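(* Let $n\ge 1$, $q>1$, and let $\mu\in\mathcal P_1(\mathbb R^n)$ satisfy $\int_{\mathbb R^n} y\,\mathrm d\mu(y)=0$ and not be supported on a hyperplane. Then the problem $$\min\Big\{\mathcal J(\varrho):=\mathcal F(\varrho)+\mathcal T(\varrho,\mu)\ :\ \varrho\in\mathcal P_1(\mathbb R^n)\Big\}$$ admits a solution, i.e. there exists $\overline\varrho\in\mathcal P_1(\mathbb R^n)$ such that $\mathcal J(\overline\varrho)\le\mathcal J(\varrho)$ for every $\varrho\in\mathcal P_1(\mathbb R^n)$.
   Context: $\mathcal P_1(\mathbb R^n)$ is the set of Borel probability measures $\varrho$ on $\mathbb R^n$ with $M_1(\varrho):=\int|x|\,\mathrm d\varrho(x)<+\infty$. "Not supported on a hyperplane" means $\mu(H)<1$ for every affine hyperplane $H\subset\mathbb R^n$. Set $\alpha=1-\frac1{n+q}\in(0,1)$ and $f(t)=-\frac1\alpha t^\alpha$ for $t\ge 0$. For a probability measure $\varrho$ on $\mathbb R^n$ with Radon-Nikodym decomposition $\varrho=\varrho^{\rm ac}(x)\,\mathrm dx+\varrho^{\rm sing}$ with respect to Lebesgue measure, $\mathcal F(\varrho):=\int_{\mathbb R^n} f(\varrho^{\rm ac}(x))\,\mathrm dx$. For probability measures $\varrho,\mu$, $\mathcal T(\varrho,\mu):=\sup\{\int_{\mathbb R^n\times\mathbb R^n} x\cdot y\,\mathrm d\gamma(x,y)\}\in[0,+\infty]$ (for $\mu$ as in the claim), the supremum being over all probability measures $\gamma$ on $\mathbb R^n\times\mathbb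 R^n$ with marginals $\varrho$ and $\mu$ for which the integral is meaningful in $[-\infty,+\infty]$. *)

theory Defs
  imports "HOL-Probability.Probability"
begin

definition P1 :: "(real ^ 'n::finite) measure set" where
  "P1 = {\<rho>. prob_space \<rho> \<and> sets \<rho> = sets borel \<and> (\<integral>\<^sup>+x. ennreal (norm x) \<partial>\<rho>) < \<infinity>}"

definition affine_hyperplane :: "(real ^ 'n::finite) set \<Rightarrow> bool" where
  "affine_hyperplane H \<longleftrightarrow> (\<exists>a b. a \<noteq> 0 \<and> H = {x. a \<bullet> x = b})"

text \<open>The integral of a measurable real function with values in \<open>[-\<infinity>, \<infinity>]\<close>, as the
  difference of the integrals of its positive and negative parts. It is meaningful unless both
  parts have infinite integral. (The Bochner integral would return the junk value 0 for a
  function that is not absolutely integrable.)\<close>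

definition integral_meaningful :: "'a measure \<Rightarrow> ('a \<Rightarrow> real) \<Rightarrow> bool" where
  "integral_meaningful M g \<longleftrightarrow> g \<in> borel_measurable M \<and>
     ((\<integral>\<^sup>+x. ennreal (g x) \<partial>M) < \<infinity> \<or> (\<integral>\<^sup>+x. ennreal (- g x) \<partial>M) < \<infinity>)"

definition ext_integral :: "'a measure \<Rightarrow> ('a \<Rightarrow> real) \<Rightarrow> ereal" where
  "ext_integral M g =
     enn2ereal (\<integral>\<^sup>+x. ennreal (g x) \<partial>M) - enn2ereal (\<integral>\<^sup>+x. ennreal (- g x) \<partial>M)"

text \<open>\<open>lebesgue_decomposition \<rho> g \<sigma>\<close>: \<open>\<rho> = g(x) dx + \<sigma>\<close> with \<open>\<sigma>\<close> singular with respect to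
  Lebesgue measure.\<close>

definition lebesgue_decomposition ::
    "(real ^ 'n::finite) measure \<Rightarrow> (real ^ 'n \<Rightarrow> real) \<Rightarrow> (real ^ 'n) measure \<Rightarrow> bool" where
  "lebesgue_decomposition \<rho> g \<sigma> \<longleftrightarrow>
     g \<in> borel_measurable borel \<and> (\<forall>x. 0 \<le> g x) \<and> sets \<sigma> = sets borel \<and>
     (\<exists>N\<in>sets borel. emeasure lborel N = 0 \<and> emeasure \<sigma> (- N) = 0) \<and>
     (\<forall>A\<in>sets borel. emeasure \<rho> A = (\<integral>\<^sup>+x\<in>A. ennreal (g x) \<partial>lborel) + emeasure \<sigma> A)"

text \<open>The density is determined only up to Lebesgue-null sets; as for \<^const>\<open>RN_deriv\<close>,
  some version of it is chosen. Existence and uniqueness are proved below.\<close>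

definition ac_density :: "(real ^ 'n::finite) measure \<Rightarrow> real ^ 'n \<Rightarrow> real" where
  "ac_density \<rho> = (SOME g. \<exists>\<sigma>. lebesgue_decomposition \<rho> g \<sigma>)"

lemma lebesgue_decomposition_exists:
  fixes \<rho> :: "(real ^ 'n::finite) measure"
  assumes "prob_space \<rho>" and sets[measurable_cong]: "sets \<rho> = sets borel"
  shows "\<exists>g \<sigma>. lebesgue_decomposition \<rho> g \<sigma>"
proof -
  interpret prob_space \<rho> by fact
  let ?S = "null_sets (lborel :: (real ^ 'n) measure)"
  have S_borel: "A \<in> sets borel" if "A \<in> ?S" for A
    using that by (auto simp: null_sets_def)
  have bdd: "bdd_above (measure \<rho> ` ?S)"
    by (rule bdd_aboveI[of _ 1]) auto
  define m where "m = (SUP A\<in>?S. measure \<rho> A)"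
  have "\<exists>A\<in>?S. m - 1 / Suc k < measure \<rho> A" for k :: nat
  proof -
    have "m - 1 / Suc k < m" by simp
    then show ?thesis
      unfolding m_def by (subst (asm) less_cSUP_iff[OF _ bdd]) auto
  qed
  then obtain B where B: "\<And>k. B k \<in> ?S" "\<And>k::nat. m - 1 / Suc k < measure \<rho> (B k)"
    by metis
  define N where "N = (\<Union>k. B k)"
  have N: "N \<in> ?S" unfolding N_def using B(1) by (rule null_sets_UN)
  note [measurable] = S_borel[OF N]
  have le_m: "measure \<rho> A \<le> m" if "A \<in> ?S" for A
    unfolding m_def using that bdd by (rule cSUP_upper)
  have m_le: "m \<le> measure \<rho> N"
  proof (rule field_le_epsilon)
    fix e :: real assume "0 < e"
    then obtain k :: nat where k: "1 / Suc k < e"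
      using nat_approx_posE by blast
    have "m - 1 / Suc k < measure \<rho> (B k)" by (rule B)
    also have "\<dots> \<le> measure \<rho> N"
      by (rule finite_measure_mono) (use S_borel[OF N] in \<open>auto simp: N_def sets\<close>)
    finally show "m \<le> measure \<rho> N + e" using k by simp
  qed
  have null: "emeasure \<rho> (A - N) = 0" if A: "A \<in> ?S" for A
  proof -
    have [measurable]: "A \<in> sets borel" using S_borel A by auto
    have "A \<union> N \<in> ?S" using A N by auto
    then have "measure \<rho> (N \<union> (A - N)) \<le> measure \<rho> N"
      using le_m[of "A \<union> N"] m_le by (simp add: Un_commute)
    moreover have "measure \<rho> (N \<union> (A - N)) = measure \<rho> N + measure \<rho> (A - N)"
      by (rule finite_measure_Union) (auto simp: sets)
    ultimately have "measure \<rho> (A - N) = 0"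
      using measure_nonneg[of \<rho> "A - N"] by linarith
    then show ?thesis by (simp add: emeasure_eq_measure)
  qed
  define \<tau> where "\<tau> = density \<rho> (indicator (- N))"
  define \<sigma> where "\<sigma> = density \<rho> (indicator N)"
  have \<tau>: "emeasure \<tau> A = emeasure \<rho> (A - N)" if [measurable]: "A \<in> sets borel" for A
    unfolding \<tau>_def
    by (subst emeasure_restricted) (auto simp: sets intro!: arg_cong[where f=\<open>emeasure \<rho>\<close>])
  have \<sigma>: "emeasure \<sigma> A = emeasure \<rho> (A \<inter> N)" if [measurable]: "A \<in> sets borel" for A
    unfolding \<sigma>_def
    by (subst emeasure_restricted) (auto simp: sets intro!: arg_cong[where f=\<open>emeasure \<rho>\<close>])
  have sets_\<tau>: "sets \<tau> = sets borel" by (simp add: \<tau>_def sets)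
  have "absolutely_continuous lborel \<tau>"
    unfolding absolutely_continuous_def
  proof
    fix A assume A: "A \<in> ?S"
    show "A \<in> null_sets \<tau>"
      by (rule null_setsI) (simp_all add: \<tau>[OF S_borel[OF A]] null[OF A] sets_\<tau> S_borel[OF A])
  qed
  then obtain h :: "real ^ 'n \<Rightarrow> ennreal" where h[measurable]: "h \<in> borel_measurable borel"
    and dh: "density lborel h = \<tau>"
    using sigma_finite_measure.Radon_Nikodym[OF lborel.sigma_finite_measure_axioms, of \<tau>] sets_\<tau> by auto
  have "(\<integral>\<^sup>+x. h x \<partial>lborel) = emeasure \<tau> UNIV"
    by (simp flip: dh add: emeasure_density)
  also have "\<dots> < \<infinity>" using \<tau>[of UNIV] by (simp add: less_top[symmetric])
  finally have "AE x in lborel. h x \<noteq> \<infinity>"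
    by (intro nn_integral_PInf_AE) auto
  then have "density lborel (\<lambda>x. ennreal (enn2real (h x))) = density lborel h"
    by (intro density_cong) (auto simp: less_top)
  then have "(\<integral>\<^sup>+x\<in>A. ennreal (enn2real (h x)) \<partial>lborel) = emeasure \<rho> (A - N)"
    if "A \<in> sets borel" for A
    using that \<tau>[OF that] dh
      emeasure_density[of "\<lambda>x. ennreal (enn2real (h x))" lborel A] by auto
  moreover have "emeasure \<rho> A = emeasure \<rho> (A - N) + emeasure \<rho> (A \<inter> N)"
    if [measurable]: "A \<in> sets borel" for A
    by (subst plus_emeasure) (auto simp: sets intro!: arg_cong[where f="emeasure \<rho>"])
  ultimately have dec: "\<forall>A\<in>sets borel. emeasure \<rho> A =
      (\<integral>\<^sup>+x\<in>A. ennreal (enn2real (h x)) \<partial>lborel) + emeasure \<sigma> A"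
    by (metis \<sigma>)
  have "emeasure \<sigma> (- N) = 0"
    by (subst \<sigma>) auto
  moreover have "emeasure lborel N = 0" using N by (rule null_setsD1)
  moreover have "sets \<sigma> = sets borel" by (simp add: \<sigma>_def sets)
  ultimately have "lebesgue_decomposition \<rho> (\<lambda>x. enn2real (h x)) \<sigma>"
    unfolding lebesgue_decomposition_def
    by (intro conjI dec bexI[of _ N] S_borel[OF N]) auto
  then show ?thesis by blast
qed

lemma lebesgue_decomposition_unique:
  fixes \<rho> :: "(real ^ 'n::finite) measure"
  assumes "prob_space \<rho>"
    and D: "lebesgue_decomposition \<rho> g \<sigma>" "lebesgue_decomposition \<rho> g' \<sigma>'"
  shows "AE x in lborel. g x = g' x"
proof -
  interpret prob_space \<rho> by fact
  note D' = D[unfolded lebesgue_decomposition_def]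
  from D' obtain N N' where N[measurable]: "N \<in> sets borel" "N' \<in> sets borel"
    and l0: "emeasure lborel N = 0" "emeasure lborel N' = 0"
    and s0: "emeasure \<sigma> (- N) = 0" "emeasure \<sigma>' (- N') = 0"
    by (elim conjE bexE)
  from D' have [measurable]: "g \<in> borel_measurable borel" "g' \<in> borel_measurable borel"
    and nonneg: "\<And>x. 0 \<le> g x" "\<And>x. 0 \<le> g' x"
    and sets: "sets \<sigma> = sets borel" "sets \<sigma>' = sets borel"
    by (elim conjE; simp)+
  note dec = D'(1)[THEN conjunct2, THEN conjunct2, THEN conjunct2, THEN conjunct2, rule_format]
    D'(2)[THEN conjunct2, THEN conjunct2, THEN conjunct2, THEN conjunct2, rule_format]
  have "N \<union> N' \<in> null_sets lborel"
    using l0 by (intro null_sets.Un null_setsI) simp_all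
  then have ae: "AE x in lborel. x \<notin> N \<union> N'" by (rule AE_not_in)
  have eq: "(\<integral>\<^sup>+x\<in>A. ennreal (k x) \<partial>lborel) = emeasure \<rho> (A - (N \<union> N'))"
    if [measurable]: "A \<in> sets borel" "k \<in> borel_measurable borel"
      and k: "\<And>A. A \<in> sets borel \<Longrightarrow> emeasure \<rho> A = (\<integral>\<^sup>+x\<in>A. ennreal (k x) \<partial>lborel) + emeasure s A"
      and s: "sets s = sets borel" "emeasure s (- M) = 0" "M \<in> sets borel" "M \<subseteq> N \<union> N'"
    for A k s M
  proof -
    have "emeasure s (A - (N \<union> N')) \<le> emeasure s (- M)"
      using s by (intro emeasure_mono) auto
    then have "emeasure \<rho> (A - (N \<union> N')) = (\<integral>\<^sup>+x\<in>A - (N \<union> N'). ennreal (k x) \<partial>lborel)"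
      using k[of "A - (N \<union> N')"] s(2) by simp
    also have "\<dots> = (\<integral>\<^sup>+x\<in>A. ennreal (k x) \<partial>lborel)"
      using ae by (intro nn_integral_cong_AE) (auto simp: indicator_def)
    finally show ?thesis by simp
  qed
  have gg: "(\<integral>\<^sup>+x\<in>A. ennreal (g x) \<partial>lborel) = (\<integral>\<^sup>+x\<in>A. ennreal (g' x) \<partial>lborel)"
    if "A \<in> sets borel" for A
    by (simp add: eq[OF that _ dec(1) sets(1) s0(1)] eq[OF that _ dec(2) sets(2) s0(2)])
  have "(\<integral>\<^sup>+x. ennreal (g x) \<partial>lborel) = emeasure \<rho> (UNIV - (N \<union> N'))"
    using eq[OF borel_open[OF open_UNIV] _ dec(1) sets(1) s0(1)] by simp
  then have fin: "(\<integral>\<^sup>+x. ennreal (g x) \<partial>lborel) \<noteq> \<infinity>" by simp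
  have "density lborel (\<lambda>x. ennreal (g x)) = density lborel (\<lambda>x. ennreal (g' x))"
    by (rule measure_eqI) (simp_all add: emeasure_density gg)
  then have "AE x in lborel. ennreal (g x) = ennreal (g' x)"
    by (subst (asm) finite_density_unique) (use fin in simp_all)
  then show ?thesis using nonneg by auto
qed

definition alpha_exp :: "'n::finite itself \<Rightarrow> real \<Rightarrow> real" where
  "alpha_exp _ q = 1 - 1 / (real CARD('n) + q)"

definition F_functional :: "real \<Rightarrow> (real ^ 'n::finite) measure \<Rightarrow> ereal" where
  "F_functional q \<rho> = (let \<alpha> = alpha_exp TYPE('n) q
     in ext_integral lborel (\<lambda>x. - (1 / \<alpha>) * ac_density \<rho> x powr \<alpha>))"

definition couplings ::
    "(real ^ 'n::finite) measure \<Rightarrow> (real ^ 'n) measure \<Rightarrow> ((real ^ 'n) \<times> (real ^ 'n)) measure set" where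
  "couplings \<rho> \<mu> = {\<gamma>. prob_space \<gamma> \<and> sets \<gamma> = sets borel \<and>
     distr \<gamma> borel fst = \<rho> \<and> distr \<gamma> borel snd = \<mu>}"

definition T_functional :: "(real ^ 'n::finite) measure \<Rightarrow> (real ^ 'n) measure \<Rightarrow> ereal" where
  "T_functional \<rho> \<mu> = Sup {ext_integral \<gamma> (\<lambda>(x, y). x \<bullet> y) | \<gamma>.
     \<gamma> \<in> couplings \<rho> \<mu> \<and> integral_meaningful \<gamma> (\<lambda>(x, y). x \<bullet> y)}"

text \<open>For \<open>q > 1\<close> and \<open>\<rho> \<in> P1\<close> the first summand is finite, so that the convention for
  \<open>- \<infinity> + \<infinity>\<close> in \<^typ>\<open>ereal\<close> is irrelevant.\<close>

definition J_functional :: "real \<Rightarrow> (real ^ 'n::finite) measure \<Rightarrow> (real ^ 'n) measure \<Rightarrow> ereal" where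
  "J_functional q \<mu> \<rho> = F_functional q \<rho> + T_functional \<rho> \<mu>"

end

theory Submission
  imports Defs
begin

text \<open>The direct method, with elementary substitutes for Kantorovich duality. A coupling whose density
  with respect to \<open>\<rho> \<otimes> \<mu>\<close> is \<open>1 + \<Sum>\<^sub>j a\<^sub>j(x) b\<^sub>j(y)\<close>, where all \<open>a\<^sub>j\<close> and \<open>b\<^sub>j\<close> have mean zero, shows
  \<open>\<T>(\<rho>, \<mu>) \<ge> \<Sum>\<^sub>j (\<integral> a\<^sub>j x d\<rho>) \<bullet> (\<integral> b\<^sub>j y d\<mu>)\<close>. Suitable signs \<open>a\<close> and \<open>b\<close> make the right-hand side at least
  \<open>c \<integral> |x| d\<rho>\<close> for centred \<open>\<rho>\<close>, because \<open>\<mu>\<close> does not live on a hyperplane. By Young's inequality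
  \<open>-\<F>\<close> is bounded by an arbitrarily small multiple of the first moment plus a constant, so first moments
  are bounded along a centred minimizing sequence; centring is harmless because both functionals are
  translation invariant when \<open>\<mu>\<close> is centred. Tightness yields a weak limit. Lower
  semicontinuity of \<open>\<T>\<close> follows by discretizing a coupling of the limit in \<open>x\<close> and transporting
  it to \<open>\<rho>\<^sub>k\<close> in the above product form; that of \<open>\<F>\<close> follows from Young's inequality with a continuous
  approximation of the optimal test function \<open>g\<^bsup>\<alpha>-1\<^esup>\<close>, \<open>g\<close> being the density of the limit.\<close>

section \<open>A space-filling curve\<close>

text \<open>The number q enters only through p = \<alpha> / (1 - \<alpha>) = n + q - 1, the exponent
  in the convex conjugate of the internal energy: q > 1 says exactly p > n, so the weight (1 + |x|)
  powr (-p) is integrable. This weight controls the tails in the coercivity estimate as well as in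
  the semicontinuity of the energy. The obstacle on the transport side is that with first moments
  only, x \<bullet> y need not be integrable under a coupling and the supremum may be infinite.
  Densities built from bounded factors avoid this: under a product measure first moments suffice,
  and the resulting lower bound involves finitely many integrals of \<rho>, which are stable under
  weak convergence for cell functions of bounded support. A weak limit of centred measures with
  bounded first moments need not be centred, because part of the mean can escape to infinity. The
  semicontinuity of the transport term therefore compares centred approximants with a limit of
  arbitrary mean.\<close>

definition triangle_wave :: "real \<Rightarrow> real" where
  "triangle_wave t = arccos (cos (pi * t)) / pi"

lemma triangle_wave_unit: "0 \<le> t \<Longrightarrow> t \<le> 1 \<Longrightarrow> triangle_wave t = t"
  by (simp add: triangle_wave_def arccos_cos mult_left_le)

lemma triangle_wave_periodic: "triangle_wave (2 * of_int k + t) = triangle_wave t"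
proof -
  have "cos (pi * (2 * of_int k + t)) = cos (2 * pi * of_int k + pi * t)"
    by (simp add: algebra_simps)
  also have "\<dots> = cos (pi * t)"
    by (simp only: cos_add cos_int_2pin sin_int_2pin mult_1 mult_zero_left diff_0_right)
  finally show ?thesis by (simp add: triangle_wave_def)
qed

lemma continuous_on_triangle_wave [continuous_intros]:
  fixes f :: "'a::t2_space \<Rightarrow> real"
  shows "continuous_on S f \<Longrightarrow> continuous_on S (\<lambda>x. triangle_wave (f x))"
  unfolding triangle_wave_def
  by (intro continuous_on_divide continuous_on_arccos continuous_on_cos continuous_on_mult
      continuous_on_const) auto

text \<open>Schoenberg's auxiliary function: 0 on [0, 1/3] and 1 on [2/3, 1], extended evenly with
  period 2. The plateaus let it read off a leading ternary digit 0 or 2 whatever the later digits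
  are.\<close>

definition schoenberg_wave :: "real \<Rightarrow> real" where
  "schoenberg_wave t = max 0 (min 1 (3 * triangle_wave t - 1))"

lemma schoenberg_wave_bounds: "0 \<le> schoenberg_wave t" "schoenberg_wave t \<le> 1"
  by (auto simp: schoenberg_wave_def)

lemma schoenberg_wave_periodic: "schoenberg_wave (2 * of_int k + t) = schoenberg_wave t"
  by (simp add: schoenberg_wave_def triangle_wave_periodic)

lemma schoenberg_wave_digit:
  assumes "c \<in> {0, 1}" "0 \<le> r" "r \<le> 1"
  shows "schoenberg_wave (2 * of_int k + (2 * c + r) / 3) = c"
  using assms by (auto simp: schoenberg_wave_def triangle_wave_periodic triangle_wave_unit)

lemma continuous_on_schoenberg_wave [continuous_intros]:
  fixes f :: "'a::t2_space \<Rightarrow> real"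
  shows "continuous_on S f \<Longrightarrow> continuous_on S (\<lambda>x. schoenberg_wave (f x))"
  unfolding schoenberg_wave_def by (intro continuous_intros)

text \<open>The witness is the point of the Cantor set with ternary digits 2 c(0), 2 c(1), ...:
  multiplication by 3^m moves digit m to the front, and what passes the ternary point is an even
  integer, hidden by the period 2. So one real number encodes any binary sequence in a form that a
  continuous function can decode.\<close>

lemma ternary_shift:
  fixes c :: "nat \<Rightarrow> real"
  assumes c: "\<And>j. c j \<in> {0, 1}"
  obtains t where "0 \<le> t" "t \<le> 1" "\<And>m. schoenberg_wave (3 ^ m * t) = c m"
proof -
  \<comment> \<open>\<open>tl m\<close> has the digits from position m on; the witness is
    \<open>tl 0\<close>.\<close>
  define tl where "tl m = (\<Sum>j. 2 * c (j + m) * (1 / 3) ^ Suc j)" for m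
  have c01: "0 \<le> c j" "c j \<le> 1" for j using c[of j] by auto
  have geo: "(\<lambda>j. 2 * (1 / 3 :: real) ^ Suc j) sums 1"
    using sums_mult[OF geometric_sums[of "1/3 :: real"], of "2/3"] by (simp add: field_simps)
  have sm: "summable (\<lambda>j. 2 * c (j + m) * (1 / 3 :: real) ^ Suc j)" for m
    by (rule summable_comparison_test_ev[OF _ sums_summable[OF geo]])
       (use c01 in \<open>auto simp: abs_mult intro!: always_eventually mult_left_le_one_le\<close>)
  have tl01: "0 \<le> tl m" "tl m \<le> 1" for m
  proof -
    show "0 \<le> tl m" unfolding tl_def using c01 by (intro suminf_nonneg sm) auto
    have "tl m \<le> (\<Sum>j. 2 * (1 / 3 :: real) ^ Suc j)" unfolding tl_def
      by (intro suminf_le sm sums_summable[OF geo]) (use c01 in \<open>auto intro!: mult_left_le_one_le\<close>)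
    then show "tl m \<le> 1" using sums_unique[OF geo] by simp
  qed
  have step: "3 * tl m = 2 * c m + tl (Suc m)" for m
  proof -
    have "tl m = (\<Sum>j. 2 * c (Suc j + m) * (1 / 3) ^ Suc (Suc j)) + 2 * c m / 3"
      unfolding tl_def using suminf_split_head[OF sm[of m]] by simp
    also have "(\<Sum>j. 2 * c (Suc j + m) * (1 / 3) ^ Suc (Suc j)) = tl (Suc m) * (1/3)"
      unfolding tl_def by (subst suminf_mult2[OF sm]) (simp add: mult_ac)
    finally show ?thesis by simp
  qed
  have "\<exists>k::int. 3 ^ m * tl 0 = 2 * of_int k + tl m" for m
  proof (induction m)
    case 0 show ?case by (intro exI[of _ 0]) simp
  next
    case (Suc m)
    then obtain k :: int where k: "3 ^ m * tl 0 = 2 * of_int k + tl m" by blast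
    obtain d :: int where d: "c m = of_int d" using c[of m] by (metis insertE of_int_0 of_int_1 singletonD)
    have "3 ^ Suc m * tl 0 = 3 * (3 ^ m * tl 0)" by simp
    also have "\<dots> = 2 * of_int (3 * k + d) + tl (Suc m)"
      unfolding k using step[of m] d by simp
    finally show ?case by blast
  qed
  note ex = this
  have "schoenberg_wave (3 ^ m * tl 0) = c m" for m
  proof -
    obtain k :: int where "3 ^ m * tl 0 = 2 * of_int k + tl m" using ex by blast
    also have "tl m = (2 * c m + tl (Suc m)) / 3" using step[of m] by simp
    finally show ?thesis using schoenberg_wave_digit[OF c tl01] by simp
  qed
  then show thesis using that tl01 by blast
qed

text \<open>The partial sums are the dyadic approximations \<lfloor>2^K x\<rfloor> / 2^K, which lie
  within 2^(-K) of x; x < 1 makes the integer part vanish.\<close>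

lemma binary_expansion:
  fixes x :: real
  assumes "0 \<le> x" "x < 1"
  shows "(\<lambda>k. (1 / 2) ^ Suc k * of_int (\<lfloor>2 ^ Suc k * x\<rfloor> mod 2)) sums x"
proof -
  have part: "(\<Sum>k<K. (1 / 2) ^ Suc k * of_int (\<lfloor>2 ^ Suc k * x\<rfloor> mod 2) :: real) = of_int \<lfloor>2 ^ K * x\<rfloor> / 2 ^ K" for K
  proof (induction K)
    case 0 have "\<lfloor>x\<rfloor> = 0" using assms by (simp add: floor_eq_iff)
    then show ?case by simp
  next
    case (Suc K)
    have "\<lfloor>2 ^ Suc K * x\<rfloor> div 2 = \<lfloor>2 ^ K * x\<rfloor>"
      using floor_divide_real_eq_div[of 2 "2 ^ Suc K * x"] by simp
    then have "\<lfloor>2 ^ Suc K * x\<rfloor> = 2 * \<lfloor>2 ^ K * x\<rfloor> + \<lfloor>2 ^ Suc K * x\<rfloor> mod 2"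
      using mult_div_mod_eq[of 2 "\<lfloor>2 ^ Suc K * x\<rfloor>"] by simp
    then have "(of_int \<lfloor>2 ^ Suc K * x\<rfloor> :: real) = 2 * of_int \<lfloor>2 ^ K * x\<rfloor> + of_int (\<lfloor>2 ^ Suc K * x\<rfloor> mod 2)"
      by (metis of_int_add of_int_mult of_int_numeral)
    then show ?case using Suc by (simp add: field_simps power_one_over)
  qed
  have "(\<lambda>K. of_int \<lfloor>2 ^ K * x\<rfloor> / 2 ^ K) \<longlonglongrightarrow> x"
  proof (rule tendsto_sandwich[of "\<lambda>K. x - (1/2)^K" _ _ "\<lambda>K. x"])
    show "\<forall>\<^sub>F K in sequentially. x - (1/2)^K \<le> of_int \<lfloor>2 ^ K * x\<rfloor> / 2 ^ K"
    proof (rule always_eventually, rule allI)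
      fix K
      have "2 ^ K * x - 1 \<le> of_int \<lfloor>2 ^ K * x\<rfloor>" by linarith
      then have "(2 ^ K * x - 1) / 2 ^ K \<le> of_int \<lfloor>2 ^ K * x\<rfloor> / 2 ^ K" by (intro divide_right_mono) auto
      then show "x - (1/2)^K \<le> of_int \<lfloor>2 ^ K * x\<rfloor> / 2 ^ K" by (simp add: diff_divide_distrib power_one_over)
    qed
    show "\<forall>\<^sub>F K in sequentially. of_int \<lfloor>2 ^ K * x\<rfloor> / 2 ^ K \<le> x"
      by (simp add: field_simps always_eventually)
    have "(\<lambda>K. (1/2 :: real)^K) \<longlonglongrightarrow> 0" by (rule LIMSEQ_power_zero) simp
    then show "(\<lambda>K. x - (1/2)^K) \<longlonglongrightarrow> x" using tendsto_diff[OF tendsto_const] by fastforce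
  qed simp
  then show ?thesis unfolding sums_def part .
qed

text \<open>Coordinate d of Schoenberg's curve in dimension N: of the sequence encoded by t it reads
  the entries at positions congruent to d modulo N as binary digits. Interleaving makes the
  coordinates independent of each other.\<close>

definition schoenberg_coord :: "nat \<Rightarrow> nat \<Rightarrow> real \<Rightarrow> real" where
  "schoenberg_coord N d t = (\<Sum>k. (1 / 2) ^ Suc k * schoenberg_wave (3 ^ (N * k + d) * t))"

lemma schoenberg_coord_periodic: "schoenberg_coord N d (2 * of_int m + t) = schoenberg_coord N d t"
proof -
  have "schoenberg_wave (3 ^ j * (2 * of_int m + t)) = schoenberg_wave (3 ^ j * t)" for j
    using schoenberg_wave_periodic[of "3 ^ j * m" "3 ^ j * t"] by (simp add: algebra_simps)
  then show ?thesis by (simp add: schoenberg_coord_def)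
qed

lemma continuous_on_schoenberg_coord: "continuous_on UNIV (schoenberg_coord N d)"
proof -
  have "uniform_limit UNIV (\<lambda>n t. \<Sum>k<n. (1 / 2) ^ Suc k * schoenberg_wave (3 ^ (N * k + d) * t))
      (\<lambda>t. \<Sum>k. (1 / 2) ^ Suc k * schoenberg_wave (3 ^ (N * k + d) * t)) sequentially"
    by (rule Weierstrass_m_test[of _ _ "\<lambda>k. (1 / 2) ^ Suc k"])
       (use schoenberg_wave_bounds in \<open>auto simp: abs_mult mult_left_le summable_geometric\<close>)
  then have "continuous_on UNIV (\<lambda>t. \<Sum>k. (1 / 2) ^ Suc k * schoenberg_wave (3 ^ (N * k + d) * t))"
    by (rule uniform_limit_theorem[rotated])
       (auto intro!: always_eventually continuous_intros)
  then show ?thesis by (simp add: schoenberg_coord_def[abs_def])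
qed

lemma schoenberg_onto:
  fixes x :: "nat \<Rightarrow> real"
  assumes "0 < N" "\<And>d. d < N \<Longrightarrow> 0 \<le> x d \<and> x d < 1"
  obtains t where "0 \<le> t" "t \<le> 1" "\<And>d. d < N \<Longrightarrow> schoenberg_coord N d t = x d"
proof -
  define c where "c j = (of_int (\<lfloor>2 ^ Suc (j div N) * x (j mod N)\<rfloor> mod 2) :: real)" for j
  have "c j \<in> {0, 1}" for j by (auto simp: c_def)
  then obtain t where t: "0 \<le> t" "t \<le> 1" "\<And>m. schoenberg_wave (3 ^ m * t) = c m"
    by (rule ternary_shift[of c]) auto
  have "schoenberg_coord N d t = x d" if "d < N" for d
    unfolding schoenberg_coord_def t(3)
    using sums_unique[OF binary_expansion[of "x d"]] assms that by (simp add: c_def)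
  with t show thesis using that by blast
qed

text \<open>The linear bound on the parameter is the point: it turns a first-moment bound in space
  into tightness on the line.\<close>

lemma space_filling_curve:
  obtains \<Psi> :: "real \<Rightarrow> real ^ 'n::finite"
  where "continuous_on UNIV \<Psi>" "\<And>x. \<exists>t\<ge>0. t \<le> 2 * norm x + 3 \<and> \<Psi> t = x"
proof -
  let ?N = "CARD('n)"
  obtain e where e: "bij_betw e (UNIV :: 'n set) {0..<?N}"
    using ex_bij_betw_finite_nat[of "UNIV :: 'n set"] by auto
  have e_less: "e i < ?N" for i using e by (auto simp: bij_betw_def)
  have e_inv: "inv_into UNIV e (e i) = i" for i using e by (simp add: bij_betw_def)
  \<comment> \<open>On [2m, 2m+1] the factor (t - triangle_wave t) / 2 is constantly m, so the curve
    covers the cube [-m, m)^n there; on [2m+1, 2m+2] the factor grows linearly to m+1, which keeps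
    the curve continuous.\<close>
  define \<Psi> :: "real \<Rightarrow> real ^ 'n" where
    "\<Psi> t = (\<chi> i. (t - triangle_wave t) / 2 * (2 * schoenberg_coord ?N (e i) t - 1))" for t
  show thesis
  proof
    show "continuous_on UNIV \<Psi>" unfolding \<Psi>_def
      by (intro continuous_intros continuous_on_vec_lambda continuous_on_schoenberg_coord) auto
    fix x :: "real ^ 'n"
    \<comment> \<open>Adding 1 makes |x_i| < m strict, so the rescaled coordinates lie in [0, 1) as
      the binary expansion requires. The parameter is then at most 2 (|x| + 1) + 1.\<close>
    define m where "m = \<lfloor>norm x\<rfloor> + 1"
    have m: "norm x < of_int m" "of_int m \<le> norm x + 1" "0 < m" using norm_ge_zero[of x] unfolding m_def by linarith+
    have xm: "\<bar>x $ i\<bar> < of_int m" for i using component_le_norm_cart[of x i] m by linarith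
    have "0 \<le> (x $ i / of_int m + 1) / 2 \<and> (x $ i / of_int m + 1) / 2 < 1" for i
      using xm[of i] m(3) by (auto simp: field_simps)
    then obtain u where u: "0 \<le> u" "u \<le> 1"
      "\<And>d. d < ?N \<Longrightarrow> schoenberg_coord ?N d u = (x $ (inv_into UNIV e d) / of_int m + 1) / 2"
      by (rule schoenberg_onto[of ?N "\<lambda>d. (x $ (inv_into UNIV e d) / of_int m + 1) / 2", rotated]) auto
    have "\<Psi> (2 * of_int m + u) = x"
      using m(3) by (simp add: \<Psi>_def vec_eq_iff triangle_wave_periodic schoenberg_coord_periodic
          triangle_wave_unit u e_less e_inv) (simp add: field_simps)
    then show "\<exists>t\<ge>0. t \<le> 2 * norm x + 3 \<and> \<Psi> t = x"
      using u m by (intro exI[of _ "2 * of_int m + u"]) auto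
  qed
qed

section \<open>Weak compactness\<close>

definition weakly_converges :: "(nat \<Rightarrow> 'a::topological_space measure) \<Rightarrow> 'a measure \<Rightarrow> bool" where
  "weakly_converges \<rho> \<rho>' \<longleftrightarrow> (\<forall>f::'a \<Rightarrow> real. continuous_on UNIV f \<longrightarrow> bounded (range f) \<longrightarrow>
     (\<lambda>k. \<integral>x. f x \<partial>\<rho> k) \<longlonglongrightarrow> (\<integral>x. f x \<partial>\<rho>'))"

text \<open>The section takes the smallest parameter of each fibre. Its sublevel set at a is the
  image of the compact interval [0, a], hence closed, which makes the section Borel.\<close>

lemma space_filling_section:
  obtains \<Psi> :: "real \<Rightarrow> real ^ 'n::finite" and s :: "real ^ 'n \<Rightarrow> real"
  where "continuous_on UNIV \<Psi>" "s \<in> borel_measurable borel"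
    "\<And>x. \<Psi> (s x) = x" "\<And>x. \<bar>s x\<bar> \<le> 2 * norm x + 3"
proof -
  obtain \<Psi> :: "real \<Rightarrow> real ^ 'n" where cont: "continuous_on UNIV \<Psi>"
    and onto: "\<And>x. \<exists>t\<ge>0. t \<le> 2 * norm x + 3 \<and> \<Psi> t = x"
    by (rule space_filling_curve) blast
  define S where "S x = {t. 0 \<le> t \<and> \<Psi> t = x}" for x
  define s where "s x = Inf (S x)" for x
  have closed: "closed (S x)" for x
  proof -
    have "closed (\<Psi> -` {x})" by (rule closed_vimage[OF closed_singleton cont])
    then have "closed ({0..} \<inter> \<Psi> -` {x})" by (intro closed_Int) auto
    also have "{0..} \<inter> \<Psi> -` {x} = S x" by (auto simp: S_def)
    finally show ?thesis .
  qed
  have bdd: "bdd_below (S x)" for x by (rule bdd_belowI[of _ 0]) (auto simp: S_def)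
  have "S x \<noteq> {}" for x using onto[of x] by (auto simp: S_def)
  then have s_in: "s x \<in> S x" for x unfolding s_def by (rule closed_contains_Inf[OF _ bdd closed])
  have le: "s x \<le> t" if "t \<in> S x" for x t unfolding s_def using that bdd by (rule cInf_lower)
  have "{x. s x \<le> a} = \<Psi> ` {0..a}" for a
  proof (intro set_eqI iffI)
    fix x assume "x \<in> {x. s x \<le> a}"
    then show "x \<in> \<Psi> ` {0..a}" using s_in[of x] by (intro image_eqI[of _ _ "s x"]) (auto simp: S_def)
  next
    fix x assume "x \<in> \<Psi> ` {0..a}"
    then obtain t where "t \<in> S x" "t \<le> a" by (auto simp: S_def)
    then show "x \<in> {x. s x \<le> a}" using le[of t x] by auto
  qed
  moreover have "closed (\<Psi> ` {0..a})" for a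
    by (intro compact_imp_closed compact_continuous_image continuous_on_subset[OF cont]) auto
  ultimately have "s \<in> borel_measurable borel"
    by (subst borel_measurable_iff_le) (auto intro: borel_closed)
  moreover have "\<bar>s x\<bar> \<le> 2 * norm x + 3" for x
  proof -
    obtain t where "t \<in> S x" "t \<le> 2 * norm x + 3" using onto[of x] by (auto simp: S_def)
    then show ?thesis using le[of t x] s_in[of x] by (auto simp: S_def)
  qed
  moreover have "\<Psi> (s x) = x" for x using s_in[of x] by (simp add: S_def)
  ultimately show thesis using that cont by blast
qed

lemma markov_norm:
  fixes \<rho> :: "'a::real_normed_vector measure"
  assumes "sets \<rho> = sets borel" "(\<integral>\<^sup>+x. ennreal (norm x) \<partial>\<rho>) \<le> ennreal M" "0 < R" "0 \<le> M"
  shows "emeasure \<rho> {x. R \<le> norm x} \<le> ennreal (M / R)"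
proof -
  note [measurable_cong] = assms(1)
  have sp: "space \<rho> = UNIV" using sets_eq_imp_space_eq[OF assms(1)] by simp
  have "emeasure \<rho> {x \<in> space \<rho>. 1 \<le> ennreal (1 / R) * ennreal (norm x)}
      \<le> ennreal (1 / R) * (\<integral>\<^sup>+x. ennreal (norm x) * indicator (space \<rho>) x \<partial>\<rho>)"
    by (rule nn_integral_Markov_inequality) auto
  also have "\<dots> \<le> ennreal (1 / R) * ennreal M"
    using assms(2) by (intro mult_left_mono) (auto simp: sp)
  also have "\<dots> = ennreal (M / R)" using assms by (simp flip: ennreal_mult add: field_simps)
  also have "{x \<in> space \<rho>. 1 \<le> ennreal (1 / R) * ennreal (norm x)} = {x. R \<le> norm x}"
    using assms(3) by (auto simp: sp field_simps simp flip: ennreal_mult)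
  finally show ?thesis .
qed

text \<open>Prokhorov's theorem in \<open>\<real>\<^sup>n\<close> is reduced to Helly's theorem on the line: the measures are
  lifted along a Borel section of a continuous surjection from the line onto \<open>\<real>\<^sup>n\<close>, and the
  limit is pushed forward again.\<close>

lemma weak_compactness:
  fixes \<rho> :: "nat \<Rightarrow> (real ^ 'n::finite) measure"
  assumes prob: "\<And>k. prob_space (\<rho> k)" and sets: "\<And>k. sets (\<rho> k) = sets borel"
    and mom: "\<And>k. (\<integral>\<^sup>+x. ennreal (norm x) \<partial>\<rho> k) \<le> ennreal M" and "0 \<le> M"
  obtains r \<rho>' where "strict_mono r" "prob_space \<rho>'" "sets \<rho>' = sets borel"
    "weakly_converges (\<rho> \<circ> r) \<rho>'"
proof -
  obtain \<Psi> :: "real \<Rightarrow> real ^ 'n" and s where cont: "continuous_on UNIV \<Psi>"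
    and s[measurable]: "s \<in> borel_measurable borel"
    and \<Psi>s: "\<And>x. \<Psi> (s x) = x" and sb: "\<And>x. \<bar>s x\<bar> \<le> 2 * norm x + 3"
    by (rule space_filling_section) blast
  have [measurable]: "\<Psi> \<in> borel_measurable borel" by (rule borel_measurable_continuous_onI[OF cont])
  note sets[measurable_cong]
  define \<nu> where "\<nu> k = distr (\<rho> k) borel s" for k
  have rd: "real_distribution (\<nu> k)" for k
    unfolding \<nu>_def real_distribution_def real_distribution_axioms_def
    using prob_space.prob_space_distr[OF prob, where f=s and M'=borel] by auto
  have "tight \<nu>" unfolding tight_def
  proof (intro conjI allI impI rd)
    fix \<epsilon> :: real assume "0 < \<epsilon>"
    \<comment> \<open>By Markov's inequality the mass outside the ball of radius R is at most M / R
      < \<epsilon>. On the ball the section is bounded by 2 R + 3, so 2 R + 4 also takes care of the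
      open end of the interval.\<close>
    define R where "R = 2 * M / \<epsilon> + 1"
    have R: "0 < R" "M / R < \<epsilon>"
      using \<open>0 < \<epsilon>\<close> \<open>0 \<le> M\<close> by (auto simp: R_def field_simps add_nonneg_pos)
    show "\<exists>a b. a < b \<and> (\<forall>n. 1 - \<epsilon> < measure (\<nu> n) {a<..b})"
    proof (intro exI conjI allI)
      show "- (2 * R + 4) < 2 * R + 4" using R by simp
      fix k
      interpret prob_space "\<rho> k" by (rule prob)
      have sp: "space (\<rho> k) = UNIV" using sets_eq_imp_space_eq[OF sets] by simp
      have "ennreal (measure (\<rho> k) {x. R \<le> norm x}) \<le> ennreal (M / R)"
        using markov_norm[OF sets[of k] mom R(1) \<open>0 \<le> M\<close>] by (simp add: emeasure_eq_measure)
      then have "measure (\<rho> k) {x. R \<le> norm x} \<le> M / R" using R \<open>0 \<le> M\<close> by simp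
      moreover have "measure (\<rho> k) (space (\<rho> k) - {x. R \<le> norm x}) = 1 - measure (\<rho> k) {x. R \<le> norm x}"
        by (rule prob_compl) (simp add: sets)
      moreover have "measure (\<rho> k) (space (\<rho> k) - {x. R \<le> norm x}) \<le> measure (\<rho> k) (s -` {- (2 * R + 4)<..2 * R + 4})"
      proof (rule finite_measure_mono)
        show "s -` {- (2 * R + 4)<..2 * R + 4} \<in> events"
          using measurable_sets[OF s, of "{- (2 * R + 4)<..2 * R + 4}"] by (simp add: sets)
        show "space (\<rho> k) - {x. R \<le> norm x} \<subseteq> s -` {- (2 * R + 4)<..2 * R + 4}"
          using sb by (auto simp: abs_le_iff) (smt (verit))+
      qed
      ultimately show "1 - \<epsilon> < measure (\<nu> k) {- (2 * R + 4)<..2 * R + 4}"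
        using R(2) by (simp add: \<nu>_def measure_distr sp)
    qed
  qed
  then obtain r N where r: "strict_mono r" and N: "real_distribution N" and w: "weak_conv_m (\<nu> \<circ> id \<circ> r) N"
    using tight_imp_convergent_subsubsequence[of \<nu> id] by (auto simp: strict_mono_id)
  interpret N: real_distribution N by fact
  define \<rho>' where "\<rho>' = distr N borel \<Psi>"
  show thesis
  proof
    show "strict_mono r" by fact
    show "prob_space \<rho>'" unfolding \<rho>'_def by (rule N.prob_space_distr) simp
    show "sets \<rho>' = sets borel" by (simp add: \<rho>'_def)
    show "weakly_converges (\<rho> \<circ> r) \<rho>'"
      unfolding weakly_converges_def
    proof (intro allI impI)
      fix f :: "real ^ 'n \<Rightarrow> real" assume f: "continuous_on UNIV f" and b: "bounded (range f)"
      then obtain B where B: "\<And>x. norm (f x) \<le> B" by (auto simp: bounded_iff)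
      have fm[measurable]: "f \<in> borel_measurable borel" by (rule borel_measurable_continuous_onI[OF f])
      \<comment> \<open>The section \<open>s\<close> need not be continuous, but only
        \<open>\<Psi>\<close> has to be: as \<open>\<Psi>\<close> undoes \<open>s\<close>, integrals
        of f against the given measures are integrals of the continuous function f \<circ> \<Psi>
        against the lifted ones.\<close>
      have "continuous_on UNIV (\<lambda>t. f (\<Psi> t))" by (rule continuous_on_compose2[OF f cont]) auto
      then have "(\<lambda>k. \<integral>t. f (\<Psi> t) \<partial>(\<nu> \<circ> id \<circ> r) k) \<longlonglongrightarrow> (\<integral>t. f (\<Psi> t) \<partial>N)"
        using w B rd N by (intro weak_conv_imp_integral_bdd_continuous_conv[where B=B])
          (auto simp: continuous_on_eq_continuous_at o_def)
      moreover have "(\<integral>t. f (\<Psi> t) \<partial>(\<nu> \<circ> id \<circ> r) k) = (\<integral>x. f x \<partial>(\<rho> \<circ> r) k)" for k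
        by (simp add: \<nu>_def integral_distr \<Psi>s)
      ultimately show "(\<lambda>k. \<integral>x. f x \<partial>(\<rho> \<circ> r) k) \<longlonglongrightarrow> (\<integral>x. f x \<partial>\<rho>')"
        by (simp add: \<rho>'_def integral_distr)
    qed
  qed
qed

section \<open>Approximation by continuous functions\<close>

lemma abs_diff_indicator_le_1:
  fixes y :: real
  shows "0 \<le> y \<Longrightarrow> y \<le> 1 \<Longrightarrow> \<bar>y - indicator A x\<bar> \<le> 1"
  by (auto simp: indicator_def)

lemma tendsto_infdist_bump:
  fixes C :: "'a::euclidean_space set"
  assumes "closed C" "C \<noteq> {}"
  shows "(\<lambda>m. max 0 (1 - real m * infdist x C)) \<longlonglongrightarrow> indicator C x"
proof (cases "x \<in> C")
  case True
  then show ?thesis by simp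
next
  case False
  then have pos: "0 < infdist x C"
    using assms infdist_nonneg[of x C] by (metis in_closed_iff_infdist_zero less_eq_real_def)
  obtain m0 :: nat where m0: "1 / infdist x C < real m0" using reals_Archimedean2 by blast
  have "\<forall>\<^sub>F m in sequentially. max 0 (1 - real m * infdist x C) = indicator C x"
  proof (rule eventually_sequentiallyI[of m0])
    fix m assume "m0 \<le> m"
    then have "1 / infdist x C < real m" using m0 by linarith
    then have "1 < real m * infdist x C" using pos by (simp add: field_simps)
    then show "max 0 (1 - real m * infdist x C) = indicator C x" using False by simp
  qed
  then show ?thesis by (rule tendsto_eventually)
qed

text \<open>Inner regularity replaces A by a compact subset, whose indicator is a decreasing limit
  of continuous bumps. Two measures are served at once, by the union of two compact sets, because
  the test function for the energy must be accurate both for the limit measure and for a weighted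
  Lebesgue measure.\<close>

lemma continuous_approx_indicator:
  fixes M N :: "'a::euclidean_space measure"
  assumes M: "finite_measure M" "sets M = sets borel" and N: "finite_measure N" "sets N = sets borel"
    and A: "A \<in> sets borel" and e: "0 < (e::real)"
  obtains f :: "'a \<Rightarrow> real" where "continuous_on UNIV f" "\<And>x. 0 \<le> f x" "\<And>x. f x \<le> 1"
    "(\<integral>x. \<bar>f x - indicator A x\<bar> \<partial>M) < e" "(\<integral>x. \<bar>f x - indicator A x\<bar> \<partial>N) < e"
proof -
  note [measurable_cong] = M(2) N(2)
  note [measurable] = A
  have inner: "\<exists>K. K \<subseteq> A \<and> compact K \<and> measure P (A - K) < e / 2"
    if P: "finite_measure P" "sets P = sets borel" for P :: "'a measure"
  proof -
    interpret finite_measure P by fact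
    have "emeasure P A = (SUP K \<in> {K. K \<subseteq> A \<and> compact K}. emeasure P K)"
      by (rule inner_regular) (use P A in \<open>auto simp: emeasure_eq_measure\<close>)
    then have "\<exists>K\<in>{K. K \<subseteq> A \<and> compact K}. emeasure P A < emeasure P K + ennreal (e / 2)"
    proof (intro SUP_approx_ennreal)
      show "emeasure P A \<noteq> \<infinity>" by simp
    qed (use e in auto)
    then obtain K where K: "K \<subseteq> A" "compact K" "emeasure P A < emeasure P K + ennreal (e / 2)" by blast
    have "measure P A < measure P K + e / 2"
      using K(3) e by (simp add: emeasure_eq_measure ennreal_less_iff flip: ennreal_plus)
    moreover have "measure P (A - K) = measure P A - measure P K"
      using K A P by (intro finite_measure_Diff) (auto intro: borel_compact)
    ultimately show ?thesis using K by (intro exI[of _ K]) auto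
  qed
  obtain K1 where K1: "K1 \<subseteq> A" "compact K1" "measure M (A - K1) < e / 2" using inner[OF M] by blast
  obtain K2 where K2: "K2 \<subseteq> A" "compact K2" "measure N (A - K2) < e / 2" using inner[OF N] by blast
  define C where "C = K1 \<union> K2"
  have C: "C \<subseteq> A" "closed C" using K1 K2 by (auto simp: C_def compact_imp_closed)
  have [measurable]: "C \<in> sets borel" using C by (rule_tac borel_closed)
  have small: "measure M (A - C) < e / 2" "measure N (A - C) < e / 2"
  proof -
    have "measure M (A - C) \<le> measure M (A - K1)"
      using K1 by (intro finite_measure.finite_measure_mono M) (auto simp: C_def M borel_compact)
    with K1 show "measure M (A - C) < e / 2" by simp
    have "measure N (A - C) \<le> measure N (A - K2)"
      using K2 by (intro finite_measure.finite_measure_mono N) (auto simp: C_def N borel_compact)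
    with K2 show "measure N (A - C) < e / 2" by simp
  qed
  have fin: "(\<integral>x. \<bar>f x - indicator A x\<bar> \<partial>P) < e"
    if P: "finite_measure P" "sets P = sets borel" and s: "measure P (A - C) < e / 2"
      and f[measurable]: "f \<in> borel_measurable borel" and b: "\<And>x. 0 \<le> f x" "\<And>x. f x \<le> 1"
      and c: "(\<integral>x. \<bar>f x - indicator C x\<bar> \<partial>P) < e / 2"
    for P and f :: "'a \<Rightarrow> real"
  proof -
    interpret finite_measure P by fact
    note [measurable_cong] = P(2)
    have i1: "integrable P (\<lambda>x. \<bar>f x - indicator C x\<bar>)"
      using b by (intro integrable_const_bound[of _ 1]) (auto intro!: AE_I2 abs_diff_indicator_le_1)
    have i2: "integrable P (indicator (A - C) :: 'a \<Rightarrow> real)"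
      by (intro integrable_real_indicator) (auto simp: less_top[symmetric])
    have "(\<integral>x. \<bar>f x - indicator A x\<bar> \<partial>P) \<le> (\<integral>x. \<bar>f x - indicator C x\<bar> + indicator (A - C) x \<partial>P)"
    proof (rule integral_mono)
      show "integrable P (\<lambda>x. \<bar>f x - indicator A x\<bar>)"
        using b by (intro integrable_const_bound[of _ 1]) (auto intro!: AE_I2 abs_diff_indicator_le_1)
      show "integrable P (\<lambda>x. \<bar>f x - indicator C x\<bar> + indicator (A - C) x)"
        using i1 i2 by (intro Bochner_Integration.integrable_add) auto
    qed (use C b in \<open>auto simp: indicator_def\<close>)
    also have "\<dots> = (\<integral>x. \<bar>f x - indicator C x\<bar> \<partial>P) + measure P (A - C)"
      using i1 i2 by (simp add: sets_eq_imp_space_eq[OF P(2)])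
    finally show ?thesis using s c by simp
  qed
  show thesis
  proof (cases "C = {}")
    \<comment> \<open>\<open>infdist\<close> to the empty set is 0 by convention, so the bumps would
      be constantly 1 here.\<close>
    case True
    then show thesis using e
      by (intro that[of "\<lambda>x. 0"] fin[OF M small(1)] fin[OF N small(2)]) auto
  next
    case False
    define f where "f m x = max 0 (1 - real m * infdist x C)" for m x
    have cont: "continuous_on UNIV (f m)" for m unfolding f_def by (intro continuous_intros)
    have [measurable]: "f m \<in> borel_measurable borel" for m
      by (rule borel_measurable_continuous_onI[OF cont])
    have b: "0 \<le> f m x" "f m x \<le> 1" for m x
      using infdist_nonneg[of x C] by (auto simp: f_def)
    have lim: "(\<lambda>m. \<integral>x. \<bar>f m x - indicator C x\<bar> \<partial>P) \<longlonglongrightarrow> (\<integral>x. 0 \<partial>P)"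
      if P: "finite_measure P" "sets P = sets borel" for P :: "'a measure"
    proof (rule integral_dominated_convergence[where w="\<lambda>_. 1"])
      note [measurable_cong] = P(2)
      interpret finite_measure P by fact
      show "integrable P (\<lambda>_. 1::real)" by simp
      show "(\<lambda>x. \<bar>f m x - indicator C x\<bar>) \<in> borel_measurable P" for m by measurable
      show "AE x in P. (\<lambda>m. \<bar>f m x - indicator C x\<bar>) \<longlonglongrightarrow> 0"
      proof (rule AE_I2)
        fix x
        have "(\<lambda>m. \<bar>f m x - indicator C x\<bar>) \<longlonglongrightarrow> \<bar>indicator C x - indicator C x\<bar>"
          unfolding f_def by (intro tendsto_intros tendsto_infdist_bump C False)
        then show "(\<lambda>m. \<bar>f m x - indicator C x\<bar>) \<longlonglongrightarrow> 0" by simp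
      qed
      show "AE x in P. norm \<bar>f m x - indicator C x\<bar> \<le> 1" for m
        using b by (auto intro!: AE_I2 abs_diff_indicator_le_1)
    qed simp
    have "\<forall>\<^sub>F m in sequentially. (\<integral>x. \<bar>f m x - indicator C x\<bar> \<partial>M) < e / 2"
         "\<forall>\<^sub>F m in sequentially. (\<integral>x. \<bar>f m x - indicator C x\<bar> \<partial>N) < e / 2"
      using order_tendstoD(2)[OF lim[OF M], of "e / 2"] order_tendstoD(2)[OF lim[OF N], of "e / 2"] e
      by simp_all
    then have "\<forall>\<^sub>F m in sequentially. (\<integral>x. \<bar>f m x - indicator C x\<bar> \<partial>M) < e / 2 \<and>
         (\<integral>x. \<bar>f m x - indicator C x\<bar> \<partial>N) < e / 2" by (rule eventually_conj)
    then obtain m where "(\<integral>x. \<bar>f m x - indicator C x\<bar> \<partial>M) < e / 2" "(\<integral>x. \<bar>f m x - indicator C x\<bar> \<partial>N) < e / 2"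
      using eventually_happens sequentially_bot by blast
    then show thesis
      by (intro that[of "f m"] fin[OF M small(1)] fin[OF N small(2)] cont b) auto
  qed
qed

text \<open>Layer-cake discretization: m layers of height K / m approximate h uniformly, and each
  superlevel set is smoothed separately. The bound K survives since every smoothed layer stays
  between 0 and K / m.\<close>

lemma continuous_approx_bounded:
  fixes M N :: "'a::euclidean_space measure" and h :: "'a \<Rightarrow> real"
  assumes M: "finite_measure M" "sets M = sets borel" and N: "finite_measure N" "sets N = sets borel"
    and h[measurable]: "h \<in> borel_measurable borel" and hb: "\<And>x. 0 \<le> h x" "\<And>x. h x \<le> K"
    and e: "0 < (e::real)" and K: "0 < K"
  obtains f :: "'a \<Rightarrow> real" where "continuous_on UNIV f" "\<And>x. 0 \<le> f x" "\<And>x. f x \<le> K"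
    "(\<integral>x. \<bar>f x - h x\<bar> \<partial>M) < e" "(\<integral>x. \<bar>f x - h x\<bar> \<partial>N) < e"
proof -
  \<comment> \<open>Error budget: the m layers, each of weight K / m and smoothing error e / (2 K),
    contribute e / 2; the uniform error K / m against a total mass below V contributes less than e /
    2.\<close>
  define V where "V = measure M (space M) + measure N (space N) + 1"
  have V: "1 \<le> V" "measure M (space M) < V" "measure N (space N) < V" by (auto simp: V_def add_nonneg_pos add_pos_nonneg)
  obtain m0 :: nat where m0: "2 * K * V / e < real m0" using reals_Archimedean2 by blast
  define m where "m = Suc m0"
  have m: "0 < m" "K / m * V < e / 2"
    using m0 e by (auto simp: m_def field_simps)
  define A where "A i = {x. real i * K / m \<le> h x}" for i
  have [measurable]: "A i \<in> sets borel" for i unfolding A_def by measurable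
  have "\<exists>f :: 'a \<Rightarrow> real. continuous_on UNIV f \<and> (\<forall>x. 0 \<le> f x \<and> f x \<le> 1) \<and>
    (\<integral>x. \<bar>f x - indicator (A i) x\<bar> \<partial>M) < e / (2 * K) \<and> (\<integral>x. \<bar>f x - indicator (A i) x\<bar> \<partial>N) < e / (2 * K)" for i
    by (rule continuous_approx_indicator[OF M N, of "A i" "e / (2 * K)"]) (use e K in auto)
  then have "\<exists>f. \<forall>i. continuous_on UNIV (f i) \<and> (\<forall>x. 0 \<le> f i x \<and> f i x \<le> (1::real)) \<and>
    (\<integral>x. \<bar>f i x - indicator (A i) x\<bar> \<partial>M) < e / (2 * K) \<and> (\<integral>x. \<bar>f i x - indicator (A i) x\<bar> \<partial>N) < e / (2 * K)"
    by (intro choice allI)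
  then obtain f where f: "\<And>i. continuous_on UNIV (f i)" "\<And>i x. 0 \<le> f i x \<and> f i x \<le> (1::real)"
    "\<And>i. (\<integral>x. \<bar>f i x - indicator (A i) x\<bar> \<partial>M) < e / (2 * K)"
    "\<And>i. (\<integral>x. \<bar>f i x - indicator (A i) x\<bar> \<partial>N) < e / (2 * K)" by blast
  have [measurable]: "f i \<in> borel_measurable borel" for i
    by (rule borel_measurable_continuous_onI[OF f(1)])
  let ?F = "\<lambda>x. \<Sum>i=1..m. K / m * f i x" and ?S = "\<lambda>x. \<Sum>i=1..m. K / m * indicator (A i) x :: real"
  have near: "\<bar>?S x - h x\<bar> \<le> K / m" for x
  proof -
    define j where "j = nat \<lfloor>h x * m / K\<rfloor>"
    have j: "real j \<le> h x * m / K" "h x * m / K < real j + 1"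
      using hb[of x] K unfolding j_def by (auto simp: floor_less_iff)
    have "h x * m \<le> K * m" using hb[of x] by (intro mult_right_mono) auto
    then have "h x * m / K \<le> m" using K by (simp add: field_simps)
    then have jm: "j \<le> m" using j by linarith
    have iff: "x \<in> A i \<longleftrightarrow> i \<le> j" for i
    proof -
      have "x \<in> A i \<longleftrightarrow> real i \<le> h x * m / K" using K m(1) by (simp add: A_def field_simps)
      also have "\<dots> \<longleftrightarrow> i \<le> j" using j by linarith
      finally show ?thesis .
    qed
    have "?S x = (\<Sum>i=1..m. if i \<le> j then K / m else 0)" by (intro sum.cong) (auto simp: iff indicator_def)
    also have "\<dots> = (\<Sum>i=1..j. K / m)" using jm by (intro sum.mono_neutral_cong_right) auto
    also have "\<dots> = K / m * j" by simp
    finally have S: "?S x = K / m * j" .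
    have "K / m * j \<le> h x" using j(1) K m(1) by (simp add: field_simps)
    moreover have "h x \<le> K / m * j + K / m" using j(2) K m(1) by (simp add: field_simps)
    ultimately show ?thesis unfolding S by linarith
  qed
  have fin: "(\<integral>x. \<bar>?F x - h x\<bar> \<partial>P) < e"
    if P: "finite_measure P" "sets P = sets borel" and PV: "measure P (space P) < V"
      and c: "\<And>i. (\<integral>x. \<bar>f i x - indicator (A i) x\<bar> \<partial>P) < e / (2 * K)" for P
  proof -
    interpret finite_measure P by fact
    note [measurable_cong] = P(2)
    have i1: "integrable P (\<lambda>x. \<bar>f i x - indicator (A i) x\<bar>)" for i
      using f(2) by (intro integrable_const_bound[of _ 1]) (auto intro!: AE_I2 abs_diff_indicator_le_1)
    have FK: "\<bar>?F x\<bar> \<le> m * (K/m * 1)" for x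
    proof -
      have "\<bar>?F x\<bar> \<le> (\<Sum>i=1..m. \<bar>K / m * f i x\<bar>)" by (rule sum_abs)
      also have "\<dots> \<le> (\<Sum>i=1..m. K / m * 1)" using f(2) K
        by (intro sum_mono) (auto simp: abs_mult intro!: divide_right_mono mult_left_le)
      finally show ?thesis by simp
    qed
    have "(\<integral>x. \<bar>?F x - h x\<bar> \<partial>P) \<le> (\<integral>x. (\<Sum>i=1..m. K / m * \<bar>f i x - indicator (A i) x\<bar>) + K / m \<partial>P)"
    proof (rule integral_mono)
      show "integrable P (\<lambda>x. \<bar>?F x - h x\<bar>)"
      proof (rule integrable_const_bound[of _ "m * (K/m*1) + K"])
        show "AE x in P. norm \<bar>?F x - h x\<bar> \<le> m * (K/m*1) + K"
          using FK hb by (intro AE_I2) (smt (verit) real_norm_def)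
      qed measurable
      show "integrable P (\<lambda>x. (\<Sum>i=1..m. K / m * \<bar>f i x - indicator (A i) x\<bar>) + K / m)"
        using i1 by (intro Bochner_Integration.integrable_add Bochner_Integration.integrable_sum integrable_mult_right) auto
      fix x
      have "\<bar>?F x - ?S x\<bar> \<le> (\<Sum>i=1..m. \<bar>K / m * (f i x - indicator (A i) x)\<bar>)"
        unfolding sum_subtractf[symmetric] right_diff_distrib[symmetric] by (rule sum_abs)
      also have "\<dots> = (\<Sum>i=1..m. K / m * \<bar>f i x - indicator (A i) x\<bar>)" using K by (simp add: abs_mult)
      finally show "\<bar>?F x - h x\<bar> \<le> (\<Sum>i=1..m. K / m * \<bar>f i x - indicator (A i) x\<bar>) + K / m"
        using near[of x] by linarith
    qed
    also have "\<dots> = (\<Sum>i=1..m. K / m * (\<integral>x. \<bar>f i x - indicator (A i) x\<bar> \<partial>P)) + K / m * measure P (space P)"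
      using i1 by (simp add: Bochner_Integration.integral_add Bochner_Integration.integral_sum)
    also have "(\<Sum>i=1..m. K / m * (\<integral>x. \<bar>f i x - indicator (A i) x\<bar> \<partial>P)) \<le> (\<Sum>i=1..m. K / m * (e / (2 * K)))"
      using c K by (intro sum_mono mult_left_mono) (auto simp: less_imp_le)
    also have "\<dots> = e / 2" using K m(1) by (simp add: field_simps)
    also have "K / m * measure P (space P) \<le> K / m * V" using PV K by (intro mult_left_mono) auto
    finally show ?thesis using m(2) by linarith
  qed
  show thesis
  proof (rule that[of ?F])
    show "continuous_on UNIV ?F" by (intro continuous_intros f)
    show "0 \<le> ?F x" for x using f(2) K by (intro sum_nonneg) auto
    show "?F x \<le> K" for x
    proof -
      have "?F x \<le> (\<Sum>i=1..m. K / m * 1)" using f(2) K by (intro sum_mono mult_left_mono) auto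
      also have "\<dots> = K" using m(1) by simp
      finally show ?thesis .
    qed
    show "(\<integral>x. \<bar>?F x - h x\<bar> \<partial>M) < e" by (rule fin[OF M V(2) f(3)])
    show "(\<integral>x. \<bar>?F x - h x\<bar> \<partial>N) < e" by (rule fin[OF N V(3) f(4)])
  qed
qed

section \<open>The internal energy\<close>

text \<open>Minus the internal energy, so that it takes values in \<open>ennreal\<close>. Coercivity
  thus becomes an upper bound, and lower semicontinuity becomes upper semicontinuity.\<close>

definition power_energy :: "real \<Rightarrow> (real ^ 'n::finite) measure \<Rightarrow> ennreal" where
  "power_energy \<alpha> \<rho> = (\<integral>\<^sup>+x. ennreal (1 / \<alpha> * ac_density \<rho> x powr \<alpha>) \<partial>lborel)"

lemma F_functional_eq:
  fixes \<rho> :: "(real ^ 'n::finite) measure"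
  assumes "0 < alpha_exp TYPE('n) q"
  shows "F_functional q \<rho> = - enn2ereal (power_energy (alpha_exp TYPE('n) q) \<rho>)"
proof -
  have "ennreal (- (1 / alpha_exp TYPE('n) q) * ac_density \<rho> x powr alpha_exp TYPE('n) q) = 0" for x
    using assms by (intro ennreal_neg) simp
  then show ?thesis
    by (simp add: F_functional_def ext_integral_def power_energy_def Let_def zero_ennreal.rep_eq)
qed

lemma ac_density_decomposition:
  fixes \<rho> :: "(real ^ 'n::finite) measure"
  assumes "prob_space \<rho>" "sets \<rho> = sets borel"
  obtains \<sigma> where "lebesgue_decomposition \<rho> (ac_density \<rho>) \<sigma>"
proof -
  have "\<exists>g \<sigma>. lebesgue_decomposition \<rho> g \<sigma>" using assms by (rule lebesgue_decomposition_exists)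
  then have "\<exists>\<sigma>. lebesgue_decomposition \<rho> (ac_density \<rho>) \<sigma>"
    unfolding ac_density_def by (rule someI_ex)
  then show thesis using that by blast
qed

lemma nn_integral_decomposition_le:
  fixes \<rho> :: "(real ^ 'n::finite) measure"
  assumes D: "lebesgue_decomposition \<rho> g \<sigma>" and s: "sets \<rho> = sets borel"
    and [measurable]: "h \<in> borel_measurable borel"
  shows "(\<integral>\<^sup>+x. ennreal (g x) * h x \<partial>lborel) \<le> (\<integral>\<^sup>+x. h x \<partial>\<rho>)"
proof -
  note D = D[unfolded lebesgue_decomposition_def]
  have [measurable]: "g \<in> borel_measurable borel" using D by simp
  have "(\<integral>\<^sup>+x. ennreal (g x) * h x \<partial>lborel) = (\<integral>\<^sup>+x. h x \<partial>density lborel (\<lambda>x. ennreal (g x)))"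
    by (simp add: nn_integral_density)
  also have "\<dots> \<le> (\<integral>\<^sup>+x. h x \<partial>\<rho>)"
    by (rule nn_integral_mono_measure)
       (use D s in \<open>auto simp: le_measure emeasure_density\<close>)
  finally show ?thesis .
qed

text \<open>Weighted AM-GM for \<psi> t and \<psi> powr (-\<alpha> / (1 - \<alpha>)) with weights
  \<alpha> and 1 - \<alpha>; the powers of \<psi> cancel in the geometric mean. For t > 0 equality
  holds at \<psi> = t powr (\<alpha> - 1), which later dictates the test function.\<close>

lemma young_power:
  fixes \<alpha> t \<psi> :: real
  assumes "0 < \<alpha>" "\<alpha> < 1" "0 \<le> t" "0 < \<psi>"
  shows "1 / \<alpha> * t powr \<alpha> \<le> \<psi> * t + (1 / \<alpha> - 1) * \<psi> powr (- (\<alpha> / (1 - \<alpha>)))"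
proof (cases "t = 0")
  case True
  then show ?thesis using assms by simp
next
  case False
  let ?v = "\<psi> powr (- (\<alpha> / (1 - \<alpha>)))"
  have "(\<psi> * t) powr \<alpha> * ?v powr (1 - \<alpha>) \<le> \<alpha> * (\<psi> * t) + (1 - \<alpha>) * ?v"
    using assms False by (intro Youngs_inequality_0) auto
  moreover have "(\<psi> * t) powr \<alpha> * ?v powr (1 - \<alpha>) = t powr \<alpha>"
  proof -
    have "- (\<alpha> / (1 - \<alpha>)) * (1 - \<alpha>) = - \<alpha>" using assms by simp
    then have "?v powr (1 - \<alpha>) = \<psi> powr - \<alpha>" by (simp only: powr_powr)
    then have "(\<psi> * t) powr \<alpha> * ?v powr (1 - \<alpha>) = t powr \<alpha> * (\<psi> powr \<alpha> * \<psi> powr - \<alpha>)"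
      using assms by (simp add: powr_mult)
    also have "\<psi> powr \<alpha> * \<psi> powr - \<alpha> = 1" using assms by (simp flip: powr_add)
    finally show ?thesis by simp
  qed
  ultimately show ?thesis using assms by (simp add: field_simps)
qed

text \<open>Young's inequality integrated with the density as t. Passing from the absolutely
  continuous part to all of \<rho> in the linear term goes in the right direction and leaves a plain
  integral against \<rho>, accessible to weak convergence; the other term does not depend on
  \<rho>.\<close>

lemma power_energy_le:
  fixes \<rho> :: "(real ^ 'n::finite) measure"
  assumes "prob_space \<rho>" "sets \<rho> = sets borel" "0 < \<alpha>" "\<alpha> < 1"
    and \<psi>[measurable]: "\<psi> \<in> borel_measurable borel" and pos: "\<And>x. 0 < \<psi> x"
  shows "power_energy \<alpha> \<rho> \<le> (\<integral>\<^sup>+x. ennreal (\<psi> x) \<partial>\<rho>)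
    + (\<integral>\<^sup>+x. ennreal ((1 / \<alpha> - 1) * \<psi> x powr (- (\<alpha> / (1 - \<alpha>)))) \<partial>lborel)"
proof -
  obtain \<sigma> where D: "lebesgue_decomposition \<rho> (ac_density \<rho>) \<sigma>"
    using assms ac_density_decomposition by blast
  have [measurable]: "ac_density \<rho> \<in> borel_measurable borel" and nn: "0 \<le> ac_density \<rho> x" for x
    using D by (auto simp: lebesgue_decomposition_def)
  have "power_energy \<alpha> \<rho> \<le> (\<integral>\<^sup>+x. ennreal (ac_density \<rho> x) * ennreal (\<psi> x)
      + ennreal ((1 / \<alpha> - 1) * \<psi> x powr (- (\<alpha> / (1 - \<alpha>)))) \<partial>lborel)"
    unfolding power_energy_def
  proof (rule nn_integral_mono)
    fix x
    show "ennreal (1 / \<alpha> * ac_density \<rho> x powr \<alpha>) \<le> ennreal (ac_density \<rho> x) * ennreal (\<psi> x)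
      + ennreal ((1 / \<alpha> - 1) * \<psi> x powr (- (\<alpha> / (1 - \<alpha>))))"
      using young_power[OF assms(3,4) nn[of x] pos[of x]] nn[of x] pos[of x] assms(3,4)
      by (simp add: mult.commute flip: ennreal_mult ennreal_plus)
  qed
  also have "\<dots> = (\<integral>\<^sup>+x. ennreal (ac_density \<rho> x) * ennreal (\<psi> x) \<partial>lborel)
    + (\<integral>\<^sup>+x. ennreal ((1 / \<alpha> - 1) * \<psi> x powr (- (\<alpha> / (1 - \<alpha>)))) \<partial>lborel)"
    by (rule nn_integral_add) auto
  also have "(\<integral>\<^sup>+x. ennreal (ac_density \<rho> x) * ennreal (\<psi> x) \<partial>lborel) \<le> (\<integral>\<^sup>+x. ennreal (\<psi> x) \<partial>\<rho>)"
    by (rule nn_integral_decomposition_le[OF D assms(2)]) simp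
  finally show ?thesis by (simp add: add_right_mono)
qed

text \<open>Dyadic shells: where 2^k \<le> 1 + |x| < 2^(k+1) the weight is at most 2^(-kp), and the
  ball of radius 2^(k+1) has volume of order 2^(kn), so a geometric series of ratio 2^(n-p) < 1
  dominates.\<close>

lemma weight_integrable:
  fixes p :: real
  assumes p: "real DIM('a::euclidean_space) < p"
  shows "(\<integral>\<^sup>+x. ennreal ((1 + norm (x::'a)) powr - p) \<partial>lborel) < \<infinity>"
proof -
  let ?n = "DIM('a)" and ?V = "unit_ball_vol (real DIM('a))"
  define f where "f k x = ennreal ((2 ^ k) powr - p) * indicator (ball 0 (2 ^ Suc k)) x" for k and x :: 'a
  have f_meas: "f k \<in> borel_measurable lborel" for k
    unfolding f_def[abs_def]
    by (intro borel_measurable_times_ennreal borel_measurable_const borel_measurable_indicator) simp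
  have "ennreal ((1 + norm x) powr - p) \<le> (\<Sum>k. f k x)" for x
  proof -
    define k where "k = nat \<lfloor>log 2 (1 + norm x)\<rfloor>"
    have "0 < 1 + norm x" by (simp add: add_pos_nonneg)
    then have "0 \<le> log 2 (1 + norm x)" by simp
    then have k: "real k \<le> log 2 (1 + norm x)" "log 2 (1 + norm x) < real k + 1"
      unfolding k_def by linarith+
    have 1: "2 ^ k \<le> 1 + norm x"
      using k(1) \<open>0 < 1 + norm x\<close> by (simp add: le_log_iff powr_realpow)
    have "1 + norm x < 2 powr (real k + 1)"
      using k(2) \<open>0 < 1 + norm x\<close> by (simp add: log_less_iff)
    then have 2: "1 + norm x < 2 ^ Suc k" by (simp add: powr_add powr_realpow)
    have "ennreal ((1 + norm x) powr - p) \<le> ennreal ((2 ^ k) powr - p)"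
      using 1 p by (intro ennreal_leI powr_mono2') auto
    also have "\<dots> = f k x" using 2 by (simp add: f_def indicator_def)
    also have "\<dots> = (\<Sum>k\<in>{k}. f k x)" by simp
    also have "\<dots> \<le> (\<Sum>k. f k x)" by (rule sum_le_suminf) auto
    finally show ?thesis .
  qed
  then have "(\<integral>\<^sup>+x. ennreal ((1 + norm (x::'a)) powr - p) \<partial>lborel) \<le> (\<integral>\<^sup>+x. (\<Sum>k. f k x) \<partial>lborel)"
    by (rule nn_integral_mono)
  also have "\<dots> = (\<Sum>k. \<integral>\<^sup>+x. f k x \<partial>lborel)"
    by (rule nn_integral_suminf[OF f_meas])
  also have "\<dots> = (\<Sum>k. ennreal (?V * 2 ^ ?n * (2 powr (?n - p)) ^ k))"
  proof (rule suminf_cong)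
    fix k
    have "(\<integral>\<^sup>+x. f k x \<partial>lborel) = ennreal ((2 ^ k) powr - p) * ennreal (?V * (2 ^ Suc k) ^ ?n)"
      unfolding f_def
      by (subst nn_integral_cmult_indicator) (auto simp: emeasure_ball simp del: power_Suc)
    also have "\<dots> = ennreal ((2 ^ k) powr - p * (?V * (2 ^ Suc k) ^ ?n))"
      by (rule ennreal_mult[symmetric]) auto
    also have "(2 ^ k) powr - p * (?V * (2 ^ Suc k) ^ ?n) = ?V * 2 ^ ?n * (2 powr (?n - p)) ^ k"
    proof -
      have "(2 ^ k :: real) powr - p = 2 powr (- p * k)" by (simp add: powr_powr mult.commute flip: powr_realpow)
      moreover have "(2 ^ Suc k :: real) ^ ?n = 2 ^ ?n * 2 powr (?n * k)"
        by (simp add: powr_realpow[symmetric] powr_powr power_mult_distrib mult.commute flip: power_mult of_nat_mult)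
      moreover have "(2 powr (?n - p)) ^ k = 2 powr (- p * k) * (2 powr (?n * k))"
        by (simp add: powr_power algebra_simps flip: powr_add)
      ultimately show ?thesis by simp
    qed
    finally show "(\<integral>\<^sup>+x. f k x \<partial>lborel) = ennreal (?V * 2 ^ ?n * (2 powr (?n - p)) ^ k)" .
  qed
  also have "\<dots> < \<infinity>"
  proof -
    have "2 powr (?n - p) < (1::real)" using p by (simp add: powr_less_one)
    then have "summable (\<lambda>k. ?V * 2 ^ ?n * (2 powr (?n - p)) ^ k)"
      by (intro summable_mult summable_geometric) auto
    then show ?thesis by (subst suminf_ennreal2) auto
  qed
  finally show ?thesis .
qed

text \<open>Test function \<psi> = s (1 + |x|): the linear term gives s plus s times the first
  moment, and the conjugate term is finite by integrability of the weight. A small s is paid for by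
  a large C.\<close>

lemma power_energy_coercive:
  fixes \<alpha> s :: real
  assumes \<alpha>: "0 < \<alpha>" "\<alpha> < 1" "real CARD('n::finite) < \<alpha> / (1 - \<alpha>)" and s: "0 < s"
  obtains C where "0 \<le> C" "\<And>\<rho> :: (real ^ 'n) measure. \<rho> \<in> P1 \<Longrightarrow>
    power_energy \<alpha> \<rho> \<le> ennreal s * (\<integral>\<^sup>+x. ennreal (norm x) \<partial>\<rho>) + ennreal C"
proof -
  let ?p = "\<alpha> / (1 - \<alpha>)"
  define W where "W = (\<integral>\<^sup>+x. ennreal ((1 + norm (x::real ^ 'n)) powr - ?p) \<partial>lborel)"
  have W: "W < \<infinity>" unfolding W_def using weight_integrable[where 'a="real ^ 'n"] \<alpha>(3) by simp
  let ?c = "(1 / \<alpha> - 1) * s powr - ?p"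
  define C where "C = enn2real (ennreal s + ennreal ?c * W)"
  have C: "ennreal C = ennreal s + ennreal ?c * W"
    unfolding C_def using W by (intro ennreal_enn2real) (simp add: ennreal_mult_less_top)
  show thesis
  proof
    show "0 \<le> C" by (simp add: C_def)
    fix \<rho> :: "(real ^ 'n) measure" assume "\<rho> \<in> P1"
    then have P: "prob_space \<rho>" and sets: "sets \<rho> = sets borel" by (auto simp: P1_def)
    note sets[measurable_cong]
    interpret prob_space \<rho> by fact
    have "power_energy \<alpha> \<rho> \<le> (\<integral>\<^sup>+x. ennreal (s * (1 + norm x)) \<partial>\<rho>)
        + (\<integral>\<^sup>+x. ennreal ((1 / \<alpha> - 1) * (s * (1 + norm (x::real ^ 'n))) powr (- ?p)) \<partial>lborel)"
      by (rule power_energy_le[OF P sets \<alpha>(1,2)]) (use s in \<open>auto simp: add_pos_nonneg\<close>)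
    also have "(\<integral>\<^sup>+x. ennreal (s * (1 + norm x)) \<partial>\<rho>) = (\<integral>\<^sup>+x. ennreal s + ennreal s * ennreal (norm x) \<partial>\<rho>)"
      using s by (intro nn_integral_cong) (simp add: distrib_left ennreal_mult')
    also have "\<dots> = ennreal s + ennreal s * (\<integral>\<^sup>+x. ennreal (norm x) \<partial>\<rho>)"
      by (simp add: nn_integral_add nn_integral_cmult emeasure_space_1)
    also have "(\<integral>\<^sup>+x. ennreal ((1 / \<alpha> - 1) * (s * (1 + norm (x::real ^ 'n))) powr (- ?p)) \<partial>lborel)
        = (\<integral>\<^sup>+x. ennreal ?c * ennreal ((1 + norm (x::real ^ 'n)) powr - ?p) \<partial>lborel)"
      using s \<alpha> by (intro nn_integral_cong)
        (simp add: powr_mult flip: ennreal_mult)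
    also have "\<dots> = ennreal ?c * W" unfolding W_def by (rule nn_integral_cmult) simp
    finally show "power_energy \<alpha> \<rho> \<le> ennreal s * (\<integral>\<^sup>+x. ennreal (norm x) \<partial>\<rho>) + ennreal C"
      unfolding C by (simp add: ac_simps)
  qed
qed

text \<open>Mean value theorem for z powr (-p), whose slope beyond d is at most p d powr (-p - 1) in
  absolute value. The shift by d keeps both arguments away from the singularity at 0.\<close>

lemma powr_minus_shift_le:
  fixes a b d p :: real
  assumes "0 \<le> a" "0 \<le> b" "0 < d" "0 < p"
  shows "(a + d) powr - p \<le> (b + d) powr - p + p * d powr (- p - 1) * \<bar>a - b\<bar>"
proof (cases "b \<le> a")
  case True
  then have "(a + d) powr - p \<le> (b + d) powr - p" using assms by (intro powr_mono2') auto
  then show ?thesis using assms by (simp add: add_increasing2)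
next
  case False
  have "\<exists>z. a + d < z \<and> z < b + d \<and>
      (b + d) powr - p - (a + d) powr - p = ((b + d) - (a + d)) * (- p * z powr (- p - 1))"
    using False assms by (intro MVT2) (auto intro!: derivative_eq_intros)
  then obtain z where z: "a + d < z"
    "(b + d) powr - p - (a + d) powr - p = (b - a) * (- p * z powr (- p - 1))" by auto
  have "z powr (- p - 1) \<le> d powr (- p - 1)" using z assms by (intro powr_mono2') auto
  then have "(b - a) * (p * z powr (- p - 1)) \<le> (b - a) * (p * d powr (- p - 1))"
    using False assms by (intro mult_left_mono) auto
  then show ?thesis using z(2) False by (simp add: algebra_simps)
qed

text \<open>N carries the singular part, so \<rho> and its absolutely continuous part agree on
  functions vanishing on N.\<close>

lemma nn_integral_decomposition_off_null:
  fixes \<rho> :: "(real ^ 'n::finite) measure"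
  assumes D: "lebesgue_decomposition \<rho> g \<sigma>" and s: "sets \<rho> = sets borel"
  obtains N where "N \<in> sets borel" "emeasure lborel N = 0"
    "\<And>h. h \<in> borel_measurable borel \<Longrightarrow> (\<And>x. x \<in> N \<Longrightarrow> h x = 0) \<Longrightarrow>
       (\<integral>\<^sup>+x. h x \<partial>\<rho>) = (\<integral>\<^sup>+x. ennreal (g x) * h x \<partial>lborel)"
proof -
  note D = D[unfolded lebesgue_decomposition_def]
  have [measurable]: "g \<in> borel_measurable borel" and s\<sigma>: "sets \<sigma> = sets borel"
    and dec: "\<And>A. A \<in> sets borel \<Longrightarrow> emeasure \<rho> A = (\<integral>\<^sup>+x\<in>A. ennreal (g x) \<partial>lborel) + emeasure \<sigma> A"
    using D by simp_all
  obtain N where N[measurable]: "N \<in> sets borel" and N0: "emeasure lborel N = 0" "emeasure \<sigma> (- N) = 0"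
    using D by blast
  note [measurable_cong] = s
  have eq: "density \<rho> (indicator (- N)) = density lborel (\<lambda>x. ennreal (g x) * indicator (- N) x)"
  proof (rule measure_eqI)
    fix A assume "A \<in> sets (density \<rho> (indicator (- N)))"
    then have [measurable]: "A \<in> sets borel" by (simp add: s)
    have "emeasure \<sigma> (A - N) \<le> emeasure \<sigma> (- N)" by (rule emeasure_mono) (auto simp: s\<sigma>)
    then have "emeasure \<sigma> (A - N) = 0" using N0 by simp
    moreover have "emeasure (density \<rho> (indicator (- N))) A = emeasure \<rho> (- N \<inter> A)"
      by (rule emeasure_restricted) (auto simp: s)
    moreover have "- N \<inter> A = A - N" by auto
    ultimately have "emeasure (density \<rho> (indicator (- N))) A = (\<integral>\<^sup>+x\<in>A - N. ennreal (g x) \<partial>lborel)"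
      by (simp add: dec)
    also have "\<dots> = emeasure (density lborel (\<lambda>x. ennreal (g x) * indicator (- N) x)) A"
      by (subst emeasure_density) (auto intro!: nn_integral_cong simp: indicator_def)
    finally show "emeasure (density \<rho> (indicator (- N))) A =
      emeasure (density lborel (\<lambda>x. ennreal (g x) * indicator (- N) x)) A" .
  qed (simp add: s)
  show thesis
  proof (rule that[OF N N0(1)])
    fix h :: "real ^ 'n \<Rightarrow> ennreal" assume [measurable]: "h \<in> borel_measurable borel" and z: "\<And>x. x \<in> N \<Longrightarrow> h x = 0"
    have "(\<integral>\<^sup>+x. h x \<partial>\<rho>) = (\<integral>\<^sup>+x. indicator (- N) x * h x \<partial>\<rho>)"
      using z by (intro nn_integral_cong) (auto simp: indicator_def)
    also have "\<dots> = (\<integral>\<^sup>+x. h x \<partial>density \<rho> (indicator (- N)))" by (subst nn_integral_density) auto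
    also have "\<dots> = (\<integral>\<^sup>+x. ennreal (g x) * indicator (- N) x * h x \<partial>lborel)"
      unfolding eq by (subst nn_integral_density) auto
    also have "\<dots> = (\<integral>\<^sup>+x. ennreal (g x) * h x \<partial>lborel)"
      using z by (intro nn_integral_cong) (auto simp: indicator_def)
    finally show "(\<integral>\<^sup>+x. h x \<partial>\<rho>) = (\<integral>\<^sup>+x. ennreal (g x) * h x \<partial>lborel)" .
  qed
qed

text \<open>Young's inequality with \<psi> = f + s (1 + |x|), f continuous, bounded and close to g
  powr (\<alpha> - 1). For \<rho>' this is nearly an equality; for \<rho> k, apart from the
  uniformly bounded moment term, only the integral of f depends on k, and it converges. The summand
  s (1 + |x|) makes the conjugate term integrable at infinity.\<close>

lemma power_energy_usc:
  fixes \<rho> :: "nat \<Rightarrow> (real ^ 'n::finite) measure" and \<alpha> M e :: real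
  assumes \<alpha>: "0 < \<alpha>" "\<alpha> < 1" "real CARD('n) < \<alpha> / (1 - \<alpha>)"
    and prob: "\<And>k. prob_space (\<rho> k)" and sets: "\<And>k. sets (\<rho> k) = sets borel"
    and mom: "\<And>k. (\<integral>\<^sup>+x. ennreal (norm x) \<partial>\<rho> k) \<le> ennreal M" and "0 \<le> M"
    and prob': "prob_space \<rho>'" and sets': "sets \<rho>' = sets borel"
    and w: "weakly_converges \<rho> \<rho>'" and fin: "power_energy \<alpha> \<rho>' < \<infinity>" and e: "0 < e"
  shows "\<forall>\<^sub>F k in sequentially. power_energy \<alpha> (\<rho> k) \<le> power_energy \<alpha> \<rho>' + ennreal e"
proof -
  define p where "p = \<alpha> / (1 - \<alpha>)"
  define c where "c = 1 / \<alpha> - 1"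
  have p: "0 < p" "real CARD('n) < p" using \<alpha> by (auto simp: p_def)
  have c: "0 < c" using \<alpha> by (simp add: c_def)
  have pexp: "(\<alpha> - 1) * (- p) = \<alpha>" using \<alpha> by (simp add: p_def field_simps)
  define g where "g = ac_density \<rho>'"
  obtain \<sigma> where D: "lebesgue_decomposition \<rho>' g \<sigma>"
    unfolding g_def using prob' sets' by (rule ac_density_decomposition)
  have gm[measurable]: "g \<in> borel_measurable borel" and g0: "\<And>x. 0 \<le> g x"
    using D by (auto simp: lebesgue_decomposition_def)
  obtain N where N[measurable]: "N \<in> sets borel" and N0: "emeasure lborel N = 0"
    and dec: "\<And>h. h \<in> borel_measurable borel \<Longrightarrow> (\<And>x. x \<in> N \<Longrightarrow> h x = 0) \<Longrightarrow>
       (\<integral>\<^sup>+x. h x \<partial>\<rho>') = (\<integral>\<^sup>+x. ennreal (g x) * h x \<partial>lborel)"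
    by (rule nn_integral_decomposition_off_null[OF D sets']) blast
  define wt where "wt x = 1 + norm x" for x :: "real ^ 'n"
  have wt: "1 \<le> wt x" for x by (simp add: wt_def)
  have wt0: "0 < wt x" for x using wt[of x] by linarith
  have [measurable]: "wt \<in> borel_measurable borel" unfolding wt_def by measurable
  note sets'[measurable_cong]
  interpret \<rho>': prob_space \<rho>' by (rule prob')
  have iw: "integrable lborel (\<lambda>x. wt x powr - p)"
    using weight_integrable[where 'a="real ^ 'n" and p=p] p
    by (intro integrableI_bounded) (auto simp: wt_def)
  have ig: "integrable lborel (\<lambda>x. g x powr \<alpha>)"
  proof (rule integrableI_bounded)
    have "(\<integral>\<^sup>+x. ennreal (norm (g x powr \<alpha>)) \<partial>lborel) \<le> power_energy \<alpha> \<rho>'"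
      unfolding power_energy_def g_def[symmetric]
      using \<alpha> by (intro nn_integral_mono ennreal_leI) (simp add: field_simps mult_left_le_one_le)
    then show "(\<integral>\<^sup>+x. ennreal (norm (g x powr \<alpha>)) \<partial>lborel) < \<infinity>" using fin by (rule le_less_trans)
  qed simp
  define I where "I = (\<integral>x. g x powr \<alpha> \<partial>lborel)"
  have I0: "0 \<le> I" unfolding I_def by (rule integral_nonneg_AE) simp
  \<comment> \<open>Since 1 / \<alpha> = 1 + c, the energy splits into the optimal values of the
    linear term, I, and of the conjugate term, c I.\<close>
  have PI: "power_energy \<alpha> \<rho>' = ennreal (I + c * I)"
  proof -
    have "power_energy \<alpha> \<rho>' = ennreal (\<integral>x. 1 / \<alpha> * g x powr \<alpha> \<partial>lborel)"
      unfolding power_energy_def g_def[symmetric]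
      using \<alpha> ig by (intro nn_integral_eq_integral) auto
    then show ?thesis by (simp add: I_def c_def algebra_simps)
  qed
  \<comment> \<open>Error budget: e / 4 for this summand, e / 4 for f against \<rho> k, e / 4 for
    the truncation at K and e / 8 for replacing h by f in the conjugate term; 7 e / 8 in
    all.\<close>
  define s where "s = e / (4 * (1 + M))"
  have s: "0 < s" "s * (1 + M) = e / 4" using e \<open>0 \<le> M\<close> by (auto simp: s_def field_simps)
  have iKs: "integrable lborel (\<lambda>x. (h x + s * wt x) powr - p)"
    if [measurable]: "h \<in> borel_measurable borel" and h: "\<And>x. 0 \<le> h x" for h
  proof (rule Bochner_Integration.integrable_bound)
    show "integrable lborel (\<lambda>x. s powr - p * wt x powr - p)" using iw by simp
    show "AE x in lborel. norm ((h x + s * wt x) powr - p) \<le> norm (s powr - p * wt x powr - p)"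
    proof (rule AE_I2)
      fix x
      have "(h x + s * wt x) powr - p \<le> (s * wt x) powr - p"
        using h[of x] s wt0[of x] p by (intro powr_mono2') auto
      also have "\<dots> = s powr - p * wt x powr - p" using s wt0[of x] by (simp add: powr_mult)
      finally show "norm ((h x + s * wt x) powr - p) \<le> norm (s powr - p * wt x powr - p)" by simp
    qed
  qed measurable
  have "(\<lambda>k. \<integral>x. (real k + s * wt x) powr - p \<partial>lborel) \<longlonglongrightarrow> (\<integral>x. (0 :: real) \<partial>(lborel :: (real ^ 'n) measure))"
  proof (rule integral_dominated_convergence[where w="\<lambda>x. (0 + s * wt x) powr - p"])
    show "integrable lborel (\<lambda>x. (0 + s * wt x) powr - p)" by (rule iKs) auto
    show "AE x in lborel. (\<lambda>k. (real k + s * wt x) powr - p) \<longlonglongrightarrow> 0"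
    proof (rule AE_I2)
      fix x :: "real ^ 'n"
      have "filterlim (\<lambda>k. s * wt x + real k) at_top sequentially"
        by (rule filterlim_tendsto_add_at_top[OF tendsto_const filterlim_real_sequentially])
      then have "filterlim (\<lambda>k. real k + s * wt x) at_top sequentially" by (simp add: add.commute)
      then show "(\<lambda>k. (real k + s * wt x) powr - p) \<longlonglongrightarrow> 0"
        by (rule tendsto_neg_powr[rotated]) (use p in simp)
    qed
    show "AE x in lborel. norm ((real k + s * wt x) powr - p) \<le> (0 + s * wt x) powr - p" for k
      using s wt0 p by (intro AE_I2) (auto intro!: powr_mono2')
  qed measurable
  then have "(\<lambda>k. c * (\<integral>x. (real k + s * wt x) powr - p \<partial>lborel)) \<longlonglongrightarrow> c * 0"
    by (intro tendsto_mult_left) simp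
  then have "\<forall>\<^sub>F k in sequentially. c * (\<integral>x. (real k + s * wt x) powr - p \<partial>lborel) < e / 4"
    using e by (intro order_tendstoD) auto
  then have "\<forall>\<^sub>F k in sequentially. c * (\<integral>x. (real k + s * wt x) powr - p \<partial>lborel) < e / 4 \<and> 1 \<le> k"
    using eventually_ge_at_top[of 1] by (rule eventually_conj)
  then obtain k0 :: nat where k0: "c * (\<integral>x. (real k0 + s * wt x) powr - p \<partial>lborel) < e / 4" "1 \<le> k0"
    using eventually_happens sequentially_bot by blast
  define K where "K = real k0"
  have K: "0 < K" "c * (\<integral>x. (K + s * wt x) powr - p \<partial>lborel) < e / 4" using k0 by (auto simp: K_def)
  text \<open>The optimal test function \<open>g powr (\<alpha> - 1)\<close> of the Young inequality, truncated at \<open>K\<close>.\<close>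
  define h where "h x = (if x \<in> N then 0 else if g x = 0 then K else min K (g x powr (\<alpha> - 1)))" for x
  have hm[measurable]: "h \<in> borel_measurable borel" unfolding h_def by measurable
  have h: "0 \<le> h x" "h x \<le> K" for x using K by (auto simp: h_def)
  have ih: "integrable \<rho>' h" using h by (intro \<rho>'.integrable_const_bound[of _ K]) (auto intro!: AE_I2)
  \<comment> \<open>The value 0 on N removes the singular part of \<rho>' from the linear term,
    while the conjugate term, a Lebesgue integral, does not see N.\<close>
  have hI: "(\<integral>x. h x \<partial>\<rho>') \<le> I"
  proof -
    have "ennreal (\<integral>x. h x \<partial>\<rho>') = (\<integral>\<^sup>+x. ennreal (h x) \<partial>\<rho>')"
      using ih h by (intro nn_integral_eq_integral[symmetric]) auto
    also have "\<dots> = (\<integral>\<^sup>+x. ennreal (g x) * ennreal (h x) \<partial>lborel)" by (rule dec) (auto simp: h_def)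
    also have "\<dots> \<le> (\<integral>\<^sup>+x. ennreal (g x powr \<alpha>) \<partial>lborel)"
    proof (rule nn_integral_mono)
      fix x
      have "g x * h x \<le> g x powr \<alpha>"
      proof (cases "g x = 0")
        case False
        then have "h x \<le> g x powr (\<alpha> - 1)" by (auto simp: h_def)
        then have "g x * h x \<le> g x * g x powr (\<alpha> - 1)" using g0[of x] by (rule mult_left_mono)
        then show ?thesis using powr_mult_base[OF g0[of x], of "\<alpha> - 1"] by simp
      qed simp
      then show "ennreal (g x) * ennreal (h x) \<le> ennreal (g x powr \<alpha>)"
        using g0[of x] h[of x] by (simp flip: ennreal_mult add: ennreal_leI)
    qed
    also have "\<dots> = ennreal I" unfolding I_def using ig by (intro nn_integral_eq_integral) auto
    finally show ?thesis using I0 by simp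
  qed
  \<comment> \<open>At untruncated points h powr (-p) equals g powr \<alpha>; where h = K the second
    summand takes over, whose integral is small by the choice of K.\<close>
  have hpt: "(h x + s * wt x) powr - p \<le> g x powr \<alpha> + (K + s * wt x) powr - p" if "x \<notin> N" for x
  proof (cases "h x = K")
    case True then show ?thesis by simp
  next
    case False
    then have *: "g x \<noteq> 0" "h x = g x powr (\<alpha> - 1)" using that by (auto simp: h_def min_def split: if_splits)
    then have "(h x + s * wt x) powr - p \<le> h x powr - p"
      using s wt0[of x] p by (intro powr_mono2') auto
    also have "\<dots> = g x powr \<alpha>" unfolding * by (simp only: powr_powr pexp)
    finally show ?thesis by (simp add: add_increasing2)
  qed
  \<comment> \<open>By the Lipschitz bound, replacing h by f changes the conjugate integrand by at
    most q |f - h| times the weight, so closeness under this finite measure is what has to be asked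
    of f.\<close>
  define L where "L = density lborel (\<lambda>x. ennreal (wt x powr - p))"
  have L: "finite_measure L" "sets L = sets borel"
    using weight_integrable[where 'a="real ^ 'n" and p=p] p
    by (auto simp: L_def wt_def emeasure_density intro!: finite_measureI)
  define q where "q = c * (p * s powr (- p - 1))"
  have q: "0 < q" using c p s by (simp add: q_def)
  define \<eta> where "\<eta> = min (e / 8) (e / (8 * q))"
  have \<eta>: "0 < \<eta>" "\<eta> \<le> e / 8" "q * \<eta> \<le> e / 8" using e q by (auto simp: \<eta>_def min_def field_simps)
  obtain f where f: "continuous_on UNIV f" "\<And>x. 0 \<le> f x" "\<And>x. f x \<le> K"
    "(\<integral>x. \<bar>f x - h x\<bar> \<partial>\<rho>') < \<eta>" "(\<integral>x. \<bar>f x - h x\<bar> \<partial>L) < \<eta>"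
    by (rule continuous_approx_bounded[OF \<rho>'.finite_measure_axioms sets' L hm h \<eta>(1) K(1)]) blast
  have fm[measurable]: "f \<in> borel_measurable borel" by (rule borel_measurable_continuous_onI[OF f(1)])
  have intf: "integrable \<rho>' f" using f by (intro \<rho>'.integrable_const_bound[of _ K]) (auto intro!: AE_I2)
  have fI: "(\<integral>x. f x \<partial>\<rho>') < I + e / 8"
  proof -
    have "(\<integral>x. f x \<partial>\<rho>') - (\<integral>x. h x \<partial>\<rho>') = (\<integral>x. f x - h x \<partial>\<rho>')"
      using intf ih by simp
    also have "\<dots> \<le> (\<integral>x. \<bar>f x - h x\<bar> \<partial>\<rho>')" using intf ih by (intro integral_mono) auto
    finally show ?thesis using f(4) hI \<eta> by linarith
  qed
  have ev: "\<forall>\<^sub>F k in sequentially. (\<integral>x. f x \<partial>\<rho> k) < I + e / 4"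
  proof -
    have "(\<lambda>k. \<integral>x. f x \<partial>\<rho> k) \<longlonglongrightarrow> (\<integral>x. f x \<partial>\<rho>')"
      using w f by (auto simp: weakly_converges_def bounded_iff intro!: exI[of _ K])
    then show ?thesis by (rule order_tendstoD) (use fI e in linarith)
  qed
  have iL: "integrable lborel (\<lambda>x. wt x powr - p * \<bar>f x - h x\<bar>)"
  proof (rule Bochner_Integration.integrable_bound)
    show "integrable lborel (\<lambda>x. wt x powr - p * K)" using iw by simp
    show "AE x in lborel. norm (wt x powr - p * \<bar>f x - h x\<bar>) \<le> norm (wt x powr - p * K)"
      using f(2,3) h K by (intro AE_I2) (auto simp: abs_mult abs_le_iff intro!: mult_left_mono, (smt (verit))+)
  qed measurable
  have fL: "(\<integral>x. wt x powr - p * \<bar>f x - h x\<bar> \<partial>lborel) < \<eta>"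
    using f(5) unfolding L_def by (subst (asm) integral_density) auto
  let ?X = "\<integral>x. c * (f x + s * wt x) powr - p \<partial>lborel"
  have X: "?X \<le> c * I + e / 4 + e / 8"
  proof -
    have "?X \<le> (\<integral>x. c * g x powr \<alpha> + c * (K + s * wt x) powr - p + q * (wt x powr - p * \<bar>f x - h x\<bar>) \<partial>lborel)"
    proof (rule integral_mono_AE)
      show "integrable lborel (\<lambda>x. c * (f x + s * wt x) powr - p)" using iKs[of f] f by simp
      show "integrable lborel (\<lambda>x. c * g x powr \<alpha> + c * (K + s * wt x) powr - p + q * (wt x powr - p * \<bar>f x - h x\<bar>))"
        using ig iL iKs[of "\<lambda>_. K"] K by (intro Bochner_Integration.integrable_add integrable_mult_right) auto
      have "AE x in lborel. x \<notin> N" using N0 by (intro AE_not_in null_setsI) auto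
      then show "AE x in lborel. c * (f x + s * wt x) powr - p \<le>
        c * g x powr \<alpha> + c * (K + s * wt x) powr - p + q * (wt x powr - p * \<bar>f x - h x\<bar>)"
      proof eventually_elim
        case (elim x)
        have "(f x + s * wt x) powr - p \<le> (h x + s * wt x) powr - p + p * (s * wt x) powr (- p - 1) * \<bar>f x - h x\<bar>"
          using f(2) h s wt0[of x] p by (intro powr_minus_shift_le) auto
        moreover have "p * (s * wt x) powr (- p - 1) * \<bar>f x - h x\<bar> \<le> p * s powr (- p - 1) * (wt x powr - p * \<bar>f x - h x\<bar>)"
        proof -
          have "wt x powr (- p - 1) \<le> wt x powr - p" using wt[of x] by (intro powr_mono) auto
          then have "p * s powr (- p - 1) * (wt x powr (- p - 1) * \<bar>f x - h x\<bar>) \<le> p * s powr (- p - 1) * (wt x powr - p * \<bar>f x - h x\<bar>)"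
            using p s by (intro mult_left_mono mult_right_mono) auto
          then show ?thesis using s wt0[of x] by (simp add: powr_mult mult_ac)
        qed
        ultimately have "(f x + s * wt x) powr - p \<le> g x powr \<alpha> + (K + s * wt x) powr - p
            + p * s powr (- p - 1) * (wt x powr - p * \<bar>f x - h x\<bar>)"
          using hpt[OF elim] by linarith
        then have "c * (f x + s * wt x) powr - p \<le> c * (g x powr \<alpha> + (K + s * wt x) powr - p
            + p * s powr (- p - 1) * (wt x powr - p * \<bar>f x - h x\<bar>))"
          using c by (intro mult_left_mono) auto
        then show ?case by (simp add: q_def algebra_simps)
      qed
    qed
    also have "\<dots> = c * I + c * (\<integral>x. (K + s * wt x) powr - p \<partial>lborel) + q * (\<integral>x. wt x powr - p * \<bar>f x - h x\<bar> \<partial>lborel)"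
      using ig iL iKs[of "\<lambda>_. K"] K by (simp add: I_def)
    also have "\<dots> \<le> c * I + e / 4 + q * \<eta>"
      using K(2) mult_left_mono[OF less_imp_le[OF fL] less_imp_le[OF q]] by linarith
    finally show ?thesis using \<eta> by linarith
  qed
  show ?thesis using ev
  proof eventually_elim
    case (elim k)
    note sets[measurable_cong]
    interpret prob_space "\<rho> k" by (rule prob)
    have ifk: "integrable (\<rho> k) f" using f by (intro integrable_const_bound[of _ K]) (auto intro!: AE_I2)
    have "power_energy \<alpha> (\<rho> k) \<le> (\<integral>\<^sup>+x. ennreal (f x + s * wt x) \<partial>\<rho> k)
        + (\<integral>\<^sup>+x. ennreal (c * (f x + s * wt x) powr - p) \<partial>lborel)"
      unfolding c_def p_def using f(2) s wt0
      by (intro power_energy_le prob sets \<alpha>) (auto simp: add_nonneg_pos)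
    also have "(\<integral>\<^sup>+x. ennreal (c * (f x + s * wt x) powr - p) \<partial>lborel) = ennreal ?X"
      using c iKs[of f] f by (intro nn_integral_eq_integral) auto
    also have "(\<integral>\<^sup>+x. ennreal (f x + s * wt x) \<partial>\<rho> k) = (\<integral>\<^sup>+x. ennreal (f x) + (ennreal s + ennreal s * ennreal (norm x)) \<partial>\<rho> k)"
      using f(2) s by (intro nn_integral_cong) (simp add: wt_def distrib_left add_nonneg_nonneg flip: ennreal_mult ennreal_plus)
    also have "\<dots> = ennreal (\<integral>x. f x \<partial>\<rho> k) + (ennreal s + ennreal s * (\<integral>\<^sup>+x. ennreal (norm x) \<partial>\<rho> k))"
      using ifk f(2) by (simp add: nn_integral_add nn_integral_cmult emeasure_space_1 nn_integral_eq_integral)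
    also have "\<dots> \<le> ennreal (I + e / 4) + (ennreal s + ennreal s * ennreal M)"
      using elim mom[of k] by (intro add_mono mult_left_mono ennreal_leI) auto
    also have "ennreal s + ennreal s * ennreal M = ennreal (e / 4)"
    proof -
      have "e / 4 = s + s * M" using s(2) by (simp only: distrib_left mult_1_right)
      then show ?thesis using s(1) \<open>0 \<le> M\<close> by (simp only:) (simp flip: ennreal_mult)
    qed
    also have "ennreal (I + e / 4) + ennreal (e / 4) + ennreal ?X \<le> ennreal (I + e / 4) + ennreal (e / 4) + ennreal (c * I + e / 4 + e / 8)"
      using X by (intro add_left_mono ennreal_leI)
    also have "\<dots> = ennreal (I + c * I + 7 * e / 8)"
      using I0 c e by (simp flip: ennreal_plus)
    also have "\<dots> \<le> ennreal (I + c * I + e)" using e by (intro ennreal_leI) auto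
    also have "\<dots> = power_energy \<alpha> \<rho>' + ennreal e" using I0 c e by (simp add: PI flip: ennreal_plus)
    finally show ?case by (simp add: add_right_mono)
  qed
qed

section \<open>Lower bounds for the maximal correlation\<close>

lemma P1_D:
  assumes "\<rho> \<in> P1"
  shows "prob_space \<rho>" "sets \<rho> = sets borel" "space \<rho> = UNIV" "integrable \<rho> (\<lambda>x. x)" "integrable \<rho> norm"
proof -
  show 1: "prob_space \<rho>" "sets \<rho> = sets borel" using assms by (auto simp: P1_def)
  then show "space \<rho> = UNIV" using sets_eq_imp_space_eq[of \<rho> borel] by simp
  note 1(2)[measurable_cong]
  show "integrable \<rho> (\<lambda>x. x)" using assms by (intro integrableI_bounded) (auto simp: P1_def)
  then show "integrable \<rho> norm" using integrable_norm by fastforce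
qed

lemma ext_integral_integrable:
  assumes "integrable M f"
  shows "ext_integral M f = ereal (\<integral>x. f x \<partial>M)" "integral_meaningful M f"
proof -
  have fin: "(\<integral>\<^sup>+x. ennreal (f x) \<partial>M) < \<infinity>" "(\<integral>\<^sup>+x. ennreal (- f x) \<partial>M) < \<infinity>"
    using assms by (auto simp: real_integrable_def less_top)
  obtain a where a: "(\<integral>\<^sup>+x. ennreal (f x) \<partial>M) = ennreal a" "0 \<le> a"
    using fin(1) by (cases "\<integral>\<^sup>+x. ennreal (f x) \<partial>M") auto
  obtain b where b: "(\<integral>\<^sup>+x. ennreal (- f x) \<partial>M) = ennreal b" "0 \<le> b"
    using fin(2) by (cases "\<integral>\<^sup>+x. ennreal (- f x) \<partial>M") auto
  show "ext_integral M f = ereal (\<integral>x. f x \<partial>M)"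
    using a b by (simp add: ext_integral_def real_lebesgue_integral_def[OF assms] enn2ereal_ennreal)
  show "integral_meaningful M f" using fin assms by (auto simp: integral_meaningful_def)
qed

lemma coupling_le_T_functional:
  assumes "\<gamma> \<in> couplings \<rho> \<mu>" "integrable \<gamma> (\<lambda>(x, y). x \<bullet> y)"
  shows "ereal (\<integral>z. fst z \<bullet> snd z \<partial>\<gamma>) \<le> T_functional \<rho> \<mu>"
proof -
  have "ext_integral \<gamma> (\<lambda>(x, y). x \<bullet> y) \<le> T_functional \<rho> \<mu>"
    unfolding T_functional_def using assms ext_integral_integrable(2)[OF assms(2)]
    by (intro Sup_upper) blast
  then show ?thesis using ext_integral_integrable(1)[OF assms(2)] by (simp add: case_prod_beta')
qed

text \<open>Independence is essential: the norm product integrates to a product of first moments,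
  whereas under a general coupling the inner product may fail to be integrable.\<close>

lemma integral_pair_inner:
  fixes u :: "'a \<Rightarrow> 'c::euclidean_space" and v :: "'b \<Rightarrow> 'c"
  assumes M: "prob_space M" and N: "prob_space N" and u: "integrable M u" and v: "integrable N v"
  shows "integrable (M \<Otimes>\<^sub>M N) (\<lambda>z. u (fst z) \<bullet> v (snd z))"
    and "(\<integral>z. u (fst z) \<bullet> v (snd z) \<partial>(M \<Otimes>\<^sub>M N)) = (\<integral>x. u x \<partial>M) \<bullet> (\<integral>y. v y \<partial>N)"
proof -
  interpret M: prob_space M by fact
  interpret N: prob_space N by fact
  interpret pair_prob_space M N by unfold_locales
  have [measurable]: "u \<in> borel_measurable M" "v \<in> borel_measurable N" using u v by auto
  show int: "integrable (M \<Otimes>\<^sub>M N) (\<lambda>z. u (fst z) \<bullet> v (snd z))"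
  proof (rule Fubini_integrable)
    show "integrable M (\<lambda>x. \<integral>y. norm (u (fst (x, y)) \<bullet> v (snd (x, y))) \<partial>N)"
    proof (rule Bochner_Integration.integrable_bound)
      show "integrable M (\<lambda>x. norm (u x) * (\<integral>y. norm (v y) \<partial>N))" using u by simp
      have "(\<integral>y. norm (u x \<bullet> v y) \<partial>N) \<le> (\<integral>y. norm (u x) * norm (v y) \<partial>N)" for x
        using v by (intro integral_mono) (auto simp: Cauchy_Schwarz_ineq2)
      then show "AE x in M. norm (\<integral>y. norm (u (fst (x, y)) \<bullet> v (snd (x, y))) \<partial>N)
          \<le> norm (norm (u x) * (\<integral>y. norm (v y) \<partial>N))"
        by (intro AE_I2) (simp add: abs_mult)
    qed measurable
  qed (use v in auto)
  show "(\<integral>z. u (fst z) \<bullet> v (snd z) \<partial>(M \<Otimes>\<^sub>M N)) = (\<integral>x. u x \<partial>M) \<bullet> (\<integral>y. v y \<partial>N)"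
    using integral_fst'[OF int] u v by simp
qed

lemma integrable_bounded_scaleR:
  fixes u :: "'a \<Rightarrow> 'c::euclidean_space" and a :: "'a \<Rightarrow> real"
  assumes "integrable M u" "a \<in> borel_measurable M" "\<And>x. \<bar>a x\<bar> \<le> A"
  shows "integrable M (\<lambda>x. a x *\<^sub>R u x)"
proof (rule Bochner_Integration.integrable_bound)
  show "integrable M (\<lambda>x. A * norm (u x))" using assms by simp
  show "AE x in M. norm (a x *\<^sub>R u x) \<le> norm (A * norm (u x))"
    using assms(3) order_trans[OF abs_ge_zero assms(3)] by (intro AE_I2) (simp add: abs_mult mult_right_mono)
qed (use assms in measurable)

text \<open>Integrating the density over one variable kills every summand by the mean-zero
  conditions and leaves 1, so the marginals are right. The constant 1 contributes the inner product
  of the two means, which vanishes as \<mu> is centred. Boundedness of \<open>a\<close> and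
  \<open>b\<close> makes first moments suffice for integrability.\<close>

lemma bilinear_coupling:
  fixes \<rho> \<mu> :: "(real ^ 'n::finite) measure" and a b :: "'j \<Rightarrow> real ^ 'n \<Rightarrow> real"
  assumes \<rho>: "\<rho> \<in> P1" and \<mu>: "\<mu> \<in> P1" and cen: "(\<integral>y. y \<partial>\<mu>) = 0" and J: "finite J"
    and am: "\<And>j. a j \<in> borel_measurable borel" and bm: "\<And>j. b j \<in> borel_measurable borel"
    and aB: "\<And>j x. \<bar>a j x\<bar> \<le> A j" and bB: "\<And>j x. \<bar>b j x\<bar> \<le> B j"
    and a0: "\<And>j. j \<in> J \<Longrightarrow> (\<integral>x. a j x \<partial>\<rho>) = 0" and b0: "\<And>j. j \<in> J \<Longrightarrow> (\<integral>y. b j y \<partial>\<mu>) = 0"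
    and nonneg: "\<And>x y. 0 \<le> 1 + (\<Sum>j\<in>J. a j x * b j y)"
  shows "ereal (\<Sum>j\<in>J. (\<integral>x. a j x *\<^sub>R x \<partial>\<rho>) \<bullet> (\<integral>y. b j y *\<^sub>R y \<partial>\<mu>)) \<le> T_functional \<rho> \<mu>"
proof -
  note P = P1_D[OF \<rho>] and Q = P1_D[OF \<mu>]
  note [measurable_cong] = P(2) Q(2)
  note [measurable] = am bm
  interpret \<rho>: prob_space \<rho> by (rule P)
  interpret \<mu>: prob_space \<mu> by (rule Q)
  interpret pair_prob_space \<rho> \<mu> by unfold_locales
  have setsP: "sets (\<rho> \<Otimes>\<^sub>M \<mu>) = sets borel"
    unfolding borel_prod[symmetric] by (rule sets_pair_measure_cong[OF P(2) Q(2)])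
  define h where "h z = 1 + (\<Sum>j\<in>J. a j (fst z) * b j (snd z))" for z
  have hm[measurable]: "h \<in> borel_measurable (borel \<Otimes>\<^sub>M borel)" unfolding h_def by measurable
  have h0: "0 \<le> h z" for z using nonneg by (simp add: h_def)
  define \<gamma> where "\<gamma> = density (\<rho> \<Otimes>\<^sub>M \<mu>) (\<lambda>z. ennreal (h z))"
  have sets\<gamma>: "sets \<gamma> = sets borel" by (simp add: \<gamma>_def setsP)
  have ia: "integrable \<rho> (a j)" for j using aB by (intro \<rho>.integrable_const_bound[of _ "A j"]) auto
  have ib: "integrable \<mu> (b j)" for j using bB by (intro \<mu>.integrable_const_bound[of _ "B j"]) auto
  have hy: "(\<integral>\<^sup>+y. ennreal (h (x, y)) \<partial>\<mu>) = 1" for x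
  proof -
    have "(\<integral>\<^sup>+y. ennreal (h (x, y)) \<partial>\<mu>) = ennreal (\<integral>y. h (x, y) \<partial>\<mu>)"
      using h0 ib by (intro nn_integral_eq_integral) (auto simp: h_def)
    also have "(\<integral>y. h (x, y) \<partial>\<mu>) = 1" using ib b0 by (simp add: h_def \<mu>.prob_space)
    finally show ?thesis by simp
  qed
  have hx: "(\<integral>\<^sup>+x. ennreal (h (x, y)) \<partial>\<rho>) = 1" for y
  proof -
    have "(\<integral>\<^sup>+x. ennreal (h (x, y)) \<partial>\<rho>) = ennreal (\<integral>x. h (x, y) \<partial>\<rho>)"
      using h0 ia by (intro nn_integral_eq_integral) (auto simp: h_def)
    also have "(\<integral>x. h (x, y) \<partial>\<rho>) = 1" using ia a0 by (simp add: h_def \<rho>.prob_space)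
    finally show ?thesis by simp
  qed
  have fst: "distr \<gamma> borel fst = \<rho>"
  proof (rule measure_eqI)
    fix X assume "X \<in> sets (distr \<gamma> borel fst)"
    then have [measurable]: "X \<in> sets borel" by simp
    have "emeasure (distr \<gamma> borel fst) X = emeasure \<gamma> (fst -` X \<inter> space \<gamma>)"
      by (rule emeasure_distr) (auto simp: \<gamma>_def)
    also have "\<dots> = (\<integral>\<^sup>+z. ennreal (h z) * indicator (fst -` X \<inter> space \<gamma>) z \<partial>(\<rho> \<Otimes>\<^sub>M \<mu>))"
      unfolding \<gamma>_def by (rule emeasure_density) (auto intro!: measurable_sets[where A="\<rho> \<Otimes>\<^sub>M \<mu>"])
    also have "\<dots> = (\<integral>\<^sup>+z. indicator X (fst z) * ennreal (h z) \<partial>(\<rho> \<Otimes>\<^sub>M \<mu>))"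
      by (intro nn_integral_cong) (auto simp: indicator_def \<gamma>_def)
    also have "\<dots> = (\<integral>\<^sup>+x. \<integral>\<^sup>+y. indicator X x * ennreal (h (x, y)) \<partial>\<mu> \<partial>\<rho>)"
      by (subst \<mu>.nn_integral_fst[symmetric]) auto
    also have "\<dots> = (\<integral>\<^sup>+x. indicator X x \<partial>\<rho>)" by (simp add: nn_integral_cmult hy)
    finally show "emeasure (distr \<gamma> borel fst) X = emeasure \<rho> X" by (simp add: P)
  qed (simp add: P)
  have snd: "distr \<gamma> borel snd = \<mu>"
  proof (rule measure_eqI)
    fix X assume "X \<in> sets (distr \<gamma> borel snd)"
    then have [measurable]: "X \<in> sets borel" by simp
    have "emeasure (distr \<gamma> borel snd) X = emeasure \<gamma> (snd -` X \<inter> space \<gamma>)"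
      by (rule emeasure_distr) (auto simp: \<gamma>_def)
    also have "\<dots> = (\<integral>\<^sup>+z. ennreal (h z) * indicator (snd -` X \<inter> space \<gamma>) z \<partial>(\<rho> \<Otimes>\<^sub>M \<mu>))"
      unfolding \<gamma>_def by (rule emeasure_density) (auto intro!: measurable_sets[where A="\<rho> \<Otimes>\<^sub>M \<mu>"])
    also have "\<dots> = (\<integral>\<^sup>+z. indicator X (snd z) * ennreal (h z) \<partial>(\<rho> \<Otimes>\<^sub>M \<mu>))"
      by (intro nn_integral_cong) (auto simp: indicator_def \<gamma>_def)
    also have "\<dots> = (\<integral>\<^sup>+y. \<integral>\<^sup>+x. indicator X y * ennreal (h (x, y)) \<partial>\<rho> \<partial>\<mu>)"
      by (subst nn_integral_snd[symmetric]) auto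
    also have "\<dots> = (\<integral>\<^sup>+y. indicator X y \<partial>\<mu>)" by (simp add: nn_integral_cmult hx)
    finally show "emeasure (distr \<gamma> borel snd) X = emeasure \<mu> X" by (simp add: Q)
  qed (simp add: Q)
  have "prob_space \<gamma>"
  proof
    have "emeasure \<gamma> (space \<gamma>) = emeasure (distr \<gamma> borel fst) UNIV"
      by (subst emeasure_distr) (auto simp: \<gamma>_def)
    then show "emeasure \<gamma> (space \<gamma>) = 1" unfolding fst using \<rho>.emeasure_space_1 P by simp
  qed
  then have \<gamma>: "\<gamma> \<in> couplings \<rho> \<mu>" using sets\<gamma> fst snd by (simp add: couplings_def)
  have iaj: "integrable \<rho> (\<lambda>x. a j x *\<^sub>R x)" for j by (rule integrable_bounded_scaleR[OF P(4) _ aB]) simp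
  have ibj: "integrable \<mu> (\<lambda>x. b j x *\<^sub>R x)" for j by (rule integrable_bounded_scaleR[OF Q(4) _ bB]) simp
  note p = integral_pair_inner[OF P(1) Q(1)]
  have expand: "h z * (fst z \<bullet> snd z) = fst z \<bullet> snd z
      + (\<Sum>j\<in>J. (a j (fst z) *\<^sub>R fst z) \<bullet> (b j (snd z) *\<^sub>R snd z))" for z
    by (simp add: h_def distrib_left distrib_right sum_distrib_left sum_distrib_right mult_ac)
  have int: "integrable (\<rho> \<Otimes>\<^sub>M \<mu>) (\<lambda>z. h z * (fst z \<bullet> snd z))"
    unfolding expand by (intro Bochner_Integration.integrable_add Bochner_Integration.integrable_sum p(1) iaj ibj P(4) Q(4))
  have "integrable \<gamma> (\<lambda>z. fst z \<bullet> snd z)"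
    unfolding \<gamma>_def using int h0 by (subst integrable_density) auto
  moreover have "(\<integral>z. fst z \<bullet> snd z \<partial>\<gamma>) = (\<integral>z. h z * (fst z \<bullet> snd z) \<partial>(\<rho> \<Otimes>\<^sub>M \<mu>))"
    unfolding \<gamma>_def using h0 by (subst integral_density) auto
  moreover have "\<dots> = (\<Sum>j\<in>J. (\<integral>x. a j x *\<^sub>R x \<partial>\<rho>) \<bullet> (\<integral>y. b j y *\<^sub>R y \<partial>\<mu>))"
  proof -
    note pj = p(1)[OF iaj ibj] p(2)[OF iaj ibj] and p0 = p(1)[OF P(4) Q(4)] p(2)[OF P(4) Q(4)]
    have "(\<integral>z. h z * (fst z \<bullet> snd z) \<partial>(\<rho> \<Otimes>\<^sub>M \<mu>)) = (\<integral>z. fst z \<bullet> snd z \<partial>(\<rho> \<Otimes>\<^sub>M \<mu>))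
        + (\<integral>z. (\<Sum>j\<in>J. (a j (fst z) *\<^sub>R fst z) \<bullet> (b j (snd z) *\<^sub>R snd z)) \<partial>(\<rho> \<Otimes>\<^sub>M \<mu>))"
      unfolding expand
      by (rule Bochner_Integration.integral_add[OF p0(1) Bochner_Integration.integrable_sum[OF pj(1)]])
    also have "(\<integral>z. (\<Sum>j\<in>J. (a j (fst z) *\<^sub>R fst z) \<bullet> (b j (snd z) *\<^sub>R snd z)) \<partial>(\<rho> \<Otimes>\<^sub>M \<mu>))
        = (\<Sum>j\<in>J. \<integral>z. (a j (fst z) *\<^sub>R fst z) \<bullet> (b j (snd z) *\<^sub>R snd z) \<partial>(\<rho> \<Otimes>\<^sub>M \<mu>))"
      by (rule Bochner_Integration.integral_sum[OF pj(1)])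
    finally show ?thesis unfolding pj(2) p0(2) cen by simp
  qed
  ultimately show ?thesis using coupling_le_T_functional[OF \<gamma>] by (simp add: case_prod_beta')
qed

text \<open>The mean of |v \<bullet> y| is a norm in v: a zero at v \<noteq> 0 would put all the
  mass on the hyperplane orthogonal to v. Being Lipschitz, it has a positive minimum on the unit
  sphere, and homogeneity does the rest.\<close>

lemma directional_moment_bound:
  fixes \<mu> :: "(real ^ 'n::finite) measure"
  assumes \<mu>: "\<mu> \<in> P1" and hyp: "\<And>H. affine_hyperplane H \<Longrightarrow> measure \<mu> H < 1"
  obtains c where "0 < c" "\<And>v. c * norm v \<le> (\<integral>y. \<bar>v \<bullet> y\<bar> \<partial>\<mu>)"
proof -
  note Q = P1_D[OF \<mu>]
  note [measurable_cong] = Q(2)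
  interpret prob_space \<mu> by (rule Q)
  define \<Phi> where "\<Phi> v = (\<integral>y. \<bar>v \<bullet> y\<bar> \<partial>\<mu>)" for v
  have int: "integrable \<mu> (\<lambda>y. \<bar>v \<bullet> y\<bar>)" for v
    using Q(4) by (intro integrable_abs integrable_inner_right) auto
  have pos: "0 < \<Phi> v" if "v \<noteq> 0" for v
  proof (rule ccontr)
    assume "\<not> 0 < \<Phi> v"
    moreover have "0 \<le> \<Phi> v" unfolding \<Phi>_def by (rule integral_nonneg_AE) simp
    ultimately have "\<Phi> v = 0" by simp
    then have "AE y in \<mu>. \<bar>v \<bullet> y\<bar> = 0"
      unfolding \<Phi>_def by (subst (asm) integral_nonneg_eq_0_iff_AE) (use int in auto)
    then have "AE y in \<mu>. y \<in> {y. v \<bullet> y = 0}" by simp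
    then have "prob {y. v \<bullet> y = 0} = 1" by (subst prob_eq_1) (auto simp: Q)
    moreover have "affine_hyperplane {y. v \<bullet> y = 0}" using that by (auto simp: affine_hyperplane_def)
    ultimately show False using hyp[of "{y. v \<bullet> y = 0}"] by simp
  qed
  have "continuous_on UNIV \<Phi>"
  proof (rule lipschitz_on_continuous_on)
    show "(\<integral>y. norm y \<partial>\<mu>)-lipschitz_on UNIV \<Phi>"
    proof (rule lipschitz_onI)
      fix v w :: "real ^ 'n"
      have "\<bar>\<Phi> v - \<Phi> w\<bar> = \<bar>\<integral>y. \<bar>v \<bullet> y\<bar> - \<bar>w \<bullet> y\<bar> \<partial>\<mu>\<bar>" using int by (simp add: \<Phi>_def)
      also have "\<dots> \<le> (\<integral>y. \<bar>\<bar>v \<bullet> y\<bar> - \<bar>w \<bullet> y\<bar>\<bar> \<partial>\<mu>)" by (rule integral_abs_bound)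
      also have "\<dots> \<le> (\<integral>y. norm (v - w) * norm y \<partial>\<mu>)"
      proof (rule integral_mono)
        fix y
        have "\<bar>\<bar>v \<bullet> y\<bar> - \<bar>w \<bullet> y\<bar>\<bar> \<le> \<bar>(v - w) \<bullet> y\<bar>" by (simp add: inner_diff_left)
        also have "\<dots> \<le> norm (v - w) * norm y" by (rule Cauchy_Schwarz_ineq2)
        finally show "\<bar>\<bar>v \<bullet> y\<bar> - \<bar>w \<bullet> y\<bar>\<bar> \<le> norm (v - w) * norm y" .
      qed (use int Q(5) in auto)
      finally show "dist (\<Phi> v) (\<Phi> w) \<le> (\<integral>y. norm y \<partial>\<mu>) * dist v w"
        by (simp add: dist_real_def dist_norm mult.commute)
    qed (auto intro: integral_nonneg_AE)
  qed
  then have "continuous_on (sphere 0 1) \<Phi>" by (rule continuous_on_subset) simp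
  moreover have "sphere 0 1 \<noteq> ({} :: (real ^ 'n) set)" by simp
  ultimately obtain v0 where v0: "v0 \<in> sphere 0 1" "\<And>v. v \<in> sphere 0 1 \<Longrightarrow> \<Phi> v0 \<le> \<Phi> v"
    using continuous_attains_inf[of "sphere 0 1 :: (real ^ 'n) set" \<Phi>] by auto
  show thesis
  proof (rule that)
    show "0 < \<Phi> v0" using v0(1) by (intro pos) auto
    fix v
    show "\<Phi> v0 * norm v \<le> (\<integral>y. \<bar>v \<bullet> y\<bar> \<partial>\<mu>)"
    proof (cases "v = 0")
      case False
      have "\<Phi> v0 * norm v \<le> \<Phi> (sgn v) * norm v"
        using False by (intro mult_right_mono v0(2)) (auto simp: norm_sgn)
      also have "\<Phi> (sgn v) * norm v = (\<integral>y. \<bar>sgn v \<bullet> y\<bar> * norm v \<partial>\<mu>)" unfolding \<Phi>_def using int by simp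
      also have "\<dots> = (\<integral>y. \<bar>v \<bullet> y\<bar> \<partial>\<mu>)"
        using False by (intro Bochner_Integration.integral_cong) (auto simp: sgn_div_norm abs_mult)
      finally show ?thesis .
    qed simp
  qed
qed

text \<open>A single summand suffices. The recentred sign of one coordinate of x produces a vector v
  of size comparable to the first moment of \<rho>; the recentred sign of v \<bullet> y then
  produces the directional moment of \<mu> along v.\<close>

lemma T_functional_ge_moment:
  fixes \<mu> :: "(real ^ 'n::finite) measure"
  assumes \<mu>: "\<mu> \<in> P1" and cen: "(\<integral>y. y \<partial>\<mu>) = 0"
    and hyp: "\<And>H. affine_hyperplane H \<Longrightarrow> measure \<mu> H < 1"
  obtains c where "0 < c"
    "\<And>\<rho>. \<rho> \<in> P1 \<Longrightarrow> (\<integral>x. x \<partial>\<rho>) = 0 \<Longrightarrow> ereal (c * (\<integral>x. norm x \<partial>\<rho>)) \<le> T_functional \<rho> \<mu>"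
proof -
  obtain c where c: "0 < c" "\<And>v. c * norm v \<le> (\<integral>y. \<bar>v \<bullet> y\<bar> \<partial>\<mu>)"
    using directional_moment_bound[OF \<mu> hyp] by blast
  note Q = P1_D[OF \<mu>]
  interpret \<mu>: prob_space \<mu> by (rule Q)
  show thesis
  proof (rule that)
    \<comment> \<open>The 4 comes from halving both recentred signs, the dimension from bounding the
      first moment by one coordinate.\<close>
    show "0 < c / (4 * CARD('n))" using c by simp
    fix \<rho> :: "(real ^ 'n) measure" assume \<rho>: "\<rho> \<in> P1" and cen\<rho>: "(\<integral>x. x \<partial>\<rho>) = 0"
    note P = P1_D[OF \<rho>]
    note [measurable_cong] = P(2) Q(2)
    interpret \<rho>: prob_space \<rho> by (rule P)
    have icomp: "integrable \<rho> (\<lambda>x. \<bar>x $ i\<bar>)" for i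
    proof (rule Bochner_Integration.integrable_bound[OF P(5)])
      show "AE x in \<rho>. norm \<bar>x $ i\<bar> \<le> norm (norm x)" by (simp add: component_le_norm_cart)
    qed measurable
    \<comment> \<open>Some coordinate carries at least the fraction 1 / n of the moment, as |x| is
      at most the sum of the |x_i|.\<close>
    have "\<exists>i. (\<integral>x. norm x \<partial>\<rho>) \<le> CARD('n) * (\<integral>x. \<bar>x $ i\<bar> \<partial>\<rho>)"
    proof (rule ccontr)
      assume "\<not> ?thesis"
      then have less: "CARD('n) * (\<integral>x. \<bar>x $ i\<bar> \<partial>\<rho>) < (\<integral>x. norm x \<partial>\<rho>)" for i by (simp add: not_le)
      have "(\<integral>x. norm x \<partial>\<rho>) \<le> (\<integral>x. (\<Sum>i\<in>UNIV. \<bar>x $ i\<bar>) \<partial>\<rho>)"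
        using P(5) icomp by (intro integral_mono norm_le_l1_cart) auto
      also have "\<dots> = (\<Sum>i\<in>UNIV. (\<integral>x. \<bar>x $ i\<bar> \<partial>\<rho>))" using icomp by simp
      finally have "CARD('n) * (\<integral>x. norm x \<partial>\<rho>) \<le> (\<Sum>i\<in>UNIV. CARD('n) * (\<integral>x. \<bar>x $ i\<bar> \<partial>\<rho>))"
        by (simp add: mult_left_mono flip: sum_distrib_left)
      also have "\<dots> < (\<Sum>i\<in>(UNIV :: 'n set). (\<integral>x. norm x \<partial>\<rho>))" using less by (intro sum_strict_mono) auto
      finally show False by simp
    qed
    then obtain i where i: "(\<integral>x. norm x \<partial>\<rho>) \<le> CARD('n) * (\<integral>x. \<bar>x $ i\<bar> \<partial>\<rho>)" by blast
    have sgn_le: "\<bar>sgn t\<bar> \<le> 1" for t :: real by (simp add: abs_sgn_eq)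
    have mean: "\<bar>\<integral>x. sgn (f x) \<partial>M\<bar> \<le> 1" if "prob_space M" "f \<in> borel_measurable M" for M and f :: "real ^ 'n \<Rightarrow> real"
    proof -
      interpret prob_space M by fact
      have "\<bar>\<integral>x. sgn (f x) \<partial>M\<bar> \<le> (\<integral>x. \<bar>sgn (f x)\<bar> \<partial>M)" by (rule integral_abs_bound)
      also have "\<dots> \<le> (\<integral>x. 1 \<partial>M)" using that sgn_le
        by (intro integral_mono integrable_const_bound[of _ 1]) auto
      finally show ?thesis by (simp add: prob_space)
    qed
    have half: "\<bar>(s - m) / 2\<bar> \<le> 1" if "\<bar>s\<bar> \<le> 1" "\<bar>m\<bar> \<le> 1" for s m :: real
      using that by (auto simp: abs_le_iff)
    define m where "m = (\<integral>x. sgn (x $ i) \<partial>\<rho>)"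
    have m: "\<bar>m\<bar> \<le> 1" unfolding m_def by (rule mean[OF P(1)]) measurable
    \<comment> \<open>Subtracting m gives mean zero without changing the integral of a x, because
      \<rho> is centred; halving gives |a| \<le> 1, so that 1 + a b is nonnegative.\<close>
    define a where "a x = (sgn (x $ i) - m) / 2" for x :: "real ^ 'n"
    have isg: "integrable \<rho> (\<lambda>x. sgn (x $ i))"
      using sgn_le by (intro \<rho>.integrable_const_bound[of _ 1]) auto
    have isx: "integrable \<rho> (\<lambda>x. sgn (x $ i) *\<^sub>R x)"
      by (rule integrable_bounded_scaleR[OF P(4) _ sgn_le]) measurable
    define v where "v = (\<integral>x. a x *\<^sub>R x \<partial>\<rho>)"
    have "v = (\<integral>x. (1/2) *\<^sub>R (sgn (x $ i) *\<^sub>R x) - (m / 2) *\<^sub>R x \<partial>\<rho>)"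
      unfolding v_def a_def by (intro Bochner_Integration.integral_cong) (auto simp: algebra_simps diff_divide_distrib scaleR_diff_left)
    also have "\<dots> = (1/2) *\<^sub>R (\<integral>x. sgn (x $ i) *\<^sub>R x \<partial>\<rho>)"
      by (subst Bochner_Integration.integral_diff)
         (auto intro!: integrable_scaleR_right isx P(4) simp only: integral_scaleR_right cen\<rho> scaleR_zero_right diff_0_right)
    finally have v: "v = (1/2) *\<^sub>R (\<integral>x. sgn (x $ i) *\<^sub>R x \<partial>\<rho>)" .
    have "v \<bullet> axis i 1 = (1/2) * (\<integral>x. (sgn (x $ i) *\<^sub>R x) \<bullet> axis i 1 \<partial>\<rho>)"
      unfolding v using isx by (simp del: inner_scaleR_left add: inner_scaleR_left[of "1/2"])
    also have "(\<integral>x. (sgn (x $ i) *\<^sub>R x) \<bullet> axis i 1 \<partial>\<rho>) = (\<integral>x. \<bar>x $ i\<bar> \<partial>\<rho>)"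
      by (intro Bochner_Integration.integral_cong) (auto simp: inner_axis abs_sgn mult.commute)
    finally have vi: "v $ i = (1/2) * (\<integral>x. \<bar>x $ i\<bar> \<partial>\<rho>)" by (simp add: inner_axis)
    define m' where "m' = (\<integral>y. sgn (v \<bullet> y) \<partial>\<mu>)"
    have m': "\<bar>m'\<bar> \<le> 1" unfolding m'_def by (rule mean[OF Q(1)]) measurable
    define b where "b y = (sgn (v \<bullet> y) - m') / 2" for y :: "real ^ 'n"
    have is': "integrable \<mu> (\<lambda>x. sgn (v \<bullet> x))"
      using sgn_le by (intro \<mu>.integrable_const_bound[of _ 1]) auto
    have isy: "integrable \<mu> (\<lambda>y. sgn (v \<bullet> y) *\<^sub>R y)"
      by (rule integrable_bounded_scaleR[OF Q(4) _ sgn_le]) measurable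
    have "(\<integral>y. b y *\<^sub>R y \<partial>\<mu>) = (\<integral>y. (1/2) *\<^sub>R (sgn (v \<bullet> y) *\<^sub>R y) - (m' / 2) *\<^sub>R y \<partial>\<mu>)"
      unfolding b_def by (intro Bochner_Integration.integral_cong) (auto simp: algebra_simps diff_divide_distrib scaleR_diff_left)
    also have "\<dots> = (1/2) *\<^sub>R (\<integral>y. sgn (v \<bullet> y) *\<^sub>R y \<partial>\<mu>)"
      by (subst Bochner_Integration.integral_diff)
         (auto intro!: integrable_scaleR_right isy Q(4) simp only: integral_scaleR_right cen scaleR_zero_right diff_0_right)
    finally have "v \<bullet> (\<integral>y. b y *\<^sub>R y \<partial>\<mu>) = (1/2) * (\<integral>y. v \<bullet> (sgn (v \<bullet> y) *\<^sub>R y) \<partial>\<mu>)"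
      using isy by (simp del: inner_scaleR_right add: inner_scaleR_right[of _ "1/2"])
    also have "(\<integral>y. v \<bullet> (sgn (v \<bullet> y) *\<^sub>R y) \<partial>\<mu>) = (\<integral>y. \<bar>v \<bullet> y\<bar> \<partial>\<mu>)"
      by (intro Bochner_Integration.integral_cong) (auto simp: abs_sgn mult.commute)
    finally have vb: "v \<bullet> (\<integral>y. b y *\<^sub>R y \<partial>\<mu>) = (1/2) * (\<integral>y. \<bar>v \<bullet> y\<bar> \<partial>\<mu>)" .
    have T: "ereal (\<Sum>j\<in>{()}. (\<integral>x. a x *\<^sub>R x \<partial>\<rho>) \<bullet> (\<integral>y. b y *\<^sub>R y \<partial>\<mu>)) \<le> T_functional \<rho> \<mu>"
    proof (rule bilinear_coupling[OF \<rho> \<mu> cen, where A="\<lambda>_. 1" and B="\<lambda>_. 1"])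
      show "\<bar>a x\<bar> \<le> 1" "\<bar>b x\<bar> \<le> 1" for x unfolding a_def b_def by (intro half sgn_le m m')+
      then have "\<bar>a x * b y\<bar> \<le> 1" for x y unfolding abs_mult by (intro mult_le_one) auto
      then show "0 \<le> 1 + (\<Sum>j\<in>{()}. a x * b y)" for x y by (simp add: abs_le_iff) (smt (verit))
      show "(\<integral>x. a x \<partial>\<rho>) = 0" unfolding a_def using isg by (simp add: m_def \<rho>.prob_space)
      show "(\<integral>y. b y \<partial>\<mu>) = 0" unfolding b_def using is' by (simp add: m'_def \<mu>.prob_space)
    qed (auto simp: a_def b_def)
    have "c / (4 * CARD('n)) * (\<integral>x. norm x \<partial>\<rho>) \<le> c / (4 * CARD('n)) * (CARD('n) * (\<integral>x. \<bar>x $ i\<bar> \<partial>\<rho>))"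
      using i c by (intro mult_left_mono) auto
    also have "\<dots> = (1/2) * (c * v $ i)" by (simp add: vi)
    also have "\<dots> \<le> (1/2) * (c * norm v)" using c component_le_norm_cart[of v i] by (intro mult_left_mono) auto
    also have "\<dots> \<le> v \<bullet> (\<integral>y. b y *\<^sub>R y \<partial>\<mu>)" unfolding vb using c(2) by (intro mult_left_mono) auto
    finally have "ereal (c / (4 * CARD('n)) * (\<integral>x. norm x \<partial>\<rho>)) \<le> ereal (v \<bullet> (\<integral>y. b y *\<^sub>R y \<partial>\<mu>))"
      by (simp only: ereal_less_eq)
    also have "\<dots> \<le> T_functional \<rho> \<mu>" using T by (simp add: v_def)
    finally show "ereal (c / (4 * CARD('n)) * (\<integral>x. norm x \<partial>\<rho>)) \<le> T_functional \<rho> \<mu>" .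
  qed
qed

section \<open>Lower semicontinuity of the maximal correlation\<close>

text \<open>Tent functions over a finite \<delta>-net of the ball, divided by their sum plus max 0
  (|x| - R). The extra term keeps the denominator positive everywhere and vanishes on the ball,
  where the quotients therefore add up to 1.\<close>

lemma partition_of_unity_cball:
  fixes R \<delta> :: real
  assumes "0 < \<delta>"
  obtains C :: "'a::euclidean_space set" and \<phi> :: "'a \<Rightarrow> 'a \<Rightarrow> real"
  where "finite C" "\<And>c. continuous_on UNIV (\<phi> c)" "\<And>c x. 0 \<le> \<phi> c x" "\<And>c x. \<phi> c x \<le> 1"
    "\<And>x. (\<Sum>c\<in>C. \<phi> c x) \<le> 1" "\<And>x. norm x \<le> R \<Longrightarrow> (\<Sum>c\<in>C. \<phi> c x) = 1"
    "\<And>c x. \<phi> c x \<noteq> 0 \<Longrightarrow> dist x c < \<delta>"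
proof -
  obtain C :: "'a set" where C: "finite C" "cball 0 R \<subseteq> (\<Union>c\<in>C. ball c \<delta>)"
    using compact_eq_totally_bounded[of "cball 0 R :: 'a set"] assms by auto
  define w where "w c x = max 0 (\<delta> - dist x c)" for c x :: 'a
  define D where "D x = (\<Sum>c\<in>C. w c x) + max 0 (norm x - R)" for x
  have w0: "0 \<le> w c x" for c x by (simp add: w_def)
  have D: "0 < D x" for x
  proof (cases "norm x \<le> R")
    case True
    then obtain c where c: "c \<in> C" "dist c x < \<delta>" using C(2) by force
    then have "0 < w c x" by (simp add: w_def dist_commute)
    also have "w c x \<le> (\<Sum>c\<in>C. w c x)" using C c w0 by (intro member_le_sum) auto
    finally show ?thesis by (simp add: D_def add_pos_nonneg)
  next
    case False
    then show ?thesis using w0 by (auto simp: D_def intro!: add_nonneg_pos sum_nonneg)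
  qed
  have le: "(\<Sum>c\<in>C. w c x / D x) \<le> 1" for x
    using D[of x] by (simp add: D_def flip: sum_divide_distrib)
  show thesis
  proof (rule that[of C "\<lambda>c x. if c \<in> C then w c x / D x else 0"])
    show "continuous_on UNIV (\<lambda>x. if c \<in> C then w c x / D x else 0)" for c
      using D by (cases "c \<in> C") (auto simp: w_def D_def less_le intro!: continuous_intros)
    show "0 \<le> (if c \<in> C then w c x / D x else 0)" for c x using w0 D[of x] by simp
    show "(if c \<in> C then w c x / D x else 0) \<le> 1" for c x
    proof (cases "c \<in> C")
      case True
      then have "w c x / D x \<le> (\<Sum>c\<in>C. w c x / D x)"
        using C w0 D[of x] by (intro member_le_sum) (auto intro: less_imp_le)
      then show ?thesis using True le[of x] by simp
    qed simp
    show "(\<Sum>c\<in>C. if c \<in> C then w c x / D x else 0) = 1" if "norm x \<le> R" for x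
      using D[of x] that by (simp add: D_def flip: sum_divide_distrib)
    show "dist x c < \<delta>" if "(if c \<in> C then w c x / D x else 0) \<noteq> 0" for c x
      using that by (auto simp: w_def max_def split: if_splits)
  qed (use C le in auto)
qed

text \<open>\<open>\<beta> j\<close> is the conditional expectation of \<phi>_j(x) given y; it
  exists because the second marginal of \<phi>_j \<gamma> is dominated by \<mu>. The bound on the
  sum is arranged at every y, since the coupling density built from it has to be nonnegative at
  every point.\<close>

lemma marginal_densities:
  fixes \<gamma> :: "('a::euclidean_space \<times> 'b::euclidean_space) measure" and \<phi> :: "'j \<Rightarrow> 'a \<Rightarrow> real"
  assumes \<gamma>: "prob_space \<gamma>" "sets \<gamma> = sets borel" and \<mu>: "distr \<gamma> borel snd = \<mu>"
    and J: "finite J" and m: "\<And>j. \<phi> j \<in> borel_measurable borel"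
    and nn: "\<And>j x. 0 \<le> \<phi> j x" and le: "\<And>x. (\<Sum>j\<in>J. \<phi> j x) \<le> 1"
  obtains \<beta> :: "'j \<Rightarrow> 'b \<Rightarrow> real" where "\<And>j. \<beta> j \<in> borel_measurable borel" "\<And>j y. 0 \<le> \<beta> j y"
    "\<And>y. (\<Sum>j\<in>J. \<beta> j y) \<le> 1"
    "\<And>j. j \<in> J \<Longrightarrow> distr (density \<gamma> (\<lambda>z. ennreal (\<phi> j (fst z)))) borel snd = density \<mu> (\<lambda>y. ennreal (\<beta> j y))"
proof -
  interpret \<gamma>: prob_space \<gamma> by fact
  have bp: "sets \<gamma> = sets (borel \<Otimes>\<^sub>M borel)" unfolding borel_prod by (rule \<gamma>(2))
  note [measurable_cong] = bp
  note [measurable] = m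
  have sets\<mu>[measurable_cong]: "sets \<mu> = sets borel" unfolding \<mu>[symmetric] by simp
  interpret \<mu>: prob_space \<mu> unfolding \<mu>[symmetric] by (rule \<gamma>.prob_space_distr) simp
  define \<kappa> where "\<kappa> j = distr (density \<gamma> (\<lambda>z. ennreal (\<phi> j (fst z)))) borel snd" for j
  have \<kappa>: "emeasure (\<kappa> j) A = (\<integral>\<^sup>+z. ennreal (\<phi> j (fst z)) * indicator A (snd z) \<partial>\<gamma>)"
    if [measurable]: "A \<in> sets borel" for j A
  proof -
    have "emeasure (\<kappa> j) A = emeasure (density \<gamma> (\<lambda>z. ennreal (\<phi> j (fst z)))) (snd -` A \<inter> space \<gamma>)"
      unfolding \<kappa>_def by (subst emeasure_distr) auto
    also have "\<dots> = (\<integral>\<^sup>+z. ennreal (\<phi> j (fst z)) * indicator (snd -` A \<inter> space \<gamma>) z \<partial>\<gamma>)"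
      by (rule emeasure_density) (auto intro!: measurable_sets[where A=\<gamma>])
    finally show ?thesis by (auto simp: indicator_def intro!: nn_integral_cong elim: order.trans)
  qed
  have \<mu>A: "emeasure \<mu> A = (\<integral>\<^sup>+z. indicator A (snd z) \<partial>\<gamma>)" if [measurable]: "A \<in> sets borel" for A
  proof -
    have "emeasure \<mu> A = (\<integral>\<^sup>+y. indicator A y \<partial>\<mu>)" by simp
    also have "\<dots> = (\<integral>\<^sup>+z. indicator A (snd z) \<partial>\<gamma>)" unfolding \<mu>[symmetric] by (rule nn_integral_distr) auto
    finally show ?thesis .
  qed
  have "\<exists>f. f \<in> borel_measurable \<mu> \<and> density \<mu> f = \<kappa> j" if j: "j \<in> J" for j
  proof -
    have "absolutely_continuous \<mu> (\<kappa> j)"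
      unfolding absolutely_continuous_def
    proof
      fix A assume A: "A \<in> null_sets \<mu>"
      then have [measurable]: "A \<in> sets borel" using sets\<mu> by (auto simp: null_sets_def)
      have "emeasure (\<kappa> j) A \<le> emeasure \<mu> A"
        unfolding \<kappa>[OF \<open>A \<in> sets borel\<close>] \<mu>A[OF \<open>A \<in> sets borel\<close>]
      proof (rule nn_integral_mono)
        fix z :: "'a \<times> 'b"
        have "\<phi> j (fst z) \<le> (\<Sum>j\<in>J. \<phi> j (fst z))" using J j nn by (intro member_le_sum) auto
        then have "\<phi> j (fst z) \<le> 1" using le[of "fst z"] by linarith
        then have "ennreal (\<phi> j (fst z)) \<le> ennreal 1" by (rule ennreal_leI)
        then show "ennreal (\<phi> j (fst z)) * indicator A (snd z) \<le> indicator A (snd z)"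
          by (auto simp: indicator_def)
      qed
      then show "A \<in> null_sets (\<kappa> j)" using A by (auto simp: null_sets_def \<kappa>_def)
    qed
    then show ?thesis using \<mu>.Radon_Nikodym[of "\<kappa> j"] by (auto simp: \<kappa>_def sets\<mu>)
  qed
  then have "\<exists>f. \<forall>j\<in>J. f j \<in> borel_measurable \<mu> \<and> density \<mu> (f j) = \<kappa> j" by (intro bchoice) blast
  then obtain f where f: "\<And>j. j \<in> J \<Longrightarrow> f j \<in> borel_measurable \<mu>" "\<And>j. j \<in> J \<Longrightarrow> density \<mu> (f j) = \<kappa> j"
    by blast
  have fm: "j \<in> J \<Longrightarrow> f j \<in> borel_measurable borel" for j using f(1) sets\<mu> measurable_cong_sets by blast
  define S where "S y = (\<Sum>j\<in>J. f j y)" for y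
  have Sm[measurable]: "S \<in> borel_measurable borel" unfolding S_def by (rule borel_measurable_sum) (rule fm)
  \<comment> \<open>On Z the sum exceeds 1, yet it integrates to at most \<mu>(Z); hence Z is a null
    set.\<close>
  define Z where "Z = {y. 1 < S y}"
  have Zm[measurable]: "Z \<in> sets borel" unfolding Z_def by measurable
  have "(\<integral>\<^sup>+y. S y * indicator Z y \<partial>\<mu>) = (\<Sum>j\<in>J. emeasure (\<kappa> j) Z)"
  proof -
    have "(\<integral>\<^sup>+y. S y * indicator Z y \<partial>\<mu>) = (\<integral>\<^sup>+y. (\<Sum>j\<in>J. f j y * indicator Z y) \<partial>\<mu>)"
      by (simp add: S_def sum_distrib_right)
    also have "\<dots> = (\<Sum>j\<in>J. \<integral>\<^sup>+y. f j y * indicator Z y \<partial>\<mu>)"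
      using f(1) by (intro nn_integral_sum) auto
    also have "\<dots> = (\<Sum>j\<in>J. emeasure (\<kappa> j) Z)"
      using f(1) by (intro sum.cong refl) (simp flip: f(2) add: emeasure_density)
    finally show ?thesis .
  qed
  also have "\<dots> = (\<integral>\<^sup>+z. (\<Sum>j\<in>J. ennreal (\<phi> j (fst z)) * indicator Z (snd z)) \<partial>\<gamma>)"
    unfolding \<kappa>[OF Zm] by (rule nn_integral_sum[symmetric]) measurable
  also have "\<dots> \<le> (\<integral>\<^sup>+z. indicator Z (snd z) \<partial>\<gamma>)"
  proof (rule nn_integral_mono)
    fix z :: "'a \<times> 'b"
    have "(\<Sum>j\<in>J. ennreal (\<phi> j (fst z))) = ennreal (\<Sum>j\<in>J. \<phi> j (fst z))" using nn by simp
    also have "\<dots> \<le> ennreal 1" using le by (rule ennreal_leI)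
    finally show "(\<Sum>j\<in>J. ennreal (\<phi> j (fst z)) * indicator Z (snd z)) \<le> indicator Z (snd z)"
      by (auto simp: indicator_def)
  qed
  also have "\<dots> = emeasure \<mu> Z" by (rule \<mu>A[OF Zm, symmetric])
  finally have SZ: "(\<integral>\<^sup>+y. S y * indicator Z y \<partial>\<mu>) \<le> emeasure \<mu> Z" .
  have "(\<integral>\<^sup>+y. S y * indicator Z y \<partial>\<mu>) = (\<integral>\<^sup>+y. (S y - 1) * indicator Z y + indicator Z y \<partial>\<mu>)"
    by (intro nn_integral_cong) (auto simp: indicator_def Z_def diff_add_cancel_ennreal less_imp_le)
  also have "\<dots> = (\<integral>\<^sup>+y. (S y - 1) * indicator Z y \<partial>\<mu>) + emeasure \<mu> Z"
    by (subst nn_integral_add) auto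
  finally have "(\<integral>\<^sup>+y. (S y - 1) * indicator Z y \<partial>\<mu>) + emeasure \<mu> Z \<le> 0 + emeasure \<mu> Z" using SZ by simp
  then have "(\<integral>\<^sup>+y. (S y - 1) * indicator Z y \<partial>\<mu>) \<le> 0"
    unfolding add.commute[of _ "emeasure \<mu> Z"] ennreal_add_left_cancel_le by simp
  then have "AE y in \<mu>. (S y - 1) * indicator Z y = 0" by (simp add: nn_integral_0_iff_AE)
  then have S1: "AE y in \<mu>. S y \<le> 1"
    by eventually_elim (auto simp: Z_def indicator_def diff_eq_0_iff_ennreal split: if_splits)
  have fin: "f j y \<noteq> \<top>" if "S y \<le> 1" "j \<in> J" for j y
  proof -
    have "f j y \<le> S y" unfolding S_def using J that by (intro member_le_sum) auto
    then show ?thesis using that by (auto simp: top_unique)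
  qed
  \<comment> \<open>The densities are reset to 0 on that null set; elsewhere they are finite, so
    \<open>enn2real\<close> loses nothing.\<close>
  define \<beta> where "\<beta> j y = (if j \<in> J \<and> S y \<le> 1 then enn2real (f j y) else 0)" for j y
  show thesis
  proof (rule that)
    show "\<beta> j \<in> borel_measurable borel" for j
    proof (cases "j \<in> J")
      case True
      note fm[OF True, measurable]
      show ?thesis unfolding \<beta>_def by measurable
    qed (simp add: \<beta>_def[abs_def])
    show "0 \<le> \<beta> j y" for j y by (simp add: \<beta>_def)
    show "(\<Sum>j\<in>J. \<beta> j y) \<le> 1" for y
    proof (cases "S y \<le> 1")
      case True
      have "ennreal (\<Sum>j\<in>J. \<beta> j y) = (\<Sum>j\<in>J. ennreal (\<beta> j y))" by (rule sum_ennreal[symmetric]) (simp add: \<beta>_def)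
      also have "\<dots> = S y" unfolding S_def using True fin
        by (intro sum.cong) (auto simp: \<beta>_def less_top)
      also have "\<dots> \<le> ennreal 1" using True by simp
      finally show ?thesis by (subst (asm) ennreal_le_iff) auto
    qed (simp add: \<beta>_def)
    show "distr (density \<gamma> (\<lambda>z. ennreal (\<phi> j (fst z)))) borel snd = density \<mu> (\<lambda>y. ennreal (\<beta> j y))" if j: "j \<in> J" for j
    proof -
      note fm[OF j, measurable]
      have "density \<mu> (f j) = density \<mu> (\<lambda>y. ennreal (\<beta> j y))"
      proof (rule density_cong)
        show "(\<lambda>y. ennreal (\<beta> j y)) \<in> borel_measurable \<mu>" unfolding \<beta>_def by measurable
        show "AE y in \<mu>. f j y = ennreal (\<beta> j y)" using S1
        proof eventually_elim
          case (elim y)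
          then show ?case using fin[of y j] j by (auto simp: \<beta>_def less_top)
        qed
      qed (use f(1)[OF j] in auto)
      then show ?thesis using f(2)[OF j] by (simp add: \<kappa>_def)
    qed
  qed
qed

lemma integral_marginal_density:
  fixes u :: "'b::euclidean_space \<Rightarrow> 'c::{banach, second_countable_topology}" and \<phi> :: "'a::euclidean_space \<Rightarrow> real"
  assumes s\<gamma>: "sets \<gamma> = sets borel" and s\<mu>: "sets \<mu> = sets borel"
    and eq: "distr (density \<gamma> (\<lambda>z. ennreal (\<phi> (fst z)))) borel snd = density \<mu> (\<lambda>y. ennreal (\<beta> y))"
    and [measurable]: "\<phi> \<in> borel_measurable borel" "\<beta> \<in> borel_measurable borel" "u \<in> borel_measurable borel"
    and nn: "\<And>x. 0 \<le> \<phi> x" "\<And>y. 0 \<le> \<beta> y"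
  shows "(\<integral>y. \<beta> y *\<^sub>R u y \<partial>\<mu>) = (\<integral>z. \<phi> (fst z) *\<^sub>R u (snd z) \<partial>\<gamma>)"
proof -
  have bp: "sets \<gamma> = sets (borel \<Otimes>\<^sub>M borel)" unfolding borel_prod by (rule s\<gamma>)
  note [measurable_cong] = bp s\<mu>
  have "(\<integral>y. \<beta> y *\<^sub>R u y \<partial>\<mu>) = (\<integral>y. u y \<partial>density \<mu> (\<lambda>y. ennreal (\<beta> y)))"
    using nn by (subst integral_density) auto
  also have "\<dots> = (\<integral>z. u (snd z) \<partial>density \<gamma> (\<lambda>z. ennreal (\<phi> (fst z))))"
    unfolding eq[symmetric] by (rule integral_distr) auto
  also have "\<dots> = (\<integral>z. \<phi> (fst z) *\<^sub>R u (snd z) \<partial>\<gamma>)"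
    using nn by (subst integral_density) auto
  finally show ?thesis .
qed

lemma coupling_D:
  fixes \<rho> \<mu> :: "(real ^ 'n::finite) measure"
  assumes \<gamma>: "\<gamma> \<in> couplings \<rho> \<mu>" and \<rho>: "\<rho> \<in> P1" and \<mu>: "\<mu> \<in> P1"
  shows "prob_space \<gamma>" "sets \<gamma> = sets borel" "sets \<gamma> = sets (borel \<Otimes>\<^sub>M borel)"
    "distr \<gamma> borel fst = \<rho>" "distr \<gamma> borel snd = \<mu>"
    "integrable \<gamma> (\<lambda>z. norm (snd z))" "(\<integral>z. norm (snd z) \<partial>\<gamma>) = (\<integral>y. norm y \<partial>\<mu>)"
proof -
  show 1: "prob_space \<gamma>" "sets \<gamma> = sets borel" "distr \<gamma> borel fst = \<rho>" "distr \<gamma> borel snd = \<mu>"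
    using \<gamma> by (auto simp: couplings_def)
  show bp: "sets \<gamma> = sets (borel \<Otimes>\<^sub>M borel)" unfolding borel_prod by (rule 1)
  note [measurable_cong] = bp
  have "integrable (distr \<gamma> borel snd) norm" unfolding 1 using P1_D[OF \<mu>] by simp
  then show "integrable \<gamma> (\<lambda>z. norm (snd z))" by (subst (asm) integrable_distr_eq) auto
  show "(\<integral>z. norm (snd z) \<partial>\<gamma>) = (\<integral>y. norm y \<partial>\<mu>)"
    unfolding 1(4)[symmetric] by (rule integral_distr[symmetric]) auto
qed

text \<open>Within the cell, x is replaced by its \<phi>-weighted barycentre m, which turns the
  correlation into a product of separate means. The barycentre is within \<delta> of c, so the
  points of the cell are within 2 \<delta> of it, which is the error term.\<close>

lemma cell_correlation:
  fixes \<rho> \<mu> :: "(real ^ 'n::finite) measure" and \<phi> :: "real ^ 'n \<Rightarrow> real"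
  assumes \<gamma>: "\<gamma> \<in> couplings \<rho> \<mu>" and \<rho>: "\<rho> \<in> P1" and \<mu>: "\<mu> \<in> P1"
    and \<phi>[measurable]: "\<phi> \<in> borel_measurable borel" and nn: "\<And>x. 0 \<le> \<phi> x" "\<And>x. \<phi> x \<le> 1"
    and supp: "\<And>x. \<phi> x \<noteq> 0 \<Longrightarrow> dist x c < \<delta>" and r: "0 < (\<integral>x. \<phi> x \<partial>\<rho>)"
  shows "integrable \<gamma> (\<lambda>z. \<phi> (fst z) * (fst z \<bullet> snd z))"
    "(\<integral>z. \<phi> (fst z) * (fst z \<bullet> snd z) \<partial>\<gamma>) - 2 * \<delta> * (\<integral>z. \<phi> (fst z) * norm (snd z) \<partial>\<gamma>)
      \<le> (\<integral>x. \<phi> x *\<^sub>R x \<partial>\<rho>) \<bullet> (\<integral>z. \<phi> (fst z) *\<^sub>R snd z \<partial>\<gamma>) / (\<integral>x. \<phi> x \<partial>\<rho>)"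
proof -
  note G = coupling_D[OF \<gamma> \<rho> \<mu>] and P = P1_D[OF \<rho>]
  note [measurable_cong] = G(3) P(2)
  interpret \<gamma>: prob_space \<gamma> by (rule G)
  interpret \<rho>: prob_space \<rho> by (rule P)
  let ?r = "\<integral>x. \<phi> x \<partial>\<rho>"
  have abs1: "\<bar>\<phi> x\<bar> \<le> 1" for x using nn by simp
  have i\<phi>: "integrable \<rho> \<phi>" using abs1 by (intro \<rho>.integrable_const_bound[of _ 1]) auto
  have i\<phi>x: "integrable \<rho> (\<lambda>x. \<phi> x *\<^sub>R x)" by (rule integrable_bounded_scaleR[OF P(4) _ abs1]) measurable
  define m where "m = (1 / ?r) *\<^sub>R (\<integral>x. \<phi> x *\<^sub>R x \<partial>\<rho>)"
  have "0 < \<delta>"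
  proof -
    obtain x where "\<phi> x \<noteq> 0" using r by fastforce
    then show ?thesis using supp[of x] zero_le_dist[of x c] by linarith
  qed
  have mc: "norm (m - c) \<le> \<delta>"
  proof -
    have "?r *\<^sub>R (m - c) = (\<integral>x. \<phi> x *\<^sub>R x \<partial>\<rho>) - (\<integral>x. \<phi> x *\<^sub>R c \<partial>\<rho>)"
      using r i\<phi> by (simp add: m_def scaleR_diff_right)
    also have "\<dots> = (\<integral>x. \<phi> x *\<^sub>R x - \<phi> x *\<^sub>R c \<partial>\<rho>)"
      by (rule Bochner_Integration.integral_diff[symmetric]) (use i\<phi>x i\<phi> in auto)
    finally have "norm (?r *\<^sub>R (m - c)) \<le> (\<integral>x. norm (\<phi> x *\<^sub>R x - \<phi> x *\<^sub>R c) \<partial>\<rho>)" by simp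
    also have "\<dots> \<le> (\<integral>x. \<phi> x * \<delta> \<partial>\<rho>)"
    proof (rule integral_mono)
      fix x
      have "norm (\<phi> x *\<^sub>R x - \<phi> x *\<^sub>R c) = \<phi> x * dist x c"
        using nn by (simp add: dist_norm flip: scaleR_diff_right)
      also have "\<dots> \<le> \<phi> x * \<delta>" using supp[of x] nn by (cases "\<phi> x = 0") (auto intro!: mult_left_mono)
      finally show "norm (\<phi> x *\<^sub>R x - \<phi> x *\<^sub>R c) \<le> \<phi> x * \<delta>" .
    qed (use i\<phi> i\<phi>x in auto)
    finally show ?thesis using r by simp
  qed
  have near: "norm (x - m) \<le> 2 * \<delta>" if "\<phi> x \<noteq> 0" for x
  proof -
    have "norm (x - m) \<le> norm (x - c) + norm (m - c)" by norm
    then show ?thesis using supp[OF that] mc by (simp add: dist_norm)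
  qed
  have iy: "integrable \<gamma> (\<lambda>z. snd z)"
    using G(6) by (subst (asm) integrable_norm_iff) auto
  have i\<phi>y: "integrable \<gamma> (\<lambda>z. \<phi> (fst z) *\<^sub>R snd z)"
    by (rule integrable_bounded_scaleR[OF iy _ abs1]) measurable
  have i\<phi>n: "integrable \<gamma> (\<lambda>z. \<phi> (fst z) * norm (snd z))"
    using integrable_norm[OF i\<phi>y] nn by simp
  have i1: "integrable \<gamma> (\<lambda>z. \<phi> (fst z) * ((fst z - m) \<bullet> snd z))"
    and b1: "\<bar>\<phi> (fst z) * ((fst z - m) \<bullet> snd z)\<bar> \<le> 2 * \<delta> * (\<phi> (fst z) * norm (snd z))" for z
  proof -
    show b: "\<bar>\<phi> (fst z) * ((fst z - m) \<bullet> snd z)\<bar> \<le> 2 * \<delta> * (\<phi> (fst z) * norm (snd z))" for z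
    proof (cases "\<phi> (fst z) = 0")
      case False
      have "\<bar>(fst z - m) \<bullet> snd z\<bar> \<le> norm (fst z - m) * norm (snd z)" by (rule Cauchy_Schwarz_ineq2)
      also have "\<dots> \<le> 2 * \<delta> * norm (snd z)" using near[OF False] by (intro mult_right_mono) auto
      finally have "\<phi> (fst z) * \<bar>(fst z - m) \<bullet> snd z\<bar> \<le> \<phi> (fst z) * (2 * \<delta> * norm (snd z))"
        using nn by (intro mult_left_mono) auto
      then show ?thesis using nn by (simp add: abs_mult mult_ac)
    qed simp
    show "integrable \<gamma> (\<lambda>z. \<phi> (fst z) * ((fst z - m) \<bullet> snd z))"
    proof (rule Bochner_Integration.integrable_bound)
      show "integrable \<gamma> (\<lambda>z. 2 * \<delta> * (\<phi> (fst z) * norm (snd z)))" using i\<phi>n by simp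
      show "AE z in \<gamma>. norm (\<phi> (fst z) * ((fst z - m) \<bullet> snd z)) \<le> norm (2 * \<delta> * (\<phi> (fst z) * norm (snd z)))"
        by (intro AE_I2, unfold real_norm_def) (rule order_trans[OF b abs_ge_self])
    qed measurable
  qed
  have i2: "integrable \<gamma> (\<lambda>z. \<phi> (fst z) * (m \<bullet> snd z))"
    using integrable_inner_right[of m, OF i\<phi>y] by (simp only: inner_scaleR_right)
  have split: "\<phi> (fst z) * (fst z \<bullet> snd z) = \<phi> (fst z) * ((fst z - m) \<bullet> snd z) + \<phi> (fst z) * (m \<bullet> snd z)" for z
    by (simp add: inner_diff_left algebra_simps)
  show "integrable \<gamma> (\<lambda>z. \<phi> (fst z) * (fst z \<bullet> snd z))"
    unfolding split by (intro Bochner_Integration.integrable_add i1 i2)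
  have "(\<integral>z. \<phi> (fst z) * (fst z \<bullet> snd z) \<partial>\<gamma>)
      = (\<integral>z. \<phi> (fst z) * ((fst z - m) \<bullet> snd z) \<partial>\<gamma>) + (\<integral>z. \<phi> (fst z) * (m \<bullet> snd z) \<partial>\<gamma>)"
    unfolding split by (rule Bochner_Integration.integral_add[OF i1 i2])
  also have "(\<integral>z. \<phi> (fst z) * ((fst z - m) \<bullet> snd z) \<partial>\<gamma>) \<le> (\<integral>z. 2 * \<delta> * (\<phi> (fst z) * norm (snd z)) \<partial>\<gamma>)"
    using b1 i1 i\<phi>n by (intro integral_mono) (auto simp: abs_le_iff)
  also have "(\<integral>z. 2 * \<delta> * (\<phi> (fst z) * norm (snd z)) \<partial>\<gamma>) = 2 * \<delta> * (\<integral>z. \<phi> (fst z) * norm (snd z) \<partial>\<gamma>)" by simp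
  also have "(\<integral>z. \<phi> (fst z) * (m \<bullet> snd z) \<partial>\<gamma>) = m \<bullet> (\<integral>z. \<phi> (fst z) *\<^sub>R snd z \<partial>\<gamma>)"
    using integral_inner_right[of m, OF i\<phi>y] by (simp only: inner_scaleR_right)
  finally show "(\<integral>z. \<phi> (fst z) * (fst z \<bullet> snd z) \<partial>\<gamma>) - 2 * \<delta> * (\<integral>z. \<phi> (fst z) * norm (snd z) \<partial>\<gamma>)
      \<le> (\<integral>x. \<phi> x *\<^sub>R x \<partial>\<rho>) \<bullet> (\<integral>z. \<phi> (fst z) *\<^sub>R snd z \<partial>\<gamma>) / ?r"
    by (simp add: m_def)
qed

text \<open>The correlation may be infinite, but a value above K forces its negative part to be
  finite. Monotone convergence recovers the positive part on large balls, and a cutoff with values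
  in [0, 1] can only shrink the negative part.\<close>

lemma correlation_truncation:
  fixes \<rho> \<mu> :: "(real ^ 'n::finite) measure"
  assumes \<gamma>: "\<gamma> \<in> couplings \<rho> \<mu>" and \<rho>: "\<rho> \<in> P1" and \<mu>: "\<mu> \<in> P1"
    and mean: "integral_meaningful \<gamma> (\<lambda>(x, y). x \<bullet> y)" and K: "ereal K < ext_integral \<gamma> (\<lambda>(x, y). x \<bullet> y)"
  obtains K' R0 where "K < K'"
    "\<And>R s. R0 \<le> R \<Longrightarrow> s \<in> borel_measurable borel \<Longrightarrow> (\<And>x. 0 \<le> s x) \<Longrightarrow> (\<And>x. s x \<le> 1) \<Longrightarrow>
      (\<And>x. norm x \<le> R \<Longrightarrow> s x = 1) \<Longrightarrow> integrable \<gamma> (\<lambda>z. s (fst z) * (fst z \<bullet> snd z)) \<Longrightarrow>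
      K' \<le> (\<integral>z. s (fst z) * (fst z \<bullet> snd z) \<partial>\<gamma>)"
proof -
  note G = coupling_D[OF \<gamma> \<rho> \<mu>]
  note [measurable_cong] = G(3)
  define f where "f z = fst z \<bullet> snd z" for z :: "(real ^ 'n) \<times> (real ^ 'n)"
  have [measurable]: "f \<in> borel_measurable (borel \<Otimes>\<^sub>M borel)" unfolding f_def by measurable
  define P where "P = (\<integral>\<^sup>+z. ennreal (f z) \<partial>\<gamma>)"
  define Q where "Q = (\<integral>\<^sup>+z. ennreal (- f z) \<partial>\<gamma>)"
  have ext: "ext_integral \<gamma> (\<lambda>(x, y). x \<bullet> y) = enn2ereal P - enn2ereal Q"
    by (simp add: ext_integral_def P_def Q_def f_def case_prod_beta')
  have Qfin: "Q < \<infinity>"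
  proof (rule ccontr)
    assume "\<not> Q < \<infinity>"
    then have Q: "Q = \<top>" using less_top[of Q] by auto
    moreover have "P < \<infinity>" using mean Q by (auto simp: integral_meaningful_def P_def Q_def f_def case_prod_beta')
    ultimately have "enn2ereal P - enn2ereal Q = - \<infinity>"
      by (cases P) (auto simp: enn2ereal_ennreal top_ennreal.rep_eq top_ereal_def)
    then show False using K ext by simp
  qed
  define qr where "qr = enn2real Q"
  have Qqr: "Q = ennreal qr" and qr: "0 \<le> qr" using Qfin by (auto simp: qr_def)
  have "ereal (K + qr) < enn2ereal P"
    using K unfolding ext Qqr using qr by (simp add: enn2ereal_ennreal ereal_less_minus flip: plus_ereal.simps(1))
  \<comment> \<open>Room is left on both sides of K1: below, it makes K1 - qr exceed K; above, it
    lets a truncated positive part still reach K1, even if P is infinite.\<close>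
  then obtain K1 where K1: "ereal (K + qr) < ereal K1" "ereal K1 < enn2ereal P"
    using ereal_dense2 by blast
  define u where "u m z = ennreal (f z) * indicator {z. norm (fst z) \<le> real m} z" for m :: nat and z
  have [measurable]: "u m \<in> borel_measurable (borel \<Otimes>\<^sub>M borel)" for m unfolding u_def by measurable
  have "\<exists>m. ennreal K1 \<le> (\<integral>\<^sup>+z. u m z \<partial>\<gamma>)"
  proof (cases "K1 \<le> 0")
    case False
    have inc: "incseq u"
      by (auto simp: incseq_def le_fun_def u_def indicator_def)
    have "(\<integral>\<^sup>+z. (SUP m. u m z) \<partial>\<gamma>) = (SUP m. \<integral>\<^sup>+z. u m z \<partial>\<gamma>)"
      by (rule nn_integral_monotone_convergence_SUP[OF inc]) measurable
    moreover have "(SUP m. u m z) = ennreal (f z)" for z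
    proof (rule antisym)
      show "(SUP m. u m z) \<le> ennreal (f z)" by (rule SUP_least) (auto simp: u_def indicator_def)
      obtain m :: nat where "norm (fst z) \<le> m" using real_arch_simple by blast
      then have "ennreal (f z) = u m z" by (simp add: u_def)
      also have "\<dots> \<le> (SUP m. u m z)" by (rule SUP_upper) simp
      finally show "ennreal (f z) \<le> (SUP m. u m z)" .
    qed
    ultimately have "P = (SUP m. \<integral>\<^sup>+z. u m z \<partial>\<gamma>)" by (simp add: P_def)
    moreover have "ennreal K1 < P" using K1(2) False by (simp add: less_ennreal.rep_eq enn2ereal_ennreal)
    ultimately show ?thesis by (auto simp: less_SUP_iff intro: less_imp_le)
  qed (simp add: ennreal_neg)
  then obtain m where m: "ennreal K1 \<le> (\<integral>\<^sup>+z. u m z \<partial>\<gamma>)" by blast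
  show thesis
  proof (rule that)
    show "K < K1 - qr" using K1(1) by simp
    fix R :: real and s :: "real ^ 'n \<Rightarrow> real"
    assume R: "real m \<le> R" and [measurable]: "s \<in> borel_measurable borel"
      and s: "\<And>x. 0 \<le> s x" "\<And>x. s x \<le> 1" "\<And>x. norm x \<le> R \<Longrightarrow> s x = 1"
      and int: "integrable \<gamma> (\<lambda>z. s (fst z) * (fst z \<bullet> snd z))"
    \<comment> \<open>The minorant g - n keeps the positive part only on the ball, where the cutoff
      is 1, and all of the negative part.\<close>
    define g where "g z = max 0 (f z) * indicator {z. norm (fst z) \<le> R} z" for z
    define n where "n z = max 0 (- f z)" for z
    have [measurable]: "g \<in> borel_measurable (borel \<Otimes>\<^sub>M borel)" "n \<in> borel_measurable (borel \<Otimes>\<^sub>M borel)"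
      unfolding g_def n_def by measurable
    have int: "integrable \<gamma> (\<lambda>z. s (fst z) * f z)" using int by (simp add: f_def)
    have ig: "integrable \<gamma> g"
      by (rule Bochner_Integration.integrable_bound[OF int])
         (auto simp: g_def indicator_def s(3) intro!: AE_I2)
    have g0: "0 \<le> g z" for z by (simp add: g_def)
    have nQ: "(\<integral>\<^sup>+z. ennreal (n z) \<partial>\<gamma>) = Q"
      unfolding Q_def by (intro nn_integral_cong) (auto simp: n_def max_def ennreal_neg)
    then have "integrable \<gamma> n" using Qfin by (intro integrableI_bounded) (auto simp: n_def)
    moreover have "(\<integral>z. n z \<partial>\<gamma>) = qr"
      using nQ by (simp add: qr_def integral_eq_nn_integral n_def)
    moreover have "K1 \<le> (\<integral>z. g z \<partial>\<gamma>)"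
    proof -
      have "ennreal K1 \<le> (\<integral>\<^sup>+z. ennreal (g z) \<partial>\<gamma>)"
        using R by (intro order_trans[OF m] nn_integral_mono)
          (auto simp: u_def g_def indicator_def max_def ennreal_neg)
      also have "\<dots> = ennreal (\<integral>z. g z \<partial>\<gamma>)"
        by (rule nn_integral_eq_integral[OF ig]) (simp add: g_def)
      finally show ?thesis
        by (subst (asm) ennreal_le_iff) (auto intro!: integral_nonneg_AE AE_I2 simp: g0)
    qed
    moreover have "(\<integral>z. g z - n z \<partial>\<gamma>) \<le> (\<integral>z. s (fst z) * f z \<partial>\<gamma>)"
    proof (rule integral_mono)
      fix z
      show "g z - n z \<le> s (fst z) * f z"
      proof (cases "norm (fst z) \<le> R")
        case True
        then show ?thesis by (auto simp: g_def n_def s(3))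
      next
        case False
        have "- n z \<le> s (fst z) * - n z" using s(1,2)[of "fst z"] by (simp add: n_def mult_left_le_one_le)
        also have "\<dots> \<le> s (fst z) * f z" using s(1) by (intro mult_left_mono) (auto simp: n_def)
        finally show ?thesis using False by (simp add: g_def)
      qed
    qed (use ig calculation(1) int in auto)
    ultimately show "K1 - qr \<le> (\<integral>z. s (fst z) * (fst z \<bullet> snd z) \<partial>\<gamma>)"
      using ig by (simp add: f_def)
  qed
qed

text \<open>A coupling \<gamma> with correlation above K is replaced by its cell version: given the
  cell c of x, y has density \<beta>_c / r_c with respect to \<mu>, independently of the position in
  the cell. If the cells exhaust the mass, this has the product form with factors \<phi>_c - r_c and
  \<beta>_c / r_c - 1. Recentring \<phi>_c under \<rho> k instead of \<rho>' gives a coupling of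
  \<rho> k and \<mu>, and its finitely many cell integrals converge.\<close>

lemma T_functional_lsc:
  fixes \<rho> :: "nat \<Rightarrow> (real ^ 'n::finite) measure"
  assumes \<rho>k: "\<And>k. \<rho> k \<in> P1" and \<rho>: "\<rho>' \<in> P1" and \<mu>: "\<mu> \<in> P1" and cen: "(\<integral>y. y \<partial>\<mu>) = 0"
    and cenk: "\<And>k. (\<integral>x. x \<partial>\<rho> k) = 0" and w: "weakly_converges \<rho> \<rho>'"
    and K: "ereal K < T_functional \<rho>' \<mu>"
  shows "\<forall>\<^sub>F k in sequentially. ereal K < T_functional (\<rho> k) \<mu>"
proof -
  obtain \<gamma> where \<gamma>: "\<gamma> \<in> couplings \<rho>' \<mu>" "integral_meaningful \<gamma> (\<lambda>(x, y). x \<bullet> y)"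
      "ereal K < ext_integral \<gamma> (\<lambda>(x, y). x \<bullet> y)"
    using K unfolding T_functional_def less_Sup_iff by blast
  obtain K' R0 where K': "K < K'" and trunc: "\<And>R s. R0 \<le> R \<Longrightarrow> s \<in> borel_measurable borel \<Longrightarrow>
      (\<And>x. 0 \<le> s x) \<Longrightarrow> (\<And>x. s x \<le> 1) \<Longrightarrow>
      (\<And>x. norm x \<le> R \<Longrightarrow> s x = 1) \<Longrightarrow> integrable \<gamma> (\<lambda>z. s (fst z) * (fst z \<bullet> snd z)) \<Longrightarrow>
      K' \<le> (\<integral>z. s (fst z) * (fst z \<bullet> snd z) \<partial>\<gamma>)"
    by (rule correlation_truncation[OF \<gamma>(1) \<rho> \<mu> \<gamma>(2,3)]) blast
  note G = coupling_D[OF \<gamma>(1) \<rho> \<mu>] and P = P1_D[OF \<rho>] and Q = P1_D[OF \<mu>]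
  note [measurable_cong] = G(3) P(2) Q(2)
  interpret \<gamma>: prob_space \<gamma> by (rule G)
  interpret \<rho>: prob_space \<rho>' by (rule P)
  interpret \<mu>: prob_space \<mu> by (rule Q)
  \<comment> \<open>So small that the loss of a factor 1 - \<epsilon> and of the total cell error
    \<epsilon> still leaves more than K.\<close>
  define \<epsilon> where "\<epsilon> = min (1/2) ((K' - K) / (2 * (1 + \<bar>K'\<bar>)))"
  have \<epsilon>: "0 < \<epsilon>" "\<epsilon> < 1" using K' by (auto simp: \<epsilon>_def)
  have \<epsilon>K: "K < (1 - \<epsilon>) * (K' - \<epsilon>)"
  proof -
    have "\<epsilon> \<le> (K' - K) / (2 * (1 + \<bar>K'\<bar>))" by (simp add: \<epsilon>_def)
    then have "\<epsilon> * (1 + \<bar>K'\<bar>) \<le> (K' - K) / 2" by (simp add: field_simps add_pos_nonneg)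
    moreover have "\<epsilon> * K' \<le> \<epsilon> * \<bar>K'\<bar>" using \<epsilon> by (intro mult_left_mono) auto
    moreover have "0 < \<epsilon> * \<epsilon>" using \<epsilon> by simp
    ultimately show ?thesis using K' by (simp add: algebra_simps)
  qed
  define m\<rho> where "m\<rho> = (\<integral>x. norm x \<partial>\<rho>')"
  define m\<mu> where "m\<mu> = (\<integral>y. norm y \<partial>\<mu>)"
  have m0: "0 \<le> m\<rho>" "0 \<le> m\<mu>" unfolding m\<rho>_def m\<mu>_def by (auto intro: integral_nonneg_AE)
  \<comment> \<open>Less than \<epsilon> of the mass of \<rho>' escapes the cells, by a Markov
    estimate.\<close>
  define R where "R = max R0 (m\<rho> / \<epsilon> + 1)"
  have R: "R0 \<le> R" "0 < R" "m\<rho> / R < \<epsilon>"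
  proof -
    have "0 \<le> m\<rho> / \<epsilon>" using m0 \<epsilon> by simp
    then show "0 < R" by (auto simp: R_def)
    have "m\<rho> / \<epsilon> < R" by (auto simp: R_def)
    then show "m\<rho> / R < \<epsilon>" using \<open>0 < R\<close> \<epsilon> by (simp add: field_simps)
  qed (simp add: R_def)
  \<comment> \<open>Summed over all cells, the barycentre error is at most 2 \<delta> times the
    first moment of \<mu>.\<close>
  define \<delta> where "\<delta> = \<epsilon> / (2 * (m\<mu> + 1))"
  have \<delta>: "0 < \<delta>" "2 * \<delta> * m\<mu> < \<epsilon>" using \<epsilon> m0 by (auto simp: \<delta>_def field_simps)
  obtain C :: "(real ^ 'n) set" and \<phi> :: "real ^ 'n \<Rightarrow> real ^ 'n \<Rightarrow> real" where C: "finite C"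
    and \<phi>c: "\<And>c. continuous_on UNIV (\<phi> c)" and \<phi>0: "\<And>c x. 0 \<le> \<phi> c x" and \<phi>1: "\<And>c x. \<phi> c x \<le> 1"
    and s1: "\<And>x. (\<Sum>c\<in>C. \<phi> c x) \<le> 1" and sR: "\<And>x. norm x \<le> R \<Longrightarrow> (\<Sum>c\<in>C. \<phi> c x) = 1"
    and supp: "\<And>c x. \<phi> c x \<noteq> 0 \<Longrightarrow> dist x c < \<delta>"
    by (rule partition_of_unity_cball[OF \<delta>(1), of R]) blast
  have [measurable]: "\<phi> c \<in> borel_measurable borel" for c by (rule borel_measurable_continuous_onI[OF \<phi>c])
  have \<phi>abs: "\<bar>\<phi> c x\<bar> \<le> 1" for c x using \<phi>0 \<phi>1 by simp
  obtain \<beta> where [measurable]: "\<And>c. \<beta> c \<in> borel_measurable borel" and \<beta>0: "\<And>c y. 0 \<le> \<beta> c y"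
    and \<beta>1: "\<And>y. (\<Sum>c\<in>C. \<beta> c y) \<le> 1"
    and \<beta>: "\<And>c. c \<in> C \<Longrightarrow> distr (density \<gamma> (\<lambda>z. ennreal (\<phi> c (fst z)))) borel snd = density \<mu> (\<lambda>y. ennreal (\<beta> c y))"
    by (rule marginal_densities[OF G(1,2,5) C, of \<phi>]) (use \<phi>0 s1 in auto)
  define r where "r c = (\<integral>x. \<phi> c x \<partial>\<rho>')" for c
  have r0: "0 \<le> r c" for c unfolding r_def using \<phi>0 by (intro integral_nonneg_AE) auto
  have i\<phi>: "integrable \<rho>' (\<phi> c)" for c using \<phi>abs by (intro \<rho>.integrable_const_bound[of _ 1]) auto
  have rsum: "1 - (\<Sum>c\<in>C. r c) < \<epsilon>"
  proof -
    have "1 - (\<Sum>c\<in>C. r c) = (\<integral>x. 1 - (\<Sum>c\<in>C. \<phi> c x) \<partial>\<rho>')" using i\<phi> by (simp add: r_def \<rho>.prob_space)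
    also have "\<dots> \<le> (\<integral>x. norm x / R \<partial>\<rho>')"
    proof (rule integral_mono)
      fix x
      have "0 \<le> (\<Sum>c\<in>C. \<phi> c x)" using \<phi>0 by (intro sum_nonneg) auto
      then show "1 - (\<Sum>c\<in>C. \<phi> c x) \<le> norm x / R"
      proof (cases "norm x \<le> R")
        case False
        then have "1 \<le> norm x / R" using R(2) by simp
        then show ?thesis using \<open>0 \<le> (\<Sum>c\<in>C. \<phi> c x)\<close> by linarith
      qed (use sR[of x] R(2) in simp)
    qed (use i\<phi> P(5) in auto)
    also have "\<dots> < \<epsilon>" using R by (simp add: m\<rho>_def)
    finally show ?thesis .
  qed
  have \<beta>le: "\<beta> c y \<le> 1" if "c \<in> C" for c y
    using member_le_sum[OF that, of "\<lambda>c. \<beta> c y"] C \<beta>0 \<beta>1[of y] by auto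
  have i\<beta>: "integrable \<mu> (\<beta> c)" if "c \<in> C" for c
    using \<beta>0 \<beta>le[OF that] by (intro \<mu>.integrable_const_bound[of _ 1]) auto
  have \<beta>r: "(\<integral>y. \<beta> c y \<partial>\<mu>) = r c" if "c \<in> C" for c
  proof -
    have "(\<integral>y. \<beta> c y \<partial>\<mu>) = (\<integral>z. \<phi> c (fst z) \<partial>\<gamma>)"
      using integral_marginal_density[OF G(2) Q(2) \<beta>[OF that], of "\<lambda>_. 1::real"] \<phi>0 \<beta>0 by simp
    also have "\<dots> = r c" unfolding r_def G(4)[symmetric] by (rule integral_distr[symmetric]) auto
    finally show ?thesis .
  qed
  define A where "A c = (\<integral>z. \<phi> c (fst z) *\<^sub>R snd z \<partial>\<gamma>)" for c
  have \<beta>y: "(\<integral>y. \<beta> c y *\<^sub>R y \<partial>\<mu>) = A c" if "c \<in> C" for c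
    unfolding A_def by (rule integral_marginal_density[OF G(2) Q(2) \<beta>[OF that]]) (use \<phi>0 \<beta>0 in auto)
  text \<open>The factor \<open>1 - \<epsilon>\<close> keeps the transported density nonnegative when \<open>\<rho>'\<close> is replaced by \<open>\<rho> k\<close>.\<close>
  define b where "b c y = (if c \<in> C \<and> r c \<noteq> 0 then (1 - \<epsilon>) * (\<beta> c y / r c - 1) else 0)" for c y
  define B where "B c = 1 / r c + 1" for c
  have [measurable]: "b c \<in> borel_measurable borel" for c unfolding b_def by measurable
  have bB: "\<bar>b c y\<bar> \<le> B c" for c y
  proof (cases "c \<in> C \<and> r c \<noteq> 0")
    case True
    then have rp: "0 < r c" using r0[of c] by simp
    have "0 \<le> \<beta> c y / r c" "\<beta> c y / r c \<le> 1 / r c" using \<beta>0 \<beta>le True rp by (auto intro!: divide_right_mono)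
    then have "\<bar>\<beta> c y / r c - 1\<bar> \<le> 1 / r c + 1" using rp by (auto simp: abs_le_iff)
    then have "(1 - \<epsilon>) * \<bar>\<beta> c y / r c - 1\<bar> \<le> 1 * (1 / r c + 1)" using \<epsilon> by (intro mult_mono) auto
    then show ?thesis using True \<epsilon> by (simp add: b_def B_def abs_mult)
  next
    case False
    then show ?thesis using r0[of c] by (auto simp: b_def B_def)
  qed
  have b_low: "- (1 - \<epsilon>) \<le> b c y" for c y
  proof (cases "c \<in> C \<and> r c \<noteq> 0")
    case True
    have "(1 - \<epsilon>) * (- 1) \<le> (1 - \<epsilon>) * (\<beta> c y / r c - 1)"
      using \<epsilon> \<beta>0 r0 by (intro mult_left_mono) auto
    then show ?thesis using True by (simp add: b_def)
  qed (use \<epsilon> in \<open>auto simp: b_def\<close>)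
  have rb: "r c * b c y \<le> (1 - \<epsilon>) * (\<beta> c y - r c)" if "c \<in> C" for c y
  proof (cases "r c = 0")
    case True
    then show ?thesis using \<epsilon> \<beta>0[of c y] by simp
  next
    case False
    then have "r c * (\<beta> c y / r c - 1) = \<beta> c y - r c" by (simp add: right_diff_distrib)
    moreover have "r c * b c y = (1 - \<epsilon>) * (r c * (\<beta> c y / r c - 1))" using False that by (simp add: b_def)
    ultimately show ?thesis by simp
  qed
  have b0: "(\<integral>y. b c y \<partial>\<mu>) = 0" for c
    using i\<beta>[of c] \<beta>r[of c] by (cases "c \<in> C \<and> r c \<noteq> 0") (auto simp: b_def \<mu>.prob_space)
  define U where "U c = (\<integral>y. b c y *\<^sub>R y \<partial>\<mu>)" for c
  have Up: "U c = ((1 - \<epsilon>) / r c) *\<^sub>R A c" if c: "c \<in> C" "r c \<noteq> 0" for c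
  proof -
    have i1: "integrable \<mu> (\<lambda>y. \<beta> c y *\<^sub>R y)"
      by (rule integrable_bounded_scaleR[OF Q(4), where A=1]) (use \<beta>0 \<beta>le c in auto)
    have "U c = (\<integral>y. ((1 - \<epsilon>) / r c) *\<^sub>R (\<beta> c y *\<^sub>R y) - (1 - \<epsilon>) *\<^sub>R y \<partial>\<mu>)"
      unfolding U_def b_def using c
      by (intro Bochner_Integration.integral_cong) (auto simp: algebra_simps scaleR_diff_left)
    also have "\<dots> = (\<integral>y. ((1 - \<epsilon>) / r c) *\<^sub>R (\<beta> c y *\<^sub>R y) \<partial>\<mu>) - (\<integral>y. (1 - \<epsilon>) *\<^sub>R y \<partial>\<mu>)"
      by (intro Bochner_Integration.integral_diff integrable_scaleR_right i1 Q(4))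
    also have "\<dots> = ((1 - \<epsilon>) / r c) *\<^sub>R A c"
      by (simp only: integral_scaleR_right \<beta>y[OF c(1)] cen scaleR_zero_right diff_0_right)
    finally show ?thesis .
  qed
  define X where "X c = (\<integral>x. \<phi> c x *\<^sub>R x \<partial>\<rho>')" for c
  have iy: "integrable \<gamma> snd" using G(6) by (subst (asm) integrable_norm_iff) auto
  have i\<phi>n: "integrable \<gamma> (\<lambda>z. \<phi> c (fst z) * norm (snd z))" for c
  proof -
    have "integrable \<gamma> (\<lambda>z. \<phi> c (fst z) *\<^sub>R snd z)"
      by (rule integrable_bounded_scaleR[OF iy _ \<phi>abs]) measurable
    from integrable_norm[OF this] show ?thesis using \<phi>0 by simp
  qed
  have cell: "integrable \<gamma> (\<lambda>z. \<phi> c (fst z) * (fst z \<bullet> snd z)) \<and>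
      (1 - \<epsilon>) * ((\<integral>z. \<phi> c (fst z) * (fst z \<bullet> snd z) \<partial>\<gamma>) - 2 * \<delta> * (\<integral>z. \<phi> c (fst z) * norm (snd z) \<partial>\<gamma>))
      \<le> X c \<bullet> U c" if c: "c \<in> C" for c
  proof (cases "r c = 0")
    \<comment> \<open>A cell without mass has \<phi>_c = 0 almost everywhere under \<gamma>, and b_c
      was set to 0, so both sides vanish.\<close>
    case True
    then have "AE x in \<rho>'. \<phi> c x = 0"
      unfolding r_def by (subst (asm) integral_nonneg_eq_0_iff_AE) (use i\<phi> \<phi>0 in auto)
    then have "AE x in distr \<gamma> borel fst. \<phi> c x = 0" unfolding G(4) .
    then have ae: "AE z in \<gamma>. \<phi> c (fst z) = 0" by (subst (asm) AE_distr_iff) auto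
    have z1: "AE z in \<gamma>. \<phi> c (fst z) * (fst z \<bullet> snd z) = 0" "AE z in \<gamma>. \<phi> c (fst z) * norm (snd z) = 0"
      using ae by auto
    have "integrable \<gamma> (\<lambda>z. \<phi> c (fst z) * (fst z \<bullet> snd z)) \<longleftrightarrow> integrable \<gamma> (\<lambda>z. 0::real)"
      by (rule integrable_cong_AE) (use z1 in auto)
    moreover have "(\<integral>z. \<phi> c (fst z) * (fst z \<bullet> snd z) \<partial>\<gamma>) = (\<integral>z. 0 \<partial>\<gamma>)"
      by (rule integral_cong_AE) (use z1 in auto)
    moreover have "(\<integral>z. \<phi> c (fst z) * norm (snd z) \<partial>\<gamma>) = (\<integral>z. 0 \<partial>\<gamma>)"
      by (rule integral_cong_AE) (use z1 in auto)
    moreover have "U c = 0" using True by (simp add: U_def b_def)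
    ultimately show ?thesis by simp
  next
    case False
    then have rp: "0 < (\<integral>x. \<phi> c x \<partial>\<rho>')" using r0[of c] by (simp add: r_def)
    note cc = cell_correlation[OF \<gamma>(1) \<rho> \<mu> _ \<phi>0 \<phi>1 supp rp]
    have "(1 - \<epsilon>) * ((\<integral>z. \<phi> c (fst z) * (fst z \<bullet> snd z) \<partial>\<gamma>) - 2 * \<delta> * (\<integral>z. \<phi> c (fst z) * norm (snd z) \<partial>\<gamma>))
        \<le> (1 - \<epsilon>) * (X c \<bullet> A c / r c)"
      unfolding X_def A_def r_def using \<epsilon> by (intro mult_left_mono cc(2)) auto
    also have "\<dots> = X c \<bullet> U c" by (simp add: Up[OF c False])
    finally show ?thesis using cc(1) by simp
  qed
  define L where "L = (\<Sum>c\<in>C. X c \<bullet> U c)"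
  have KL: "K < L"
  proof -
    let ?s = "\<lambda>x. \<Sum>c\<in>C. \<phi> c x"
    have int: "integrable \<gamma> (\<lambda>z. ?s (fst z) * (fst z \<bullet> snd z))"
      unfolding sum_distrib_right using cell by (intro Bochner_Integration.integrable_sum) auto
    have "K' \<le> (\<integral>z. ?s (fst z) * (fst z \<bullet> snd z) \<partial>\<gamma>)"
      by (rule trunc[OF R(1) _ _ s1 sR int]) (auto intro: sum_nonneg \<phi>0)
    also have "\<dots> = (\<Sum>c\<in>C. \<integral>z. \<phi> c (fst z) * (fst z \<bullet> snd z) \<partial>\<gamma>)"
      unfolding sum_distrib_right using cell by (intro Bochner_Integration.integral_sum) auto
    finally have 1: "K' \<le> (\<Sum>c\<in>C. \<integral>z. \<phi> c (fst z) * (fst z \<bullet> snd z) \<partial>\<gamma>)" .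
    have "(\<Sum>c\<in>C. \<integral>z. \<phi> c (fst z) * norm (snd z) \<partial>\<gamma>) = (\<integral>z. ?s (fst z) * norm (snd z) \<partial>\<gamma>)"
      unfolding sum_distrib_right using i\<phi>n by (intro Bochner_Integration.integral_sum[symmetric])
    also have "\<dots> \<le> (\<integral>z. norm (snd z) \<partial>\<gamma>)"
    proof (rule integral_mono)
      show "integrable \<gamma> (\<lambda>z. ?s (fst z) * norm (snd z))"
        unfolding sum_distrib_right using i\<phi>n by (intro Bochner_Integration.integrable_sum)
      show "?s (fst z) * norm (snd z) \<le> norm (snd z)" for z
        using s1 \<phi>0 by (intro mult_left_le_one_le sum_nonneg) auto
    qed (rule G)
    also have "\<dots> = m\<mu>" by (simp add: G m\<mu>_def)
    finally have "2 * \<delta> * (\<Sum>c\<in>C. \<integral>z. \<phi> c (fst z) * norm (snd z) \<partial>\<gamma>) \<le> 2 * \<delta> * m\<mu>"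
      using \<delta> by (intro mult_left_mono) auto
    then have "K' - \<epsilon> \<le> (\<Sum>c\<in>C. \<integral>z. \<phi> c (fst z) * (fst z \<bullet> snd z) \<partial>\<gamma>) -
        2 * \<delta> * (\<Sum>c\<in>C. \<integral>z. \<phi> c (fst z) * norm (snd z) \<partial>\<gamma>)"
      using 1 \<delta> by linarith
    then have "(1 - \<epsilon>) * (K' - \<epsilon>) \<le> (1 - \<epsilon>) * ((\<Sum>c\<in>C. \<integral>z. \<phi> c (fst z) * (fst z \<bullet> snd z) \<partial>\<gamma>) -
        2 * \<delta> * (\<Sum>c\<in>C. \<integral>z. \<phi> c (fst z) * norm (snd z) \<partial>\<gamma>))"
      using \<epsilon> by (intro mult_left_mono) auto
    also have "\<dots> = (\<Sum>c\<in>C. (1 - \<epsilon>) * ((\<integral>z. \<phi> c (fst z) * (fst z \<bullet> snd z) \<partial>\<gamma>) - 2 * \<delta> * (\<integral>z. \<phi> c (fst z) * norm (snd z) \<partial>\<gamma>)))"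
      by (simp add: sum_distrib_left sum_subtractf right_diff_distrib)
    also have "\<dots> \<le> L" unfolding L_def using cell by (intro sum_mono) auto
    finally show ?thesis using \<epsilon>K by linarith
  qed
  define rk where "rk k c = (\<integral>x. \<phi> c x \<partial>\<rho> k)" for k c
  have rk: "(\<lambda>k. rk k c) \<longlonglongrightarrow> r c" for c
    unfolding rk_def r_def using w \<phi>c \<phi>abs[of c]
    by (auto simp: weakly_converges_def bounded_iff intro!: exI[of _ 1])
  \<comment> \<open>The threshold \<epsilon>^2 is exactly what remains in the nonnegativity check: 1
    - (1 - \<epsilon>) - (1 - \<epsilon>) \<epsilon>.\<close>
  have "(\<lambda>k. \<Sum>c\<in>C. \<bar>rk k c - r c\<bar> * B c) \<longlonglongrightarrow> (\<Sum>c\<in>C. \<bar>r c - r c\<bar> * B c)"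
    by (intro tendsto_intros rk)
  then have ev1: "\<forall>\<^sub>F k in sequentially. (\<Sum>c\<in>C. \<bar>rk k c - r c\<bar> * B c) < \<epsilon> * \<epsilon>"
    by (rule order_tendstoD) (use \<epsilon> in simp)
  have P': "prob_space (\<rho> k)" "sets (\<rho> k) = sets borel" "integrable (\<rho> k) (\<lambda>x. x)" for k
    using P1_D[OF \<rho>k] by auto
  have i\<phi>xk: "integrable (\<rho> k) (\<lambda>x. \<phi> c x *\<^sub>R x)" for k c
    by (rule integrable_bounded_scaleR[OF P'(3) _ \<phi>abs]) (simp add: measurable_cong_sets[OF P'(2) refl])
  \<comment> \<open>Although x is unbounded, \<phi>_c x is a bounded continuous field because
    \<phi>_c has bounded support.\<close>
  have "(\<lambda>k. (\<integral>x. \<phi> c x *\<^sub>R x \<partial>\<rho> k) \<bullet> U c) \<longlonglongrightarrow> X c \<bullet> U c" for c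
  proof -
    have "bounded (range (\<lambda>x. \<phi> c x * (x \<bullet> U c)))"
    proof (rule boundedI)
      fix t assume "t \<in> range (\<lambda>x. \<phi> c x * (x \<bullet> U c))"
      then obtain x where t: "t = \<phi> c x * (x \<bullet> U c)" by blast
      show "norm t \<le> (\<delta> + norm c) * norm (U c)"
      proof (cases "\<phi> c x = 0")
        case False
        have "norm x \<le> norm (x - c) + norm c" by norm
        then have "norm x \<le> \<delta> + norm c" using supp[OF False] by (simp add: dist_norm)
        have "norm t = \<bar>\<phi> c x\<bar> * \<bar>x \<bullet> U c\<bar>" by (simp add: t abs_mult)
        also have "\<dots> \<le> 1 * (norm x * norm (U c))"
          using \<phi>abs Cauchy_Schwarz_ineq2 by (intro mult_mono) auto
        also have "\<dots> \<le> (\<delta> + norm c) * norm (U c)"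
          using \<open>norm x \<le> \<delta> + norm c\<close> by (simp add: mult_right_mono)
        finally show ?thesis .
      qed (use \<delta> in \<open>simp add: t add_nonneg_nonneg\<close>)
    qed
    moreover have "continuous_on UNIV (\<lambda>x. \<phi> c x * (x \<bullet> U c))" by (intro continuous_intros \<phi>c)
    ultimately have "(\<lambda>k. \<integral>x. \<phi> c x * (x \<bullet> U c) \<partial>\<rho> k) \<longlonglongrightarrow> (\<integral>x. \<phi> c x * (x \<bullet> U c) \<partial>\<rho>')"
      using w by (simp add: weakly_converges_def)
    moreover have "(\<integral>x. \<phi> c x * (x \<bullet> U c) \<partial>\<rho> k) = (\<integral>x. \<phi> c x *\<^sub>R x \<partial>\<rho> k) \<bullet> U c" for k
      using integral_inner_left[of "U c", OF i\<phi>xk[of k c]] by (simp only: inner_scaleR_left)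
    moreover have "(\<integral>x. \<phi> c x * (x \<bullet> U c) \<partial>\<rho>') = X c \<bullet> U c"
      using integral_inner_left[of "U c", OF integrable_bounded_scaleR[OF P(4) _ \<phi>abs[of c]]]
      by (simp add: X_def)
    ultimately show ?thesis by simp
  qed
  then have "(\<lambda>k. \<Sum>c\<in>C. (\<integral>x. \<phi> c x *\<^sub>R x \<partial>\<rho> k) \<bullet> U c) \<longlonglongrightarrow> L"
    unfolding L_def by (intro tendsto_sum)
  then have "\<forall>\<^sub>F k in sequentially. K < (\<Sum>c\<in>C. (\<integral>x. \<phi> c x *\<^sub>R x \<partial>\<rho> k) \<bullet> U c)"
    using KL by (rule order_tendstoD)
  with ev1 show ?thesis
  proof eventually_elim
    case (elim k)
    interpret \<rho>k: prob_space "\<rho> k" by (rule P')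
    note [measurable_cong] = P'(2)
    have i\<phi>k: "integrable (\<rho> k) (\<phi> c)" for c using \<phi>abs by (intro \<rho>k.integrable_const_bound[of _ 1]) auto
    have rk01: "0 \<le> rk k c" "rk k c \<le> 1" for c
    proof -
      show "0 \<le> rk k c" unfolding rk_def using \<phi>0 by (intro integral_nonneg_AE) auto
      have "rk k c \<le> (\<integral>x. 1 \<partial>\<rho> k)" unfolding rk_def using i\<phi>k \<phi>1 by (intro integral_mono) auto
      then show "rk k c \<le> 1" by (simp add: \<rho>k.prob_space)
    qed
    have "ereal (\<Sum>c\<in>C. (\<integral>x. (\<phi> c x - rk k c) *\<^sub>R x \<partial>\<rho> k) \<bullet> (\<integral>y. b c y *\<^sub>R y \<partial>\<mu>)) \<le> T_functional (\<rho> k) \<mu>"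
    proof (rule bilinear_coupling[OF \<rho>k \<mu> cen C, where A="\<lambda>_. 1" and B=B])
      show "\<bar>\<phi> c x - rk k c\<bar> \<le> 1" for c x using \<phi>0[of c x] \<phi>1[of c x] rk01[of c] by (auto simp: abs_le_iff)
      show "(\<integral>x. \<phi> c x - rk k c \<partial>\<rho> k) = 0" for c using i\<phi>k by (simp add: rk_def \<rho>k.prob_space)
      fix x y
      \<comment> \<open>Three parts: \<phi>_c contributes at least -(1 - \<epsilon>), as the
        \<phi>_c sum to at most 1; r_c costs at most (1 - \<epsilon>) \<epsilon>, as the \<beta>_c
        sum to at most 1 and the r_c to more than 1 - \<epsilon>; the deviation of rk from r_c costs
        less than \<epsilon>^2.\<close>
      have "(\<Sum>c\<in>C. \<phi> c x * b c y) \<ge> (\<Sum>c\<in>C. \<phi> c x * (- (1 - \<epsilon>)))"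
        using b_low \<phi>0 by (intro sum_mono mult_left_mono) auto
      moreover have "(\<Sum>c\<in>C. \<phi> c x * (- (1 - \<epsilon>))) \<ge> - (1 - \<epsilon>)"
        using mult_right_mono[OF s1[of x], of "1 - \<epsilon>"] \<epsilon> by (simp add: sum_negf flip: sum_distrib_right)
      moreover have "(\<Sum>c\<in>C. r c * b c y) \<le> (1 - \<epsilon>) * \<epsilon>"
      proof -
        have "(\<Sum>c\<in>C. r c * b c y) \<le> (\<Sum>c\<in>C. (1 - \<epsilon>) * (\<beta> c y - r c))" using rb by (intro sum_mono)
        also have "\<dots> = (1 - \<epsilon>) * ((\<Sum>c\<in>C. \<beta> c y) - (\<Sum>c\<in>C. r c))"
          by (simp add: sum_distrib_left sum_subtractf right_diff_distrib)
        also have "\<dots> \<le> (1 - \<epsilon>) * \<epsilon>" using \<epsilon> rsum \<beta>1[of y] by (intro mult_left_mono) auto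
        finally show ?thesis .
      qed
      moreover have "(\<Sum>c\<in>C. (rk k c - r c) * b c y) \<le> (\<Sum>c\<in>C. \<bar>rk k c - r c\<bar> * B c)"
      proof (rule sum_mono)
        fix c
        have "(rk k c - r c) * b c y \<le> \<bar>rk k c - r c\<bar> * \<bar>b c y\<bar>" by (metis abs_ge_self abs_mult)
        also have "\<dots> \<le> \<bar>rk k c - r c\<bar> * B c" using bB by (intro mult_left_mono) auto
        finally show "(rk k c - r c) * b c y \<le> \<bar>rk k c - r c\<bar> * B c" .
      qed
      moreover have "(\<Sum>c\<in>C. (\<phi> c x - rk k c) * b c y) = (\<Sum>c\<in>C. \<phi> c x * b c y) - (\<Sum>c\<in>C. r c * b c y)
          - (\<Sum>c\<in>C. (rk k c - r c) * b c y)"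
        by (simp add: sum_subtractf left_diff_distrib)
      moreover have "(1 - \<epsilon>) * \<epsilon> = \<epsilon> - \<epsilon> * \<epsilon>" by (simp add: left_diff_distrib)
      ultimately show "0 \<le> 1 + (\<Sum>c\<in>C. (\<phi> c x - rk k c) * b c y)" using elim(1) by linarith
    qed (use bB b0 in auto)
    \<comment> \<open>Recentring leaves the cell moment unchanged because \<rho> k is
      centred.\<close>
    moreover have "(\<integral>x. (\<phi> c x - rk k c) *\<^sub>R x \<partial>\<rho> k) = (\<integral>x. \<phi> c x *\<^sub>R x \<partial>\<rho> k)" for c
    proof -
      have "(\<integral>x. (\<phi> c x - rk k c) *\<^sub>R x \<partial>\<rho> k) = (\<integral>x. \<phi> c x *\<^sub>R x - rk k c *\<^sub>R x \<partial>\<rho> k)"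
        by (simp add: scaleR_diff_left)
      also have "\<dots> = (\<integral>x. \<phi> c x *\<^sub>R x \<partial>\<rho> k) - (\<integral>x. rk k c *\<^sub>R x \<partial>\<rho> k)"
        by (intro Bochner_Integration.integral_diff integrable_scaleR_right i\<phi>xk P'(3))
      also have "(\<integral>x. rk k c *\<^sub>R x \<partial>\<rho> k) = 0" by (simp only: integral_scaleR_right cenk scaleR_zero_right)
      finally show ?thesis by simp
    qed
    ultimately have le: "ereal (\<Sum>c\<in>C. (\<integral>x. \<phi> c x *\<^sub>R x \<partial>\<rho> k) \<bullet> U c) \<le> T_functional (\<rho> k) \<mu>"
      by (simp add: U_def)
    have "ereal K < ereal (\<Sum>c\<in>C. (\<integral>x. \<phi> c x *\<^sub>R x \<partial>\<rho> k) \<bullet> U c)" using elim(2) by simp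
    then show ?case using le by (rule less_le_trans)
  qed
qed

section \<open>Translations and existence of a minimizer\<close>

lemma nn_integral_add_integrable_finite:
  fixes f g :: "'a \<Rightarrow> real"
  assumes [measurable]: "f \<in> borel_measurable M" and g: "integrable M g"
  shows "(\<integral>\<^sup>+x. ennreal (f x + g x) \<partial>M) < \<infinity> \<longleftrightarrow> (\<integral>\<^sup>+x. ennreal (f x) \<partial>M) < \<infinity>"
proof -
  have *: "(\<integral>\<^sup>+x. ennreal (u x + v x) \<partial>M) < \<infinity>"
    if [measurable]: "u \<in> borel_measurable M" and v: "integrable M v" and u: "(\<integral>\<^sup>+x. ennreal (u x) \<partial>M) < \<infinity>"
    for u v :: "'a \<Rightarrow> real"
  proof -
    have [measurable]: "v \<in> borel_measurable M" using v by simp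
    have le: "ennreal (a + b) \<le> ennreal a + ennreal b" for a b
      by (cases "0 \<le> a"; cases "0 \<le> b") (auto simp: ennreal_neg ennreal_leI simp flip: ennreal_plus)
    have "(\<integral>\<^sup>+x. ennreal (u x + v x) \<partial>M) \<le> (\<integral>\<^sup>+x. ennreal (u x) + ennreal (v x) \<partial>M)"
      by (intro nn_integral_mono le)
    also have "\<dots> = (\<integral>\<^sup>+x. ennreal (u x) \<partial>M) + (\<integral>\<^sup>+x. ennreal (v x) \<partial>M)" by (rule nn_integral_add) auto
    also have "\<dots> < \<infinity>" using u v by (auto simp: real_integrable_def less_top)
    finally show ?thesis .
  qed
  have [measurable]: "g \<in> borel_measurable M" using g by simp
  show ?thesis
  proof
    assume "(\<integral>\<^sup>+x. ennreal (f x + g x) \<partial>M) < \<infinity>"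
    then show "(\<integral>\<^sup>+x. ennreal (f x) \<partial>M) < \<infinity>"
      using *[of "\<lambda>x. f x + g x" "\<lambda>x. - g x"] g by simp
  next
    assume "(\<integral>\<^sup>+x. ennreal (f x) \<partial>M) < \<infinity>"
    then show "(\<integral>\<^sup>+x. ennreal (f x + g x) \<partial>M) < \<infinity>" by (intro * assms)
  qed
qed

text \<open>An integrable perturbation affects the finiteness of neither part, so infinite values
  are kept, and in the finite case the zero mean keeps the value. Correlations are thus compared
  under translation even when they are infinite.\<close>

lemma ext_integral_add_null:
  fixes f g :: "'a \<Rightarrow> real"
  assumes f: "integral_meaningful M f" and g: "integrable M g" and g0: "(\<integral>x. g x \<partial>M) = 0"
  shows "integral_meaningful M (\<lambda>x. f x + g x)" "ext_integral M (\<lambda>x. f x + g x) = ext_integral M f"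
proof -
  have fm[measurable]: "f \<in> borel_measurable M" using f by (simp add: integral_meaningful_def)
  have [measurable]: "g \<in> borel_measurable M" using g by simp
  have pos: "(\<integral>\<^sup>+x. ennreal (f x + g x) \<partial>M) < \<infinity> \<longleftrightarrow> (\<integral>\<^sup>+x. ennreal (f x) \<partial>M) < \<infinity>"
    by (rule nn_integral_add_integrable_finite[OF fm g])
  have neg: "(\<integral>\<^sup>+x. ennreal (- (f x + g x)) \<partial>M) < \<infinity> \<longleftrightarrow> (\<integral>\<^sup>+x. ennreal (- f x) \<partial>M) < \<infinity>"
    using nn_integral_add_integrable_finite[of "\<lambda>x. - f x" M "\<lambda>x. - g x"] g by (simp add: add.commute)
  show "integral_meaningful M (\<lambda>x. f x + g x)"
    using f unfolding integral_meaningful_def pos neg by auto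
  have inf: "P = \<top> \<Longrightarrow> Q < \<top> \<Longrightarrow> enn2ereal P - enn2ereal Q = \<infinity>" for P Q
    by (cases Q) (auto simp: enn2ereal_ennreal top_ennreal.rep_eq top_ereal_def)
  have minf: "P < \<top> \<Longrightarrow> Q = \<top> \<Longrightarrow> enn2ereal P - enn2ereal Q = - \<infinity>" for P Q
    by (cases P) (auto simp: enn2ereal_ennreal top_ennreal.rep_eq top_ereal_def)
  consider "(\<integral>\<^sup>+x. ennreal (f x) \<partial>M) < \<top>" "(\<integral>\<^sup>+x. ennreal (- f x) \<partial>M) < \<top>"
    | "(\<integral>\<^sup>+x. ennreal (f x) \<partial>M) = \<top>" "(\<integral>\<^sup>+x. ennreal (- f x) \<partial>M) < \<top>"
    | "(\<integral>\<^sup>+x. ennreal (f x) \<partial>M) < \<top>" "(\<integral>\<^sup>+x. ennreal (- f x) \<partial>M) = \<top>"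
    using f unfolding integral_meaningful_def infinity_ennreal_def
    by (metis top.not_eq_extremum)
  then show "ext_integral M (\<lambda>x. f x + g x) = ext_integral M f"
  proof cases
    case 1
    then have "integrable M f" by (auto simp: real_integrable_def)
    then show ?thesis using g g0 by (simp add: ext_integral_integrable)
  next
    case 2
    then have "(\<integral>\<^sup>+x. ennreal (f x + g x) \<partial>M) = \<top>" "(\<integral>\<^sup>+x. ennreal (- (f x + g x)) \<partial>M) < \<top>"
      using pos neg by (simp_all add: not_less top_unique)
    then show ?thesis unfolding ext_integral_def using 2 by (simp only: inf)
  next
    case 3
    then have "(\<integral>\<^sup>+x. ennreal (f x + g x) \<partial>M) < \<top>" "(\<integral>\<^sup>+x. ennreal (- (f x + g x)) \<partial>M) = \<top>"
      using pos neg by (simp_all add: not_less top_unique)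
    then show ?thesis unfolding ext_integral_def using 3 by (simp only: minf)
  qed
qed

lemma distr_translate_cancel:
  fixes M :: "'a::euclidean_space measure"
  assumes "sets M = sets borel"
  shows "distr (distr M borel (\<lambda>x. x + v)) borel (\<lambda>x. x - v) = M"
proof -
  note [measurable_cong] = assms
  have "distr (distr M borel (\<lambda>x. x + v)) borel (\<lambda>x. x - v) = distr M borel (\<lambda>x. x)"
    by (subst distr_distr) (auto simp: o_def)
  also have "\<dots> = M" by (rule distr_id2) (simp add: assms)
  finally show ?thesis .
qed

text \<open>Translating the first coordinate of a coupling changes x \<bullet> y by v \<bullet> y,
  which has mean zero as \<mu> is centred. One inequality is enough, since centring only must not
  raise the functional.\<close>

lemma T_functional_translate_le:
  fixes \<rho> \<mu> :: "(real ^ 'n::finite) measure"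
  assumes \<rho>: "\<rho> \<in> P1" and \<mu>: "\<mu> \<in> P1" and cen: "(\<integral>y. y \<partial>\<mu>) = 0"
  shows "T_functional (distr \<rho> borel (\<lambda>x. x + v)) \<mu> \<le> T_functional \<rho> \<mu>"
  unfolding T_functional_def
proof (rule Sup_least)
  fix t assume "t \<in> {ext_integral \<gamma> (\<lambda>(x, y). x \<bullet> y) | \<gamma>.
     \<gamma> \<in> couplings (distr \<rho> borel (\<lambda>x. x + v)) \<mu> \<and> integral_meaningful \<gamma> (\<lambda>(x, y). x \<bullet> y)}"
  then obtain \<gamma> where t: "t = ext_integral \<gamma> (\<lambda>(x, y). x \<bullet> y)"
    and \<gamma>: "\<gamma> \<in> couplings (distr \<rho> borel (\<lambda>x. x + v)) \<mu>" and mean: "integral_meaningful \<gamma> (\<lambda>(x, y). x \<bullet> y)" by blast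
  have \<gamma>1: "prob_space \<gamma>" "sets \<gamma> = sets borel" "distr \<gamma> borel fst = distr \<rho> borel (\<lambda>x. x + v)" "distr \<gamma> borel snd = \<mu>"
    using \<gamma> by (auto simp: couplings_def)
  have bp: "sets \<gamma> = sets (borel \<Otimes>\<^sub>M borel)" unfolding borel_prod by (rule \<gamma>1)
  note P = P1_D[OF \<rho>] and Q = P1_D[OF \<mu>]
  note [measurable_cong] = bp P(2)
  interpret prob_space \<gamma> by (rule \<gamma>1)
  define S where "S z = (fst z - v, snd z)" for z :: "(real ^ 'n) \<times> (real ^ 'n)"
  have Sm: "S \<in> \<gamma> \<rightarrow>\<^sub>M borel" unfolding S_def borel_prod[symmetric] by measurable
  define \<gamma>' where "\<gamma>' = distr \<gamma> borel S"
  have f1: "fst \<in> (borel :: ((real ^ 'n) \<times> (real ^ 'n)) measure) \<rightarrow>\<^sub>M borel"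
    "snd \<in> (borel :: ((real ^ 'n) \<times> (real ^ 'n)) measure) \<rightarrow>\<^sub>M borel"
    "(\<lambda>z. fst z \<bullet> snd z) \<in> borel_measurable (borel :: ((real ^ 'n) \<times> (real ^ 'n)) measure)"
    unfolding borel_prod[symmetric] by measurable
  have "distr \<gamma>' borel fst = distr (distr \<gamma> borel fst) borel (\<lambda>x. x - v)"
    unfolding \<gamma>'_def by (subst distr_distr[OF f1(1) Sm], subst distr_distr) (auto simp: S_def o_def)
  also have "\<dots> = \<rho>" unfolding \<gamma>1(3) by (rule distr_translate_cancel[OF P(2)])
  finally have fst: "distr \<gamma>' borel fst = \<rho>" .
  have "distr \<gamma>' borel snd = distr \<gamma> borel snd"
    unfolding \<gamma>'_def by (subst distr_distr[OF f1(2) Sm]) (auto simp: S_def o_def)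
  then have \<gamma>': "\<gamma>' \<in> couplings \<rho> \<mu>"
    using fst \<gamma>1(4) prob_space_distr[OF Sm] by (simp add: couplings_def \<gamma>'_def)
  have "integrable \<mu> (\<lambda>y. v \<bullet> y)" using integrable_inner_right[of v, OF Q(4)] by simp
  then have iv: "integrable \<gamma> (\<lambda>z. v \<bullet> snd z)"
    unfolding \<gamma>1(4)[symmetric] by (subst (asm) integrable_distr_eq) auto
  have "(\<integral>z. v \<bullet> snd z \<partial>\<gamma>) = (\<integral>y. v \<bullet> y \<partial>\<mu>)"
    unfolding \<gamma>1(4)[symmetric] by (rule integral_distr[symmetric]) auto
  also have "\<dots> = 0" using integral_inner_right[of v, OF Q(4)] cen by simp
  finally have iv0: "(\<integral>z. - (v \<bullet> snd z) \<partial>\<gamma>) = 0" by simp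
  note add = ext_integral_add_null[OF mean Bochner_Integration.integrable_minus[OF iv] iv0]
  have SS: "(case S z of (x, y) \<Rightarrow> x \<bullet> y) = (case z of (x, y) \<Rightarrow> x \<bullet> y) + - (v \<bullet> snd z)" for z
    by (simp add: S_def case_prod_beta' inner_diff_left)
  have nn: "(\<integral>\<^sup>+z. ennreal (h z) \<partial>\<gamma>') = (\<integral>\<^sup>+z. ennreal (h (S z)) \<partial>\<gamma>)"
    if "h \<in> borel_measurable borel" for h
    unfolding \<gamma>'_def by (rule nn_integral_distr[OF Sm]) (use that in measurable)
  have cm: "(\<lambda>(x, y). x \<bullet> y) \<in> borel_measurable (borel :: ((real ^ 'n) \<times> (real ^ 'n)) measure)"
    using f1(3) by (simp add: case_prod_beta')
  have n1: "(\<integral>\<^sup>+z. ennreal ((\<lambda>(x, y). x \<bullet> y) z) \<partial>\<gamma>') = (\<integral>\<^sup>+z. ennreal ((\<lambda>(x, y). x \<bullet> y) z + - (v \<bullet> snd z)) \<partial>\<gamma>)"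
    by (subst nn[OF cm]) (simp only: SS)
  have n2: "(\<integral>\<^sup>+z. ennreal (- (\<lambda>(x, y). x \<bullet> y) z) \<partial>\<gamma>') = (\<integral>\<^sup>+z. ennreal (- ((\<lambda>(x, y). x \<bullet> y) z + - (v \<bullet> snd z))) \<partial>\<gamma>)"
    by (subst nn[OF borel_measurable_uminus[OF cm]]) (simp only: SS)
  have "integral_meaningful \<gamma>' (\<lambda>(x, y). x \<bullet> y)"
    using add(1) cm unfolding integral_meaningful_def n1 n2 by (simp add: \<gamma>'_def)
  moreover have "ext_integral \<gamma>' (\<lambda>(x, y). x \<bullet> y) = t"
    unfolding t add(2)[symmetric] unfolding ext_integral_def n1 n2 ..
  ultimately show "t \<le> Sup {ext_integral \<gamma> (\<lambda>(x, y). x \<bullet> y) | \<gamma>.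
     \<gamma> \<in> couplings \<rho> \<mu> \<and> integral_meaningful \<gamma> (\<lambda>(x, y). x \<bullet> y)}"
    using \<gamma>' by (intro Sup_upper) blast
qed

lemma P1_translate:
  fixes \<rho> :: "(real ^ 'n::finite) measure"
  assumes \<rho>: "\<rho> \<in> P1"
  shows "distr \<rho> borel (\<lambda>x. x + v) \<in> P1" "(\<integral>x. x \<partial>distr \<rho> borel (\<lambda>x. x + v)) = (\<integral>x. x \<partial>\<rho>) + v"
proof -
  note P = P1_D[OF \<rho>]
  note [measurable_cong] = P(2)
  interpret prob_space \<rho> by (rule P)
  have "integrable \<rho> (\<lambda>x. x + v)" using P by simp
  then have "(\<integral>\<^sup>+x. ennreal (norm (x + v)) \<partial>\<rho>) < \<infinity>" by (simp add: integrable_iff_bounded)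
  then show "distr \<rho> borel (\<lambda>x. x + v) \<in> P1"
    using prob_space_distr[of "\<lambda>x. x + v" borel] by (simp add: P1_def nn_integral_distr)
  show "(\<integral>x. x \<partial>distr \<rho> borel (\<lambda>x. x + v)) = (\<integral>x. x \<partial>\<rho>) + v"
  proof -
    have "(\<integral>x. x \<partial>distr \<rho> borel (\<lambda>x. x + v)) = (\<integral>x. x + v \<partial>\<rho>)" by (rule integral_distr) measurable
    also have "\<dots> = (\<integral>x. x \<partial>\<rho>) + (\<integral>x. v \<partial>\<rho>)"
      by (rule Bochner_Integration.integral_add[OF P(4)]) simp
    also have "(\<integral>x. v \<partial>\<rho>) = v" by (simp add: prob_space)
    finally show ?thesis .
  qed
qed

lemma nn_integral_lborel_translate:
  fixes h :: "'a::euclidean_space \<Rightarrow> ennreal"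
  assumes [measurable]: "h \<in> borel_measurable borel"
  shows "(\<integral>\<^sup>+x. h (x - v) \<partial>lborel) = (\<integral>\<^sup>+x. h x \<partial>lborel)"
proof -
  have "(\<integral>\<^sup>+x. h x \<partial>lborel) = (\<integral>\<^sup>+x. h x \<partial>distr lborel borel ((+) (- v)))"
    unfolding lborel_distr_plus ..
  also have "\<dots> = (\<integral>\<^sup>+x. h (- v + x) \<partial>lborel)" by (rule nn_integral_distr) auto
  finally show ?thesis by simp
qed

text \<open>The translated density and singular part decompose the translated measure; uniqueness
  almost everywhere ties this to the version chosen by \<open>ac_density\<close>, and Lebesgue
  measure is translation invariant.\<close>

lemma power_energy_translate:
  fixes \<rho> :: "(real ^ 'n::finite) measure"
  assumes \<rho>: "prob_space \<rho>" "sets \<rho> = sets borel"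
  shows "power_energy \<alpha> (distr \<rho> borel (\<lambda>x. x + v)) = power_energy \<alpha> \<rho>"
proof -
  note [measurable_cong] = \<rho>(2)
  interpret prob_space \<rho> by fact
  define g where "g = ac_density \<rho>"
  obtain \<sigma> where D: "lebesgue_decomposition \<rho> g \<sigma>"
    unfolding g_def using \<rho> by (rule ac_density_decomposition)
  note D' = D[unfolded lebesgue_decomposition_def]
  have [measurable]: "g \<in> borel_measurable borel" and g0: "\<And>x. 0 \<le> g x" and s\<sigma>[measurable_cong]: "sets \<sigma> = sets borel"
    and dec: "\<And>A. A \<in> sets borel \<Longrightarrow> emeasure \<rho> A = (\<integral>\<^sup>+x\<in>A. ennreal (g x) \<partial>lborel) + emeasure \<sigma> A"
    using D' by simp_all
  obtain N where [measurable]: "N \<in> sets borel" and N: "emeasure lborel N = 0" "emeasure \<sigma> (- N) = 0" using D' by blast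
  have sp: "space \<rho> = UNIV" "space \<sigma> = UNIV"
    using sets_eq_imp_space_eq[OF \<rho>(2)] sets_eq_imp_space_eq[OF s\<sigma>] by simp_all
  let ?\<rho> = "distr \<rho> borel (\<lambda>x. x + v)" and ?\<sigma> = "distr \<sigma> borel (\<lambda>x. x + v)"
  have pre: "(\<lambda>x. x + v) -` A \<in> sets borel" if "A \<in> sets borel" for A
    using measurable_sets[of "\<lambda>x. x + v" borel borel A] that by simp
  have "lebesgue_decomposition ?\<rho> (\<lambda>x. g (x - v)) ?\<sigma>"
    unfolding lebesgue_decomposition_def
  proof (intro conjI allI ballI bexI[of _ "(\<lambda>x. x - v) -` N"])
    show N': "(\<lambda>x. x - v) -` N \<in> sets borel" using measurable_sets[of "\<lambda>x. x - v" borel borel N] by simp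
    have "emeasure lborel ((\<lambda>x. x - v) -` N) = (\<integral>\<^sup>+x. indicator ((\<lambda>x. x - v) -` N) x \<partial>lborel)"
      by (rule nn_integral_indicator[symmetric]) (use N' in simp)
    also have "\<dots> = (\<integral>\<^sup>+x. indicator N (x - v) \<partial>lborel)"
      by (intro nn_integral_cong) (simp add: indicator_def)
    also have "\<dots> = 0" using N by (subst nn_integral_lborel_translate) auto
    finally show "emeasure lborel ((\<lambda>x. x - v) -` N) = 0" .
    have "(\<lambda>x. x + v) -` (- (\<lambda>x. x - v) -` N) = - N" by auto
    then show "emeasure ?\<sigma> (- (\<lambda>x. x - v) -` N) = 0" using N N' by (subst emeasure_distr) (auto simp: sp)
    fix A :: "(real ^ 'n) set" assume A[measurable]: "A \<in> sets borel"
    have "emeasure ?\<rho> A = emeasure \<rho> ((\<lambda>x. x + v) -` A)" by (subst emeasure_distr) (auto simp: sp)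
    also have "\<dots> = (\<integral>\<^sup>+x\<in>(\<lambda>x. x + v) -` A. ennreal (g x) \<partial>lborel) + emeasure \<sigma> ((\<lambda>x. x + v) -` A)"
      by (rule dec[OF pre[OF A]])
    also have "emeasure \<sigma> ((\<lambda>x. x + v) -` A) = emeasure ?\<sigma> A" by (subst emeasure_distr) (auto simp: sp)
    also have "(\<integral>\<^sup>+x\<in>(\<lambda>x. x + v) -` A. ennreal (g x) \<partial>lborel)
        = (\<integral>\<^sup>+x. ennreal (g (x - v)) * indicator ((\<lambda>x. x + v) -` A) (x - v) \<partial>lborel)"
      using pre[OF A] by (intro nn_integral_lborel_translate[symmetric]) auto
    also have "\<dots> = (\<integral>\<^sup>+x\<in>A. ennreal (g (x - v)) \<partial>lborel)"
      by (intro nn_integral_cong) (auto simp: indicator_def)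
    finally show "emeasure ?\<rho> A = (\<integral>\<^sup>+x\<in>A. ennreal (g (x - v)) \<partial>lborel) + emeasure ?\<sigma> A" .
  qed (use g0 in auto)
  moreover have pr: "prob_space ?\<rho>" by (rule prob_space_distr) simp
  moreover obtain \<sigma>' where "lebesgue_decomposition ?\<rho> (ac_density ?\<rho>) \<sigma>'"
    using ac_density_decomposition[OF pr] by auto
  ultimately have "AE x in lborel. ac_density ?\<rho> x = g (x - v)"
    using lebesgue_decomposition_unique by blast
  then have "power_energy \<alpha> ?\<rho> = (\<integral>\<^sup>+x. ennreal (1 / \<alpha> * g (x - v) powr \<alpha>) \<partial>lborel)"
    unfolding power_energy_def by (intro nn_integral_cong_AE) auto
  also have "\<dots> = power_energy \<alpha> \<rho>"
    unfolding power_energy_def g_def[symmetric]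
    by (rule nn_integral_lborel_translate[of "\<lambda>x. ennreal (1 / \<alpha> * g x powr \<alpha>)"]) measurable
  finally show ?thesis .
qed

text \<open>The norm is not a bounded test function; its truncations are, and monotone convergence
  removes the truncation. The bound passes to the limit even where the moments themselves do not
  converge.\<close>

lemma weakly_converges_moment:
  fixes \<rho> :: "nat \<Rightarrow> (real ^ 'n::finite) measure"
  assumes prob: "\<And>k. prob_space (\<rho> k)" and sets: "\<And>k. sets (\<rho> k) = sets borel"
    and mom: "\<And>k. (\<integral>\<^sup>+x. ennreal (norm x) \<partial>\<rho> k) \<le> ennreal M" and "0 \<le> M"
    and prob': "prob_space \<rho>'" and sets': "sets \<rho>' = sets borel" and w: "weakly_converges \<rho> \<rho>'"
  shows "(\<integral>\<^sup>+x. ennreal (norm x) \<partial>\<rho>') \<le> ennreal M"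
proof -
  note sets[measurable_cong] sets'[measurable_cong]
  interpret \<rho>': prob_space \<rho>' by (rule prob')
  define f where "f m x = min (norm x) (real m)" for m :: nat and x :: "real ^ 'n"
  have [measurable]: "f m \<in> borel_measurable borel" for m unfolding f_def by measurable
  have f: "\<bar>f m x\<bar> \<le> real m" "0 \<le> f m x" "f m x \<le> norm x" for m x by (auto simp: f_def)
  have le: "(\<integral>\<^sup>+x. ennreal (f m x) \<partial>\<rho>') \<le> ennreal M" for m
  proof -
    have "continuous_on UNIV (f m)" unfolding f_def by (intro continuous_intros)
    then have "(\<lambda>k. \<integral>x. f m x \<partial>\<rho> k) \<longlonglongrightarrow> (\<integral>x. f m x \<partial>\<rho>')"
      using w f(1)[of m] by (auto simp: weakly_converges_def bounded_iff intro!: exI[of _ "real m"])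
    moreover have "(\<integral>x. f m x \<partial>\<rho> k) \<le> M" for k
    proof -
      interpret prob_space "\<rho> k" by (rule prob)
      have "ennreal (\<integral>x. f m x \<partial>\<rho> k) = (\<integral>\<^sup>+x. ennreal (f m x) \<partial>\<rho> k)"
        using f by (intro nn_integral_eq_integral[symmetric] integrable_const_bound[of _ "real m"]) auto
      also have "\<dots> \<le> (\<integral>\<^sup>+x. ennreal (norm x) \<partial>\<rho> k)" using f by (intro nn_integral_mono ennreal_leI) auto
      also note mom[of k]
      finally show ?thesis using \<open>0 \<le> M\<close> by (simp add: ennreal_le_iff)
    qed
    ultimately have "(\<integral>x. f m x \<partial>\<rho>') \<le> M" by (intro LIMSEQ_le_const2) auto
    moreover have "(\<integral>\<^sup>+x. ennreal (f m x) \<partial>\<rho>') = ennreal (\<integral>x. f m x \<partial>\<rho>')"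
      using f by (intro nn_integral_eq_integral \<rho>'.integrable_const_bound[of _ "real m"]) auto
    ultimately show ?thesis by (simp add: ennreal_leI)
  qed
  have "(\<integral>\<^sup>+x. (SUP m. ennreal (f m x)) \<partial>\<rho>') = (SUP m. \<integral>\<^sup>+x. ennreal (f m x) \<partial>\<rho>')"
    by (rule nn_integral_monotone_convergence_SUP)
       (auto simp: incseq_def le_fun_def f_def intro!: ennreal_leI)
  also have "\<dots> \<le> ennreal M" by (rule SUP_least) (rule le)
  also have "(\<lambda>x. SUP m. ennreal (f m x)) = (\<lambda>x. ennreal (norm x))"
  proof
    fix x :: "real ^ 'n"
    obtain m :: nat where "norm x \<le> m" using real_arch_simple by blast
    then have "ennreal (norm x) = ennreal (f m x)" by (simp add: f_def)
    also have "\<dots> \<le> (SUP m. ennreal (f m x))" by (rule SUP_upper) simp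
    finally show "(SUP m. ennreal (f m x)) = ennreal (norm x)"
      by (intro antisym SUP_least ennreal_leI f(3))
  qed
  finally show ?thesis .
qed

theorem theorem3p1:
  fixes q :: real and \<mu> :: "(real ^ 'n::finite) measure"
  assumes "q > 1"
    and "\<mu> \<in> P1"
    and "(\<integral>y. y \<partial>\<mu>) = 0"
    and "\<And>H. affine_hyperplane H \<Longrightarrow> measure \<mu> H < 1"
  shows "\<exists>\<rho>'\<in>P1. \<forall>\<rho>\<in>P1. J_functional q \<mu> \<rho>' \<le> J_functional q \<mu> \<rho>"
proof -
  note \<mu> = assms(2) and cen = assms(3)
  define \<alpha> where "\<alpha> = alpha_exp TYPE('n) q"
  have n: "1 \<le> real CARD('n)" using zero_less_card_finite[where 'a='n] by linarith
  have \<alpha>: "0 < \<alpha>" "\<alpha> < 1" "real CARD('n) < \<alpha> / (1 - \<alpha>)"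
  proof -
    show "0 < \<alpha>" "\<alpha> < 1" using n \<open>q > 1\<close> by (auto simp: \<alpha>_def alpha_exp_def field_simps)
    have "\<alpha> / (1 - \<alpha>) = real CARD('n) + q - 1"
      using n \<open>q > 1\<close> by (simp add: \<alpha>_def alpha_exp_def field_simps)
    then show "real CARD('n) < \<alpha> / (1 - \<alpha>)" using \<open>q > 1\<close> by simp
  qed
  obtain c where c: "0 < c" and T_ge: "\<And>\<rho>. \<rho> \<in> P1 \<Longrightarrow> (\<integral>x. x \<partial>\<rho>) = 0 \<Longrightarrow> ereal (c * (\<integral>x. norm x \<partial>\<rho>)) \<le> T_functional \<rho> \<mu>"
    using T_functional_ge_moment[OF \<mu> cen assms(4)] by blast
  \<comment> \<open>With s = c / 2 the energy absorbs only half of the coefficient c gained from the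
    transport term, and c / 2 remains for coercivity.\<close>
  obtain C where C: "0 \<le> C" and G_le: "\<And>\<rho> :: (real ^ 'n) measure. \<rho> \<in> P1 \<Longrightarrow>
      power_energy \<alpha> \<rho> \<le> ennreal (c / 2) * (\<integral>\<^sup>+x. ennreal (norm x) \<partial>\<rho>) + ennreal C"
    by (rule power_energy_coercive[OF \<alpha>, of "c / 2"]) (use c in auto)
  define E where "E \<rho> = enn2real (power_energy \<alpha> \<rho>)" for \<rho> :: "(real ^ 'n) measure"
  have mom: "(\<integral>\<^sup>+x. ennreal (norm x) \<partial>\<rho>) = ennreal (\<integral>x. norm x \<partial>\<rho>)" if "\<rho> \<in> P1" for \<rho> :: "(real ^ 'n) measure"
    using P1_D(5)[OF that] by (intro nn_integral_eq_integral) auto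
  have E: "power_energy \<alpha> \<rho> = ennreal (E \<rho>)" "E \<rho> \<le> c / 2 * (\<integral>x. norm x \<partial>\<rho>) + C" if \<rho>: "\<rho> \<in> P1" for \<rho>
  proof -
    have nn: "0 \<le> (\<integral>x. norm x \<partial>\<rho>)" by (rule integral_nonneg_AE) simp
    have *: "power_energy \<alpha> \<rho> \<le> ennreal (c / 2 * (\<integral>x. norm x \<partial>\<rho>) + C)"
    proof -
      have "ennreal (c / 2 * (\<integral>x. norm x \<partial>\<rho>) + C) = ennreal (c / 2) * ennreal (\<integral>x. norm x \<partial>\<rho>) + ennreal C"
        using c C nn by (simp only: ennreal_plus ennreal_mult mult_nonneg_nonneg less_imp_le half_gt_zero)
      then show ?thesis using G_le[OF \<rho>] by (simp only: mom[OF \<rho>])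
    qed
    then have "power_energy \<alpha> \<rho> < \<top>" by (rule le_less_trans) simp
    then show 1: "power_energy \<alpha> \<rho> = ennreal (E \<rho>)" by (simp add: E_def)
    show "E \<rho> \<le> c / 2 * (\<integral>x. norm x \<partial>\<rho>) + C"
      using * c C nn unfolding 1 by (subst (asm) ennreal_le_iff) auto
  qed
  have E0: "0 \<le> E \<rho>" for \<rho> by (simp add: E_def)
  have J: "J_functional q \<mu> \<rho> = ereal (- E \<rho>) + T_functional \<rho> \<mu>" if "\<rho> \<in> P1" for \<rho>
    using F_functional_eq[of q \<rho>] \<alpha>(1) E(1)[OF that] E0[of \<rho>]
    by (simp add: J_functional_def \<alpha>_def enn2ereal_ennreal)
  have center: "\<exists>\<rho>'\<in>P1. (\<integral>x. x \<partial>\<rho>') = 0 \<and> J_functional q \<mu> \<rho>' \<le> J_functional q \<mu> \<rho>"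
    if \<rho>: "\<rho> \<in> P1" for \<rho>
  proof (intro bexI conjI)
    let ?v = "- (\<integral>x. x \<partial>\<rho>)"
    let ?\<rho> = "distr \<rho> borel (\<lambda>x. x + ?v)"
    show P: "?\<rho> \<in> P1" by (rule P1_translate[OF \<rho>])
    show "(\<integral>x. x \<partial>?\<rho>) = 0" by (subst P1_translate(2)[OF \<rho>]) simp
    have "E ?\<rho> = E \<rho>" unfolding E_def using P1_D[OF \<rho>] by (subst power_energy_translate) auto
    then show "J_functional q \<mu> ?\<rho> \<le> J_functional q \<mu> \<rho>"
      unfolding J[OF \<rho>] J[OF P]
      by (simp only:) (intro add_left_mono T_functional_translate_le[OF \<rho> \<mu> cen])
  qed
  have coercive: "ereal (c / 2 * (\<integral>x. norm x \<partial>\<rho>) - C) \<le> J_functional q \<mu> \<rho>"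
    if \<rho>: "\<rho> \<in> P1" "(\<integral>x. x \<partial>\<rho>) = 0" for \<rho>
  proof -
    have "ereal (c / 2 * (\<integral>x. norm x \<partial>\<rho>) - C) \<le> ereal (- E \<rho>) + ereal (c * (\<integral>x. norm x \<partial>\<rho>))"
      using E(2)[OF \<rho>(1)] by simp
    also have "\<dots> \<le> J_functional q \<mu> \<rho>" unfolding J[OF \<rho>(1)] by (intro add_left_mono T_ge \<rho>)
    finally show ?thesis .
  qed
  define m where "m = (INF \<rho>\<in>P1. J_functional q \<mu> \<rho>)"
  have m_le: "m \<le> J_functional q \<mu> \<rho>" if "\<rho> \<in> P1" for \<rho> unfolding m_def using that by (rule INF_lower)
  have "ereal (- C) \<le> m"
    unfolding m_def
  proof (rule INF_greatest)
    fix \<rho> :: "(real ^ 'n) measure" assume "\<rho> \<in> P1"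
    then obtain \<rho>' where \<rho>': "\<rho>' \<in> P1" "(\<integral>x. x \<partial>\<rho>') = 0" "J_functional q \<mu> \<rho>' \<le> J_functional q \<mu> \<rho>" using center by blast
    have "0 \<le> (\<integral>x. norm x \<partial>\<rho>')" by (rule integral_nonneg_AE) simp
    then have "ereal (- C) \<le> ereal (c / 2 * (\<integral>x. norm x \<partial>\<rho>') - C)" using c by simp
    also note coercive[OF \<rho>'(1,2)]
    also note \<rho>'(3)
    finally show "ereal (- C) \<le> J_functional q \<mu> \<rho>" .
  qed
  show ?thesis
  proof (cases "m = \<infinity>")
    \<comment> \<open>An infinite infimum means that the functional is constantly infinite on
      \<open>P1\<close>, so any element is a minimizer; \<mu> is one at hand.\<close>
    case True
    then show ?thesis using m_le \<mu> by (intro bexI[of _ \<mu>]) (auto simp: top_unique)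
  next
    case False
    then obtain m0 where m0: "m = ereal m0" using \<open>ereal (- C) \<le> m\<close> by (cases m) auto
    have "\<exists>\<rho>\<in>P1. (\<integral>x. x \<partial>\<rho>) = 0 \<and> J_functional q \<mu> \<rho> < ereal (m0 + 1 / Suc k)" for k
    proof -
      have "m < ereal (m0 + 1 / Suc k)" by (simp add: m0)
      then obtain \<rho> where "\<rho> \<in> P1" "J_functional q \<mu> \<rho> < ereal (m0 + 1 / Suc k)"
        unfolding m_def INF_less_iff by blast
      then show ?thesis using center[of \<rho>] by (meson le_less_trans)
    qed
    then obtain \<rho> where \<rho>: "\<And>k. \<rho> k \<in> P1" "\<And>k. (\<integral>x. x \<partial>\<rho> k) = 0"
      "\<And>k. J_functional q \<mu> (\<rho> k) < ereal (m0 + 1 / Suc k)" by metis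
    \<comment> \<open>The coercive bound at the level m0 + 1, which dominates the whole sequence,
      solved for the first moment.\<close>
    define M where "M = max 0 ((m0 + 1 + C) / (c / 2))"
    have M: "0 \<le> M" by (simp add: M_def)
    have momk: "(\<integral>\<^sup>+x. ennreal (norm x) \<partial>\<rho> k) \<le> ennreal M" for k
    proof -
      have "ereal (c / 2 * (\<integral>x. norm x \<partial>\<rho> k) - C) < ereal (m0 + 1 / Suc k)"
        using coercive[OF \<rho>(1,2)] \<rho>(3) by (rule le_less_trans)
      then have "c / 2 * (\<integral>x. norm x \<partial>\<rho> k) < m0 + 1 / Suc k + C" by simp
      moreover have "1 / real (Suc k) \<le> 1" by simp
      ultimately have "c / 2 * (\<integral>x. norm x \<partial>\<rho> k) \<le> m0 + 1 + C" by linarith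
      then have "(\<integral>x. norm x \<partial>\<rho> k) \<le> (m0 + 1 + C) / (c / 2)" using c by (simp add: field_simps)
      then show ?thesis unfolding mom[OF \<rho>(1)] M_def by (intro ennreal_leI) simp
    qed
    obtain r \<rho>' where r: "strict_mono r" and \<rho>': "prob_space \<rho>'" "sets \<rho>' = sets borel" and w: "weakly_converges (\<rho> \<circ> r) \<rho>'"
      by (rule weak_compactness[of \<rho> M]) (use P1_D[OF \<rho>(1)] momk M in auto)
    have \<rho>r: "(\<rho> \<circ> r) k \<in> P1" "(\<integral>x. x \<partial>(\<rho> \<circ> r) k) = 0" "prob_space ((\<rho> \<circ> r) k)" "sets ((\<rho> \<circ> r) k) = sets borel"
      "(\<integral>\<^sup>+x. ennreal (norm x) \<partial>(\<rho> \<circ> r) k) \<le> ennreal M" for k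
      using \<rho> P1_D[OF \<rho>(1)] momk by auto
    have "(\<integral>\<^sup>+x. ennreal (norm x) \<partial>\<rho>') \<le> ennreal M"
      by (rule weakly_converges_moment[OF \<rho>r(3,4,5) M \<rho>' w])
    then have \<rho>'P: "\<rho>' \<in> P1" using \<rho>' by (auto simp: P1_def intro: le_less_trans)
    have "J_functional q \<mu> \<rho>' \<le> ereal m0"
    proof (rule ccontr)
      assume "\<not> ?thesis"
      then have "ereal m0 < ereal (- E \<rho>') + T_functional \<rho>' \<mu>" by (simp add: J[OF \<rho>'P] not_le)
      then have "ereal (m0 + E \<rho>') < T_functional \<rho>' \<mu>"
        by (cases "T_functional \<rho>' \<mu>") auto
      then obtain t where t: "m0 + E \<rho>' < t" "ereal t < T_functional \<rho>' \<mu>"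
        using ereal_dense2 by (metis less_ereal.simps(1))
      \<comment> \<open>Half of this gap is spent on the energy; the other half is contradicted by
        the distance of the sequence to the infimum.\<close>
      define e where "e = t - m0 - E \<rho>'"
      have e: "0 < e / 2" using t by (simp add: e_def)
      have "power_energy \<alpha> \<rho>' < \<infinity>" by (simp add: E(1)[OF \<rho>'P])
      then have "\<forall>\<^sub>F k in sequentially. power_energy \<alpha> ((\<rho> \<circ> r) k) \<le> power_energy \<alpha> \<rho>' + ennreal (e / 2)"
        by (rule power_energy_usc[OF \<alpha> \<rho>r(3,4,5) M \<rho>' w _ e])
      moreover have "\<forall>\<^sub>F k in sequentially. ereal t < T_functional ((\<rho> \<circ> r) k) \<mu>"
        by (rule T_functional_lsc[OF \<rho>r(1) \<rho>'P \<mu> cen \<rho>r(2) w t(2)])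
      moreover have "\<forall>\<^sub>F k in sequentially. 1 / real (Suc k) < e / 2"
        using LIMSEQ_inverse_real_of_nat e by (intro order_tendstoD) (auto simp: inverse_eq_divide)
      ultimately have "\<forall>\<^sub>F k in sequentially. False"
      proof eventually_elim
        case (elim k)
        have "E (\<rho> (r k)) \<le> E \<rho>' + e / 2"
          using elim(1) E(1)[OF \<rho>(1)] E(1)[OF \<rho>'P] E0 e by (simp flip: ennreal_plus)
        then have "ereal (m0 + e / 2) \<le> ereal (- E (\<rho> (r k))) + ereal t" by (simp add: e_def field_simps)
        also have "\<dots> \<le> J_functional q \<mu> (\<rho> (r k))"
          unfolding J[OF \<rho>(1)] using elim(2) by (intro add_left_mono) simp
        also have "\<dots> < ereal (m0 + 1 / Suc (r k))" by (rule \<rho>(3))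
        finally have "e / 2 < 1 / Suc (r k)" by simp
        also have "\<dots> \<le> 1 / Suc k" using seq_suble[OF r, of k] by (intro divide_left_mono) auto
        finally show False using elim(3) by simp
      qed
      then show False by simp
    qed
    then show ?thesis using m_le \<rho>'P m0 by (intro bexI[of _ \<rho>']) (auto intro: order_trans)
  qed
qed

end
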